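(* Let $(X_n)_{n\in\mathbb{N}}$ be a sequence of random matrices with $X_n\in M_n^{sa}$, such that for every $n$, $X_n\in\mathcal{S}(d_n)$ for a sequence $d_n$ with $d_n=o(n^2)$. Assume $(X_n)_{n\in\mathbb{N}}$ has property $\mathcal{L}$. Then for any metric $d$ on the space of probability measures on $\mathbb{R}$ that metrizes weak convergence, \[ d\big(L_n^{\frac{1}{\sqrt{n}}X_n},\ \mathbb{E} L_n^{\frac{1}{\sqrt{n}}X_n}\big)\to 0 \quad\text{in probability}. \] In particular, if $\mathbb{E} L_n^{\frac{1}{\sqrt{n}}X_n}$ converges weakly to a probability measure $\mu$, then $L_n^{\frac{1}{\sqrt{n}}X_n}$ converges weakly in probability to $\mu$, i.e. $d(L_n^{\frac{1}{\sqrt{n}}X_n},\mu)\to 0$ in probability.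
   Context: $M_n^{sa}$ denotes the space of $n\times n$ complex Hermitian matrices. For a (random) Hermitian $n\times n$ matrix $X$ with eigenvalues $\lambda_1\le\dots\le\lambda_n$, the empirical spectral distribution is $L_n^X=\frac1n\sum_{i=1}^n\delta_{\lambda_i}$; its expectation $\mathbb{E}L_n^X$ is the deterministic probability measure with $\mathbb{E}L_n^X(A)=\mathbb{E}(L_n^X(A))$ for Borel $A$. A random $n\times m$ matrix $X$ satisfies $\mathcal{S}(d)$ if there is a partition $\{P_1,\dots,P_k\}$ of $\{1,\dots,n\}\times\{1,\dots,m\}$ such that the random vectors $Y_r=\{X_{ij}\}_{(i,j)\in P_r}$, $r=1,\dots,k$, are mutually independent and $|P_r|\le d$ for all $r$. A sequence of random matrices $X_n\in M_n$ has property $\mathcal{L}$ if for every $\varepsilon>0$, \[ \lim_{M\to\infty}\limsup_{n\to\infty}\mathbb{P}\Big(\frac1{n^2}\sum_{i,j=1}^n|(X_n)_{ij}|^2\mathbf{1}_{\{|(X_n)_{ij}|>M\}}>\varepsilon\Big)=0. \] *)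

theory Defs
  imports "HOL-Probability.Probability" "HOL-Library.Landau_Symbols"
    "Jordan_Normal_Form.Determinant" "Jordan_Normal_Form.Char_Poly"
begin

definition hermitian_mat :: "nat \<Rightarrow> complex mat \<Rightarrow> bool" where
  "hermitian_mat n A \<longleftrightarrow> A \<in> carrier_mat n n \<and>
     (\<forall>i<n. \<forall>j<n. A $$ (i,j) = cnj (A $$ (j,i)))"

definition eigvals :: "complex mat \<Rightarrow> real list" where
  "eigvals A = (SOME xs. sorted xs \<and> length xs = dim_row A \<and>
      char_poly A = (\<Prod>x\<leftarrow>xs. [:- complex_of_real x, 1:]))"

definition esd :: "complex mat \<Rightarrow> real measure" where
  "esd A = measure_of UNIV (sets borel)
     (\<lambda>S. ennreal ((\<Sum>x\<leftarrow>eigvals A. indicator S x) / real (dim_row A)))"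

definition mean_measure :: "'a measure \<Rightarrow> ('a \<Rightarrow> real measure) \<Rightarrow> real measure" where
  "mean_measure M L = measure_of UNIV (sets borel)
     (\<lambda>S. \<integral>\<^sup>+ \<omega>. emeasure (L \<omega>) S \<partial>M)"

definition satisfies_S :: "'a measure \<Rightarrow> nat \<Rightarrow> nat \<Rightarrow> ('a \<Rightarrow> complex mat) \<Rightarrow> nat \<Rightarrow> bool" where
  "satisfies_S M n m Y d \<longleftrightarrow> (\<exists>P. partition_on ({..<n} \<times> {..<m}) P \<and>
     (\<forall>B\<in>P. card B \<le> d) \<and>
     prob_space.indep_vars M (\<lambda>B. PiM B (\<lambda>_. borel)) (\<lambda>B \<omega>. restrict (\<lambda>p. Y \<omega> $$ p) B) P)"

definition property_L :: "(nat \<Rightarrow> 'a measure) \<Rightarrow> (nat \<Rightarrow> 'a \<Rightarrow> complex mat) \<Rightarrow> bool" where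
  "property_L M X \<longleftrightarrow> (\<forall>\<epsilon>>0.
     ((\<lambda>K::real. limsup (\<lambda>n. ereal (measure (M n) {\<omega> \<in> space (M n).
         (\<Sum>i<n. \<Sum>j<n. (cmod (X n \<omega> $$ (i,j)))\<^sup>2 * indicator {K<..} (cmod (X n \<omega> $$ (i,j))))
           / (real n)\<^sup>2 > \<epsilon>})))
      \<longlongrightarrow> 0) at_top)"

definition metrizes_weak_conv :: "(real measure \<Rightarrow> real measure \<Rightarrow> real) \<Rightarrow> bool" where
  "metrizes_weak_conv \<rho> \<longleftrightarrow>
     (\<forall>\<mu> \<nu>. real_distribution \<mu> \<longrightarrow> real_distribution \<nu> \<longrightarrow>
        0 \<le> \<rho> \<mu> \<nu> \<and> \<rho> \<mu> \<nu> = \<rho> \<nu> \<mu> \<and> (\<rho> \<mu> \<nu> = 0 \<longleftrightarrow> \<mu> = \<nu>)) \<and>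
     (\<forall>\<mu> \<nu> \<eta>. real_distribution \<mu> \<longrightarrow> real_distribution \<nu> \<longrightarrow> real_distribution \<eta> \<longrightarrow>
        \<rho> \<mu> \<eta> \<le> \<rho> \<mu> \<nu> + \<rho> \<nu> \<eta>) \<and>
     (\<forall>\<mu>s \<mu>. (\<forall>k. real_distribution (\<mu>s k)) \<longrightarrow> real_distribution \<mu> \<longrightarrow>
        ((\<lambda>k. \<rho> (\<mu>s k) \<mu>) \<longlonglongrightarrow> 0 \<longleftrightarrow> weak_conv_m \<mu>s \<mu>))"

end

theory Submission
  imports Defs "Jordan_Normal_Form.Schur_Decomposition" "HOL-Real_Asymp.Real_Asymp"
begin

text \<open>
  Weak convergence is tested on Stieltjes transforms \<open>s(z) = \<integral> 1/(x - z) d\<mu>\<close>, which for an empirical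
  spectral distribution are normalised resolvent traces. For entries truncated at level \<open>K\<close>, resampling
  one block changes the trace by \<open>tr (R\<^sup>2 \<Delta>)\<close> plus a remainder bounded by
  \<open>\<parallel>\<Delta>\<parallel>\<^sub>F\<^sup>2 / \<bar>Im z\<bar>\<^sup>3\<close>. Summed over the blocks, the squares of the linear terms are controlled by
  \<open>\<parallel>R\<^sup>2\<parallel>\<^sub>F\<^sup>2 \<le> n / \<bar>Im z\<bar>\<^sup>4\<close>, so the Efron--Stein inequality bounds the variance of \<open>s(z)\<close> by a constant
  times \<open>d / n\<^sup>2\<close>. Property \<open>\<L>\<close> removes the truncation and makes the mean spectral distributions tight;
  along a subsequence on which they converge weakly, the random ones converge to the same limit in
  probability.
\<close>

section \<open>The Efron--Stein inequality\<close>

text \<open>The second-order expansion is forced. The first-order bound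
  \<open>mtrace_resolvent_diff_le\<close> only shows that resampling a block \<open>B\<close>
  changes the square of s(z) by an amount of order K^2 |B| / n^2, and these add up to order K^2
  because the blocks cover n^2 positions. Only the linear term sees that different blocks test
  different entries of R^2, whose squares sum to order n rather than n for each block. Blocks need
  not be closed under transposition, so resampling one block destroys Hermitian symmetry; this is
  why both an entry of R^2 and its transpose occur in the block estimates. No moments are assumed,
  and property L speaks only of probabilities. Hence the variance is taken after truncation, and
  tails of the mean law are bounded separately on the event where the truncation error is large. The
  metric is arbitrary and comes with no modulus of continuity: Stieltjes transforms control it near
  a fixed law, while the mean law moves with n. Compactness supplies the fixed centre.\<close>

lemma power2_le_if_abs_le: "\<bar>x\<bar> \<le> c \<Longrightarrow> x\<^sup>2 \<le> c\<^sup>2" for x c :: real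
  by (metis abs_ge_zero power2_abs power_mono)

lemma (in prob_space) integrable_bounded:
  fixes h :: "'a \<Rightarrow> 'b::{banach, second_countable_topology}"
  assumes "h \<in> borel_measurable M" "\<And>x. x \<in> space M \<Longrightarrow> norm (h x) \<le> b"
  shows "integrable M h"
  using assms by (intro integrable_const_bound[where B=b]) auto

lemma (in prob_space) square_integral_le:
  fixes h :: "'a \<Rightarrow> real"
  assumes h: "h \<in> borel_measurable M" "\<And>x. x \<in> space M \<Longrightarrow> \<bar>h x\<bar> \<le> b"
  shows "(\<integral>x. h x \<partial>M)\<^sup>2 \<le> (\<integral>x. (h x)\<^sup>2 \<partial>M)"
proof -
  have i1: "integrable M h"
    using h by (intro integrable_bounded[where b=b]) auto
  have i2: "integrable M (\<lambda>x. (h x)\<^sup>2)"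
    using h by (intro integrable_bounded[where b="b\<^sup>2"]) (auto intro: power2_le_if_abs_le)
  have "0 \<le> variance h" by simp
  also have "\<dots> = (\<integral>x. (h x)\<^sup>2 \<partial>M) - (\<integral>x. h x \<partial>M)\<^sup>2"
    by (rule variance_eq[OF i1 i2])
  finally show ?thesis by simp
qed

text \<open>The deviation of \<open>g u\<close> from its mean is the average of
  \<open>g u - g v\<close> over an independent \<open>v\<close>, so Jensen applies in
  \<open>v\<close> alone and leaves a bound in \<open>u\<close>.\<close>

lemma (in prob_space) variance_le_oscillation:
  fixes g H :: "'a \<Rightarrow> real"
  assumes g: "g \<in> borel_measurable M" "\<And>x. x \<in> space M \<Longrightarrow> \<bar>g x\<bar> \<le> b"
    and H: "H \<in> borel_measurable M" "\<And>x. x \<in> space M \<Longrightarrow> \<bar>H x\<bar> \<le> c"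
    and osc: "\<And>u v. u \<in> space M \<Longrightarrow> v \<in> space M \<Longrightarrow> (g u - g v)\<^sup>2 \<le> H u"
  shows "(\<integral>x. (g x)\<^sup>2 \<partial>M) - (\<integral>x. g x \<partial>M)\<^sup>2 \<le> (\<integral>x. H x \<partial>M)"
proof -
  have i1: "integrable M g"
    using g by (intro integrable_bounded[where b=b]) auto
  have iH: "integrable M H"
    using H by (intro integrable_bounded[where b=c]) auto
  have i2: "integrable M (\<lambda>x. (g x)\<^sup>2)"
    using g by (intro integrable_bounded[where b="b\<^sup>2"]) (auto intro: power2_le_if_abs_le)
  have pt: "(g u - (\<integral>x. g x \<partial>M))\<^sup>2 \<le> H u" if u: "u \<in> space M" for u
  proof -
    have m: "(\<lambda>v. g u - g v) \<in> borel_measurable M" using g by auto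
    have bd: "\<bar>g u - g v\<bar> \<le> 2 * b" if "v \<in> space M" for v
      using g(2)[OF u] g(2)[OF that] by linarith
    have "g u - (\<integral>x. g x \<partial>M) = (\<integral>v. g u - g v \<partial>M)"
      using i1 by (simp add: prob_space)
    then have "(g u - (\<integral>x. g x \<partial>M))\<^sup>2 \<le> (\<integral>v. (g u - g v)\<^sup>2 \<partial>M)"
      using square_integral_le[OF m bd] by simp
    also have "\<dots> \<le> (\<integral>v. H u \<partial>M)"
    proof (rule integral_mono)
      show "integrable M (\<lambda>v. (g u - g v)\<^sup>2)"
        using m power2_le_if_abs_le[OF bd] by (intro integrable_bounded[where b="(2*b)\<^sup>2"]) auto
    qed (use osc u in auto)
    finally show ?thesis by (simp add: prob_space)
  qed
  have "(\<integral>x. (g x)\<^sup>2 \<partial>M) - (\<integral>x. g x \<partial>M)\<^sup>2 = variance g"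
    by (rule variance_eq[OF i1 i2, symmetric])
  also have "\<dots> \<le> (\<integral>x. H x \<partial>M)"
  proof (rule integral_mono)
    have "integrable M (\<lambda>x. (g x)\<^sup>2 - 2 * (\<integral>x. g x \<partial>M) * g x + (\<integral>x. g x \<partial>M)\<^sup>2)"
      using i1 i2 by auto
    then show "integrable M (\<lambda>x. (g x - expectation g)\<^sup>2)"
      by (simp add: power2_diff algebra_simps)
  qed (use iH pt in auto)
  finally show ?thesis .
qed

text \<open>Induction on the coordinates by the law of total variance: the variance in the new
  coordinate is controlled by \<open>variance_le_oscillation\<close>, and averaging over that
  coordinate preserves the oscillation hypothesis for the others by Jensen. The bound
  \<open>G i\<close> sees the original point and not the replacement \<open>v\<close>; this lets all
  blocks later share the resolvent of one matrix.\<close>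

lemma efron_stein:
  fixes f :: "('i \<Rightarrow> 'b) \<Rightarrow> real" and G :: "'i \<Rightarrow> ('i \<Rightarrow> 'b) \<Rightarrow> real"
  assumes N: "\<And>i. prob_space (N i)" and "finite I"
    and f: "f \<in> borel_measurable (PiM I N)" "\<And>x. x \<in> space (PiM I N) \<Longrightarrow> \<bar>f x\<bar> \<le> b"
    and G: "\<And>i. i \<in> I \<Longrightarrow> G i \<in> borel_measurable (PiM I N)"
      "\<And>i x. i \<in> I \<Longrightarrow> x \<in> space (PiM I N) \<Longrightarrow> \<bar>G i x\<bar> \<le> c"
    and osc: "\<And>i x v. i \<in> I \<Longrightarrow> x \<in> space (PiM I N) \<Longrightarrow> v \<in> space (N i) \<Longrightarrow>
      (f x - f (x(i := v)))\<^sup>2 \<le> G i x"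
  shows "(\<integral>x. (f x)\<^sup>2 \<partial>PiM I N) - (\<integral>x. f x \<partial>PiM I N)\<^sup>2 \<le> (\<Sum>i\<in>I. \<integral>x. G i x \<partial>PiM I N)"
  using \<open>finite I\<close> f G osc
proof (induction I arbitrary: f G rule: finite_induct)
  case empty
  interpret product_prob_space N by (simp add: N product_prob_space.intro product_prob_space_axioms_def product_sigma_finite_def prob_space_imp_sigma_finite)
  show ?case by (simp add: PiM_empty lebesgue_integral_count_space_finite)
next
  case (insert j I)
  interpret product_prob_space N by (simp add: N product_prob_space.intro product_prob_space_axioms_def product_sigma_finite_def prob_space_imp_sigma_finite)
  note j_integrable_bounded = prob_space.integrable_bounded[OF N[of j]]
  interpret PI: prob_space "PiM I N" by (intro prob_space_PiM N)
  interpret PJ: prob_space "PiM (insert j I) N" by (intro prob_space_PiM N)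
  note [measurable] = insert.prems(1)
  have upd: "x(j := u) \<in> space (PiM (insert j I) N)" if "x \<in> space (PiM I N)" "u \<in> space (N j)" for x u
    using that insert.hyps by (auto simp: space_PiM PiE_iff extensional_def)
  have mupd[measurable]: "(\<lambda>(x, u). x(j := u)) \<in> PiM I N \<Otimes>\<^sub>M N j \<rightarrow>\<^sub>M PiM (insert j I) N"
    by (rule measurable_add_dim)
  have mupd1: "(\<lambda>u. x(j := u)) \<in> N j \<rightarrow>\<^sub>M PiM (insert j I) N" if "x \<in> space (PiM I N)" for x
    using measurable_compose[OF measurable_Pair1'[OF that] mupd] by simp
  \<comment> \<open>Fubini for splitting off coordinate \<open>j\<close>, stated for every bounded
    measurable \<open>F\<close> since it is applied to \<open>f\<close>, to its square and to each
    \<open>G i\<close>.\<close>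
  have int_ins: "(\<integral>x. F x \<partial>PiM (insert j I) N) = (\<integral>x. \<integral>u. F (x(j:=u)) \<partial>N j \<partial>PiM I N)"
    and int_bd: "\<And>x. x \<in> space (PiM I N) \<Longrightarrow> \<bar>\<integral>u. F (x(j:=u)) \<partial>N j\<bar> \<le> b'"
    and int_meas: "(\<lambda>x. \<integral>u. F (x(j:=u)) \<partial>N j) \<in> borel_measurable (PiM I N)"
    and int_j: "\<And>x. x \<in> space (PiM I N) \<Longrightarrow> integrable (N j) (\<lambda>u. F (x(j:=u)))"
    if F: "F \<in> borel_measurable (PiM (insert j I) N)" "\<And>x. x \<in> space (PiM (insert j I) N) \<Longrightarrow> \<bar>F x\<bar> \<le> b'"
    for F :: "('i \<Rightarrow> 'b) \<Rightarrow> real" and b'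
  proof -
    have "integrable (PiM (insert j I) N) F"
      using F by (intro PJ.integrable_bounded[where b=b']) auto
    then show "(\<integral>x. F x \<partial>PiM (insert j I) N) = (\<integral>x. \<integral>u. F (x(j:=u)) \<partial>N j \<partial>PiM I N)"
      by (rule product_integral_insert[OF insert.hyps])
    show ij: "integrable (N j) (\<lambda>u. F (x(j:=u)))" if "x \<in> space (PiM I N)" for x
      using F upd[OF that] measurable_compose[OF mupd1[OF that] F(1)] by (intro j_integrable_bounded[where b=b']) auto
    show "\<bar>\<integral>u. F (x(j:=u)) \<partial>N j\<bar> \<le> b'" if "x \<in> space (PiM I N)" for x
    proof -
      have "norm (\<integral>u. F (x(j:=u)) \<partial>N j) \<le> (\<integral>u. norm (F (x(j:=u))) \<partial>N j)"
        by (rule integral_norm_bound)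
      also have "\<dots> \<le> (\<integral>u. b' \<partial>N j)"
        using ij[OF that] F(2) upd[OF that] by (intro integral_mono) auto
      finally show ?thesis by (simp add: prob_space.prob_space[OF N])
    qed
    have "(\<lambda>(x,u). F (x(j:=u))) \<in> borel_measurable (PiM I N \<Otimes>\<^sub>M N j)"
      using measurable_compose[OF mupd F(1)] by (simp add: case_prod_beta)
    then show "(\<lambda>x. \<integral>u. F (x(j:=u)) \<partial>N j) \<in> borel_measurable (PiM I N)"
      by (rule sigma_finite_measure.borel_measurable_lebesgue_integral[OF prob_space_imp_sigma_finite[OF N]])
  qed
  \<comment> \<open>\<open>h\<close> and \<open>q\<close> are the conditional first and second
    moments of \<open>f\<close> given the old coordinates.\<close>
  define h where "h x = (\<integral>u. f (x(j:=u)) \<partial>N j)" for x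
  define q where "q x = (\<integral>u. (f (x(j:=u)))\<^sup>2 \<partial>N j)" for x
  define G' where "G' i x = (\<integral>u. G i (x(j:=u)) \<partial>N j)" for i x
  note fm = insert.prems(1) and fb = insert.prems(2)
  have b0: "0 \<le> b"
    using fb PJ.not_empty by (meson abs_ge_zero all_not_in_conv order_trans)
  have f2m: "(\<lambda>x. (f x)\<^sup>2) \<in> borel_measurable (PiM (insert j I) N)" by measurable
  have f2b: "\<bar>(f x)\<^sup>2\<bar> \<le> b\<^sup>2" if "x \<in> space (PiM (insert j I) N)" for x
    using fb[OF that] b0 by (simp add: power2_le_iff_abs_le)
  have h: "h \<in> borel_measurable (PiM I N)" "\<And>x. x \<in> space (PiM I N) \<Longrightarrow> \<bar>h x\<bar> \<le> b"
    unfolding h_def by (rule int_meas[OF fm fb], simp, rule int_bd[OF fm fb])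
  have q: "q \<in> borel_measurable (PiM I N)" "\<And>x. x \<in> space (PiM I N) \<Longrightarrow> \<bar>q x\<bar> \<le> b\<^sup>2"
    unfolding q_def by (rule int_meas[OF f2m f2b], simp, rule int_bd[OF f2m f2b])
  have G': "G' i \<in> borel_measurable (PiM I N)" "\<And>x. x \<in> space (PiM I N) \<Longrightarrow> \<bar>G' i x\<bar> \<le> c"
    "(\<integral>x. G i x \<partial>PiM (insert j I) N) = (\<integral>x. G' i x \<partial>PiM I N)"
    if "i \<in> insert j I" for i
    unfolding G'_def using int_meas[OF insert.prems(3,4)[OF that]] int_bd[OF insert.prems(3,4)[OF that]]
      int_ins[OF insert.prems(3,4)[OF that]] by blast+
  have IH: "(\<integral>x. (h x)\<^sup>2 \<partial>PiM I N) - (\<integral>x. h x \<partial>PiM I N)\<^sup>2 \<le> (\<Sum>i\<in>I. \<integral>x. G' i x \<partial>PiM I N)"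
  proof (rule insert.IH)
    fix i x v assume i: "i \<in> I" and x: "x \<in> space (PiM I N)" and v: "v \<in> space (N i)"
    have ij: "i \<noteq> j" using i insert.hyps by auto
    have xv: "x(i := v) \<in> space (PiM I N)"
      using i x v by (auto simp: space_PiM PiE_iff extensional_def)
    have m: "(\<lambda>u. f (x(j:=u)) - f (x(i:=v, j:=u))) \<in> borel_measurable (N j)"
      by (intro borel_measurable_diff measurable_compose[OF mupd1[OF x] fm] measurable_compose[OF mupd1[OF xv] fm])
    have bd: "\<bar>f (x(j:=u)) - f (x(i:=v, j:=u))\<bar> \<le> 2 * b" if "u \<in> space (N j)" for u
      using fb[OF upd[OF x that]] fb[OF upd[OF xv that]] by linarith
    have "h x - h (x(i:=v)) = (\<integral>u. f (x(j:=u)) - f (x(i:=v, j:=u)) \<partial>N j)"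
      unfolding h_def
      by (rule Bochner_Integration.integral_diff[OF int_j[OF fm fb x] int_j[OF fm fb xv], symmetric])
    then have "(h x - h (x(i:=v)))\<^sup>2 \<le> (\<integral>u. (f (x(j:=u)) - f (x(i:=v, j:=u)))\<^sup>2 \<partial>N j)"
      using prob_space.square_integral_le[OF N m bd] by simp
    also have "\<dots> \<le> G' i x"
      unfolding G'_def
    proof (rule integral_mono)
      show "integrable (N j) (\<lambda>u. (f (x(j:=u)) - f (x(i:=v, j:=u)))\<^sup>2)"
        using m power2_le_if_abs_le[OF bd] by (intro j_integrable_bounded[where b="(2*b)\<^sup>2"]) auto
      show "integrable (N j) (\<lambda>u. G i (x(j := u)))"
        using int_j[OF insert.prems(3,4) x] i by blast
      fix u assume "u \<in> space (N j)"
      from insert.prems(5)[OF insertI2[OF i] upd[OF x this] v]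
      show "(f (x(j:=u)) - f (x(i:=v, j:=u)))\<^sup>2 \<le> G i (x(j := u))"
        unfolding fun_upd_twist[OF ij] .
    qed
    finally show "(h x - h (x(i := v)))\<^sup>2 \<le> G' i x" .
  qed (use h G' in auto)
  \<comment> \<open>With the old coordinates frozen this is the one-variable case.\<close>
  have J: "q x - (h x)\<^sup>2 \<le> G' j x" if x: "x \<in> space (PiM I N)" for x
    unfolding q_def h_def G'_def
  proof (rule prob_space.variance_le_oscillation[OF N])
    show "(\<lambda>u. f (x(j:=u))) \<in> borel_measurable (N j)" "(\<lambda>u. G j (x(j:=u))) \<in> borel_measurable (N j)"
      using measurable_compose[OF mupd1[OF x]] fm insert.prems(3) by blast+
    fix u assume u: "u \<in> space (N j)"
    show "\<bar>f (x(j := u))\<bar> \<le> b" "\<bar>G j (x(j := u))\<bar> \<le> c"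
      by (rule fb[OF upd[OF x u]], rule insert.prems(4)[OF insertI1 upd[OF x u]])
    fix v assume v: "v \<in> space (N j)"
    show "(f (x(j := u)) - f (x(j := v)))\<^sup>2 \<le> G j (x(j := u))"
      using insert.prems(5)[OF insertI1 upd[OF x u] v] unfolding fun_upd_upd .
  qed
  have ih2: "integrable (PiM I N) (\<lambda>x. (h x)\<^sup>2)"
    using h b0 by (intro PI.integrable_bounded[where b="b\<^sup>2"]) (auto simp: power2_le_iff_abs_le)
  have iq: "integrable (PiM I N) q"
    using q by (intro PI.integrable_bounded[where b="b\<^sup>2"]) auto
  have "(\<integral>x. q x - (h x)\<^sup>2 \<partial>PiM I N) \<le> (\<integral>x. G' j x \<partial>PiM I N)"
  proof (rule integral_mono)
    show "integrable (PiM I N) (G' j)"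
      using G'[of j] by (intro PI.integrable_bounded[where b=c]) auto
  qed (use iq ih2 J in auto)
  then have "(\<integral>x. q x \<partial>PiM I N) - (\<integral>x. (h x)\<^sup>2 \<partial>PiM I N) \<le> (\<integral>x. G' j x \<partial>PiM I N)"
    using iq ih2 by simp
  \<comment> \<open>Total variance: E q - (E h)^2 = E (q - h^2) + (E h^2 - (E h)^2), the first part
    bounded by the term for \<open>j\<close>, the second by induction.\<close>
  with IH have "(\<integral>x. q x \<partial>PiM I N) - (\<integral>x. h x \<partial>PiM I N)\<^sup>2 \<le> (\<Sum>i\<in>insert j I. \<integral>x. G' i x \<partial>PiM I N)"
    using insert.hyps by simp
  moreover have "(\<integral>x. (f x)\<^sup>2 \<partial>PiM (insert j I) N) = (\<integral>x. q x \<partial>PiM I N)"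
    unfolding q_def by (rule int_ins[OF f2m f2b])
  moreover have "(\<integral>x. f x \<partial>PiM (insert j I) N) = (\<integral>x. h x \<partial>PiM I N)"
    unfolding h_def by (rule int_ins[OF fm fb])
  moreover have "(\<Sum>i\<in>insert j I. \<integral>x. G' i x \<partial>PiM I N) = (\<Sum>i\<in>insert j I. \<integral>x. G i x \<partial>PiM (insert j I) N)"
    using G'(3) by (intro sum.cong) auto
  ultimately show ?case by simp
qed

section \<open>Resolvents of Hermitian matrices\<close>

definition frob_sq :: "complex mat \<Rightarrow> real" where
  "frob_sq A = (\<Sum>p\<in>{..<dim_row A} \<times> {..<dim_col A}. (cmod (A $$ p))\<^sup>2)"

definition mtrace :: "complex mat \<Rightarrow> complex" where
  "mtrace A = (\<Sum>i<dim_row A. A $$ (i,i))"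

definition shift_mat :: "complex mat \<Rightarrow> complex \<Rightarrow> complex mat" where
  "shift_mat A z = A - z \<cdot>\<^sub>m 1\<^sub>m (dim_row A)"

definition resolvent :: "complex mat \<Rightarrow> complex \<Rightarrow> complex mat" where
  "resolvent A z = (SOME R. R \<in> carrier_mat (dim_row A) (dim_row A) \<and>
     shift_mat A z * R = 1\<^sub>m (dim_row A) \<and> R * shift_mat A z = 1\<^sub>m (dim_row A))"

lemma frob_sq_nonneg [simp]: "0 \<le> frob_sq A"
  by (simp add: frob_sq_def sum_nonneg)

lemma frob_sq_carrier:
  "A \<in> carrier_mat n m \<Longrightarrow> frob_sq A = (\<Sum>p\<in>{..<n} \<times> {..<m}. (cmod (A $$ p))\<^sup>2)"
  unfolding frob_sq_def by (metis carrier_matD)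

lemma mult_mat_index:
  fixes A B :: "complex mat"
  assumes "A \<in> carrier_mat n m" "B \<in> carrier_mat m k" "i < n" "j < k"
  shows "(A * B) $$ (i,j) = (\<Sum>l<m. A $$ (i,l) * B $$ (l,j))"
  using assms by (auto simp: scalar_prod_def atLeast0LessThan intro!: sum.cong)

lemma mtrace_mult:
  assumes "A \<in> carrier_mat n m" "B \<in> carrier_mat m n"
  shows "mtrace (A * B) = (\<Sum>(i,j)\<in>{..<n} \<times> {..<m}. A $$ (i,j) * B $$ (j,i))"
  using assms mult_mat_index[OF assms] by (simp add: mtrace_def sum.cartesian_product[symmetric])

lemma mtrace_mult_commute:
  assumes "A \<in> carrier_mat n m" "B \<in> carrier_mat m n"
  shows "mtrace (A * B) = mtrace (B * A)"
  unfolding mtrace_mult[OF assms] mtrace_mult[OF assms(2,1)]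
  unfolding sum.cartesian_product[symmetric]
  by (subst sum.swap) (simp add: mult.commute)

lemma mtrace_diff:
  "A \<in> carrier_mat n n \<Longrightarrow> B \<in> carrier_mat n n \<Longrightarrow> mtrace (A - B) = mtrace A - mtrace B"
  by (simp add: mtrace_def sum_subtractf)

lemma norm_sum_mult_le:
  fixes a b :: "'i \<Rightarrow> complex"
  shows "cmod (\<Sum>i\<in>S. a i * b i) \<le> sqrt (\<Sum>i\<in>S. (cmod (a i))\<^sup>2) * sqrt (\<Sum>i\<in>S. (cmod (b i))\<^sup>2)"
proof -
  have "cmod (\<Sum>i\<in>S. a i * b i) \<le> (\<Sum>i\<in>S. \<bar>cmod (a i)\<bar> * \<bar>cmod (b i)\<bar>)"
    by (rule order_trans[OF norm_sum]) (simp add: norm_mult)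
  also have "\<dots> \<le> L2_set (\<lambda>i. cmod (a i)) S * L2_set (\<lambda>i. cmod (b i)) S"
    by (rule L2_set_mult_ineq)
  finally show ?thesis by (simp add: L2_set_def)
qed

lemma sum_transpose:
  "(\<Sum>p\<in>{..<n} \<times> {..<m}. f p) = (\<Sum>(i,j)\<in>{..<m} \<times> {..<n}. f (j,i))"
  for f :: "nat \<times> nat \<Rightarrow> 'a::comm_monoid_add"
  by (rule sum.reindex_bij_witness[where i="\<lambda>(i,j). (j,i)" and j="\<lambda>(i,j). (j,i)"]) auto

lemma norm_mtrace_mult_le:
  assumes "A \<in> carrier_mat n m" "B \<in> carrier_mat m n"
  shows "cmod (mtrace (A * B)) \<le> sqrt (frob_sq A) * sqrt (frob_sq B)"
proof -
  have "mtrace (A * B) = (\<Sum>p\<in>{..<n} \<times> {..<m}. A $$ p * B $$ (prod.swap p))"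
    unfolding mtrace_mult[OF assms] by (rule sum.cong) auto
  then have "cmod (mtrace (A * B)) \<le> sqrt (\<Sum>p\<in>{..<n} \<times> {..<m}. (cmod (A $$ p))\<^sup>2) *
      sqrt (\<Sum>p\<in>{..<n} \<times> {..<m}. (cmod (B $$ (prod.swap p)))\<^sup>2)"
    by (simp only: norm_sum_mult_le)
  also have "(\<Sum>p\<in>{..<n} \<times> {..<m}. (cmod (B $$ (prod.swap p)))\<^sup>2) = frob_sq B"
    unfolding frob_sq_carrier[OF assms(2)] by (subst sum_transpose) (auto intro!: sum.cong)
  finally show ?thesis using frob_sq_carrier[OF assms(1)] by simp
qed

text \<open>The quadratic form of a Hermitian matrix is real, so the imaginary part of
  \<open>\<langle>w, (A - z) w\<rangle>\<close> is \<open>- Im z \<parallel>w\<parallel>\<^sup>2\<close>.\<close>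
lemma hermitian_shift_bound:
  fixes a :: "nat \<Rightarrow> nat \<Rightarrow> complex"
  assumes herm: "\<And>i j. i < n \<Longrightarrow> j < n \<Longrightarrow> a i j = cnj (a j i)"
    and v: "\<And>i. i < n \<Longrightarrow> v i = (\<Sum>j<n. a i j * w j) - z * w i"
  shows "(Im z)\<^sup>2 * (\<Sum>i<n. (cmod (w i))\<^sup>2) \<le> (\<Sum>i<n. (cmod (v i))\<^sup>2)"
proof -
  define W where "W = (\<Sum>i<n. (cmod (w i))\<^sup>2)"
  define V where "V = (\<Sum>i<n. (cmod (v i))\<^sup>2)"
  define q where "q = (\<Sum>i<n. \<Sum>j<n. cnj (w i) * a i j * w j)"
  have W0: "0 \<le> W" and V0: "0 \<le> V" by (auto simp: W_def V_def sum_nonneg)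
  have "cnj q = (\<Sum>i<n. \<Sum>j<n. w i * cnj (a i j) * cnj (w j))"
    by (simp add: q_def)
  also have "\<dots> = (\<Sum>i<n. \<Sum>j<n. w i * a j i * cnj (w j))"
    using herm[symmetric] by (intro sum.cong refl) simp
  also have "\<dots> = q"
    unfolding q_def by (subst sum.swap) (simp add: mult_ac)
  finally have q_real: "Im q = 0"
    by (simp add: complex_eq_iff)
  have "(\<Sum>i<n. cnj (w i) * v i) = (\<Sum>i<n. (\<Sum>j<n. cnj (w i) * a i j * w j) - z * complex_of_real ((cmod (w i))\<^sup>2))"
  proof (intro sum.cong refl)
    fix i assume "i \<in> {..<n}"
    then have "cnj (w i) * v i = cnj (w i) * (\<Sum>j<n. a i j * w j) - z * (w i * cnj (w i))"
      using v by (simp add: right_diff_distrib mult_ac)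
    then show "cnj (w i) * v i = (\<Sum>j<n. cnj (w i) * a i j * w j) - z * complex_of_real ((cmod (w i))\<^sup>2)"
      by (simp add: sum_distrib_left mult.assoc flip: complex_norm_square)
  qed
  also have "\<dots> = q - z * complex_of_real W"
    by (simp add: sum_subtractf q_def W_def sum_distrib_left)
  finally have "Im (\<Sum>i<n. cnj (w i) * v i) = - (Im z * W)"
    using q_real by simp
  then have "\<bar>Im z\<bar> * W \<le> cmod (\<Sum>i<n. cnj (w i) * v i)"
    using abs_Im_le_cmod[of "\<Sum>i<n. cnj (w i) * v i"] W0 by (simp add: abs_mult)
  also have "\<dots> \<le> sqrt W * sqrt V"
    using norm_sum_mult_le[of "\<lambda>i. cnj (w i)" v "{..<n}"] by (simp add: W_def V_def)
  finally have "\<bar>Im z\<bar> * sqrt W * sqrt W \<le> sqrt W * sqrt V"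
    using W0 by (simp add: mult.assoc)
  \<comment> \<open>One factor \<open>sqrt W\<close> is cancelled; for \<open>W = 0\<close> the left
    side vanishes.\<close>
  then have "\<bar>Im z\<bar> * sqrt W \<le> sqrt V"
    using W0 V0 by (cases "W = 0") (auto simp: mult.commute[of "sqrt W"])
  then have "(\<bar>Im z\<bar> * sqrt W)\<^sup>2 \<le> (sqrt V)\<^sup>2"
    using W0 by (intro power_mono) auto
  then show ?thesis
    using W0 V0 by (simp add: power_mult_distrib W_def[symmetric] V_def[symmetric])
qed

section \<open>Shifted Hermitian matrices and their inverses\<close>

lemma hermitian_matD:
  assumes "hermitian_mat n A"
  shows "A \<in> carrier_mat n n" "dim_row A = n" "dim_col A = n"
  using assms unfolding hermitian_mat_def by blast+

lemma hermitian_mat_cnj: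
  assumes "hermitian_mat n A" "i < n" "j < n"
  shows "A $$ (i,j) = cnj (A $$ (j,i))"
  using assms unfolding hermitian_mat_def by blast

lemma shift_mat_carrier [simp]: "A \<in> carrier_mat n n \<Longrightarrow> shift_mat A z \<in> carrier_mat n n"
  by (auto simp: shift_mat_def)

lemma dim_shift_mat [simp]: "dim_row (shift_mat A z) = dim_row A" "dim_col (shift_mat A z) = dim_row A"
  by (auto simp: shift_mat_def)

lemma shift_mat_index:
  "A \<in> carrier_mat n n \<Longrightarrow> i < n \<Longrightarrow> j < n \<Longrightarrow>
    shift_mat A z $$ (i,j) = A $$ (i,j) - (if i = j then z else 0)"
  by (auto simp: shift_mat_def)

text \<open>Column by column application of \<open>hermitian_shift_bound\<close>. Together with the
  row version below it plays the part of the operator norm bound 1 / |Im z| for the resolvent,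
  expressed through Frobenius norms.\<close>

lemma frob_sq_shift_mult_le:
  assumes A: "hermitian_mat n A" and W: "W \<in> carrier_mat n n"
  shows "(Im z)\<^sup>2 * frob_sq W \<le> frob_sq (shift_mat A z * W)"
proof -
  note AD = hermitian_matD[OF A]
  have c: "shift_mat A z * W \<in> carrier_mat n n"
    by (rule mult_carrier_mat[OF shift_mat_carrier[OF AD(1)] W])
  have "(Im z)\<^sup>2 * (\<Sum>i<n. (cmod (W $$ (i,j)))\<^sup>2) \<le> (\<Sum>i<n. (cmod ((shift_mat A z * W) $$ (i,j)))\<^sup>2)"
    if j: "j < n" for j
  proof (rule hermitian_shift_bound[where a="\<lambda>i j. A $$ (i,j)"])
    fix i assume i: "i < n"
    have "(shift_mat A z * W) $$ (i,j) = (\<Sum>l<n. shift_mat A z $$ (i,l) * W $$ (l,j))"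
      using AD W i j by (intro mult_mat_index) auto
    also have "\<dots> = (\<Sum>l<n. A $$ (i,l) * W $$ (l,j) - (if l = i then z * W $$ (l,j) else 0))"
      using AD i by (intro sum.cong) (auto simp: shift_mat_index algebra_simps)
    also have "\<dots> = (\<Sum>l<n. A $$ (i,l) * W $$ (l,j)) - z * W $$ (i,j)"
      using i by (simp add: sum_subtractf sum.delta)
    finally show "(shift_mat A z * W) $$ (i,j) = (\<Sum>l<n. A $$ (i,l) * W $$ (l,j)) - z * W $$ (i,j)" .
  qed (rule hermitian_mat_cnj[OF A])
  then have "(Im z)\<^sup>2 * (\<Sum>j<n. \<Sum>i<n. (cmod (W $$ (i,j)))\<^sup>2) \<le> (\<Sum>j<n. \<Sum>i<n. (cmod ((shift_mat A z * W) $$ (i,j)))\<^sup>2)"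
    by (subst sum_distrib_left) (intro sum_mono, simp)
  then show ?thesis
    unfolding frob_sq_carrier[OF W] frob_sq_carrier[OF c]
    by (subst (1 2) sum_transpose) (simp add: sum.cartesian_product)
qed

lemma frob_sq_mult_shift_le:
  assumes A: "hermitian_mat n A" and W: "W \<in> carrier_mat n n"
  shows "(Im z)\<^sup>2 * frob_sq W \<le> frob_sq (W * shift_mat A z)"
proof -
  note AD = hermitian_matD[OF A]
  have c: "W * shift_mat A z \<in> carrier_mat n n"
    by (rule mult_carrier_mat[OF W shift_mat_carrier[OF AD(1)]])
  \<comment> \<open>Since \<open>A\<close> is Hermitian, conjugating row \<open>i\<close> of W (A -
    z) gives A - cnj z applied to the conjugated row of \<open>W\<close>, so the vector bound
    applies at \<open>cnj z\<close>.\<close>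
  have "(Im (cnj z))\<^sup>2 * (\<Sum>j<n. (cmod (cnj (W $$ (i,j))))\<^sup>2) \<le> (\<Sum>j<n. (cmod (cnj ((W * shift_mat A z) $$ (i,j))))\<^sup>2)"
    if i: "i < n" for i
  proof (rule hermitian_shift_bound[where a="\<lambda>i j. A $$ (i,j)"])
    fix j assume j: "j < n"
    have "(W * shift_mat A z) $$ (i,j) = (\<Sum>l<n. W $$ (i,l) * shift_mat A z $$ (l,j))"
      using AD W i j by (intro mult_mat_index) auto
    also have "\<dots> = (\<Sum>l<n. W $$ (i,l) * A $$ (l,j) - (if l = j then z * W $$ (i,l) else 0))"
      using AD j by (intro sum.cong) (auto simp: shift_mat_index algebra_simps)
    also have "\<dots> = (\<Sum>l<n. W $$ (i,l) * A $$ (l,j)) - z * W $$ (i,j)"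
      using j by (simp add: sum_subtractf sum.delta)
    finally have "cnj ((W * shift_mat A z) $$ (i,j)) = (\<Sum>l<n. cnj (A $$ (l,j)) * cnj (W $$ (i,l))) - cnj z * cnj (W $$ (i,j))"
      by (simp add: mult.commute)
    also have "(\<Sum>l<n. cnj (A $$ (l,j)) * cnj (W $$ (i,l))) = (\<Sum>l<n. A $$ (j,l) * cnj (W $$ (i,l)))"
      using hermitian_mat_cnj[OF A j] by (intro sum.cong) auto
    finally show "cnj ((W * shift_mat A z) $$ (i,j)) = (\<Sum>l<n. A $$ (j,l) * cnj (W $$ (i,l))) - cnj z * cnj (W $$ (i,j))" .
  qed (rule hermitian_mat_cnj[OF A])
  then have "(Im z)\<^sup>2 * (\<Sum>i<n. \<Sum>j<n. (cmod (W $$ (i,j)))\<^sup>2) \<le> (\<Sum>i<n. \<Sum>j<n. (cmod ((W * shift_mat A z) $$ (i,j)))\<^sup>2)"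
    by (subst sum_distrib_left) (intro sum_mono, simp)
  then show ?thesis
    unfolding frob_sq_carrier[OF W] frob_sq_carrier[OF c] 
    by (simp add: sum.cartesian_product)
qed

text \<open>The case \<open>v = 0\<close> of \<open>hermitian_shift_bound\<close>. It yields both
  the invertibility of A - z and the reality of the eigenvalues.\<close>

lemma hermitian_kernel_shift:
  assumes A: "hermitian_mat n A" and z: "Im z \<noteq> 0" and w: "w \<in> carrier_vec n" and 0: "A *\<^sub>v w = z \<cdot>\<^sub>v w"
  shows "w = 0\<^sub>v n"
proof -
  note AD = hermitian_matD[OF A]
  have "(Im z)\<^sup>2 * (\<Sum>i<n. (cmod (vec_index w i))\<^sup>2) \<le> (\<Sum>i<n. (cmod 0)\<^sup>2)"
  proof (rule hermitian_shift_bound[where a="\<lambda>i j. A $$ (i,j)" and v="\<lambda>_. 0" and w="vec_index w" and z=z])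
    fix i assume i: "i < n"
    have "vec_index (A *\<^sub>v w) i = (\<Sum>j<n. A $$ (i,j) * vec_index w j)"
      using AD w i by (auto simp: scalar_prod_def atLeast0LessThan intro!: sum.cong)
    then show "0 = (\<Sum>j<n. A $$ (i,j) * vec_index w j) - z * vec_index w i"
      using 0 w i by simp
  qed (rule hermitian_mat_cnj[OF A])
  then have "(\<Sum>i<n. (cmod (vec_index w i))\<^sup>2) \<le> 0"
    using z by (simp add: mult_le_0_iff not_le)
  then have "\<forall>i<n. vec_index w i = 0"
    using sum_nonneg_eq_0_iff[of "{..<n}" "\<lambda>i. (cmod (vec_index w i))\<^sup>2"]
    by (auto intro!: antisym sum_nonneg)
  then show ?thesis using w by (intro eq_vecI) auto
qed

lemma resolvent_hermitian:
  assumes A: "hermitian_mat n A" and z: "Im z \<noteq> 0"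
  shows "resolvent A z \<in> carrier_mat n n" "shift_mat A z * resolvent A z = 1\<^sub>m n"
    "resolvent A z * shift_mat A z = 1\<^sub>m n"
proof -
  note AD = hermitian_matD[OF A]
  have "det (shift_mat A z) \<noteq> 0"
  proof
    assume "det (shift_mat A z) = 0"
    then obtain w where w: "w \<in> carrier_vec n" "w \<noteq> 0\<^sub>v n" "shift_mat A z *\<^sub>v w = 0\<^sub>v n"
      using det_0_iff_vec_prod_zero_field[of "shift_mat A z" n] AD by auto
    have "A *\<^sub>v w = z \<cdot>\<^sub>v w"
    proof (rule eq_vecI)
      fix i assume "i < dim_vec (z \<cdot>\<^sub>v w)"
      then have i: "i < n" using w by simp
      have "0 = vec_index (shift_mat A z *\<^sub>v w) i" using w i by simp
      also have "\<dots> = (\<Sum>j<n. shift_mat A z $$ (i,j) * vec_index w j)"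
        using AD w(1) i by (auto simp: scalar_prod_def atLeast0LessThan intro!: sum.cong)
      also have "\<dots> = (\<Sum>j<n. A $$ (i,j) * vec_index w j - (if j = i then z * vec_index w j else 0))"
        using AD i by (intro sum.cong) (auto simp: shift_mat_index algebra_simps)
      also have "\<dots> = (\<Sum>j<n. A $$ (i,j) * vec_index w j) - z * vec_index w i"
        using i by (simp add: sum_subtractf sum.delta)
      also have "(\<Sum>j<n. A $$ (i,j) * vec_index w j) = vec_index (A *\<^sub>v w) i"
        using AD w i by (auto simp: scalar_prod_def atLeast0LessThan intro!: sum.cong)
      finally show "vec_index (A *\<^sub>v w) i = vec_index (z \<cdot>\<^sub>v w) i" using w i by simp
    qed (use w AD in auto)
    then show False using hermitian_kernel_shift[OF A z w(1)] w by auto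
  qed
  then have "\<exists>R. R \<in> carrier_mat (dim_row A) (dim_row A) \<and>
     shift_mat A z * R = 1\<^sub>m (dim_row A) \<and> R * shift_mat A z = 1\<^sub>m (dim_row A)"
    using det_non_zero_imp_unit[of "shift_mat A z" n "()"] AD
    by (auto simp: Units_def ring_mat_def)
  from someI_ex[OF this] AD
  show "resolvent A z \<in> carrier_mat n n" "shift_mat A z * resolvent A z = 1\<^sub>m n"
    "resolvent A z * shift_mat A z = 1\<^sub>m n"
    unfolding resolvent_def by auto
qed

text \<open>The shift bounds applied to R B and B R, which the shift carries back to
  \<open>B\<close>.\<close>

lemma frob_sq_resolvent_mult_le:
  assumes A: "hermitian_mat n A" and z: "Im z \<noteq> 0" and B: "B \<in> carrier_mat n n"
  shows "frob_sq (resolvent A z * B) \<le> frob_sq B / (Im z)\<^sup>2" "frob_sq (B * resolvent A z) \<le> frob_sq B / (Im z)\<^sup>2"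
proof -
  note AD = hermitian_matD[OF A] and R = resolvent_hermitian[OF A z]
  have "shift_mat A z * (resolvent A z * B) = B"
    using assoc_mult_mat[of "shift_mat A z" n n "resolvent A z" n B n] AD R B by simp
  then show "frob_sq (resolvent A z * B) \<le> frob_sq B / (Im z)\<^sup>2"
    using frob_sq_shift_mult_le[OF A, of "resolvent A z * B" z] R B z
    by (simp add: field_simps)
  have "(B * resolvent A z) * shift_mat A z = B"
    using assoc_mult_mat[of B n n "resolvent A z" n "shift_mat A z" n] AD R B by simp
  then show "frob_sq (B * resolvent A z) \<le> frob_sq B / (Im z)\<^sup>2"
    using frob_sq_mult_shift_le[OF A, of "B * resolvent A z" z] R B z
    by (simp add: field_simps)
qed

lemma frob_sq_one: "frob_sq (1\<^sub>m n) = real n"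
proof -
  have "frob_sq (1\<^sub>m n) = (\<Sum>i<n. \<Sum>j<n. (cmod ((1\<^sub>m n :: complex mat) $$ (i,j)))\<^sup>2)"
    unfolding sum.cartesian_product by (subst frob_sq_carrier[of _ n n]) (auto intro!: sum.cong)
  also have "\<dots> = (\<Sum>i<n. \<Sum>j<n. if j = i then 1 else 0)"
    by (intro sum.cong) auto
  finally show ?thesis by simp
qed

lemma frob_sq_resolvent_le:
  assumes A: "hermitian_mat n A" and z: "Im z \<noteq> 0"
  shows "frob_sq (resolvent A z) \<le> real n / (Im z)\<^sup>2"
    "frob_sq (resolvent A z * resolvent A z) \<le> real n / (Im z) ^ 4"
proof -
  note R = resolvent_hermitian[OF A z]
  show *: "frob_sq (resolvent A z) \<le> real n / (Im z)\<^sup>2"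
    using frob_sq_resolvent_mult_le(1)[OF A z, of "1\<^sub>m n"] R by (simp add: frob_sq_one)
  have "frob_sq (resolvent A z * resolvent A z) \<le> frob_sq (resolvent A z) / (Im z)\<^sup>2"
    by (rule frob_sq_resolvent_mult_le(1)[OF A z R(1)])
  also have "\<dots> \<le> real n / (Im z)\<^sup>2 / (Im z)\<^sup>2"
    by (intro divide_right_mono *) simp
  also have "\<dots> = real n / (Im z) ^ 4"
    by (simp add: power2_eq_square power4_eq_xxxx)
  finally show "frob_sq (resolvent A z * resolvent A z) \<le> real n / (Im z) ^ 4" .
qed

section \<open>Perturbation of the resolvent trace\<close>

lemma resolvent_identity:
  assumes A: "hermitian_mat n A" and B: "hermitian_mat n B" and z: "Im z \<noteq> 0"
  shows "resolvent B z = resolvent A z - resolvent B z * (B - A) * resolvent A z"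
proof -
  let ?R = "resolvent A z" and ?S = "resolvent B z"
  note AD = hermitian_matD[OF A] and R = resolvent_hermitian[OF A z]
  note BD = hermitian_matD[OF B] and S = resolvent_hermitian[OF B z]
  have D: "B - A = shift_mat B z - shift_mat A z"
    using AD BD by (intro eq_matI) (auto simp: shift_mat_index)
  have "?S * (B - A) * ?R = (?S * shift_mat B z - ?S * shift_mat A z) * ?R"
    unfolding D using AD BD R S by (subst mult_minus_distrib_mat[of _ n n _ n]) auto
  also have "\<dots> = ?S * shift_mat B z * ?R - ?S * shift_mat A z * ?R"
    using AD BD R S by (intro minus_mult_distrib_mat[of _ n n _ _ n]) auto
  also have "?S * shift_mat A z * ?R = ?S"
    using assoc_mult_mat[of ?S n n "shift_mat A z" n ?R n] AD R S by simp
  also have "?S * shift_mat B z * ?R = ?R"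
    using S R by simp
  finally show ?thesis
    using R S by (intro eq_matI) auto
qed

text \<open>First-order estimate by Cauchy-Schwarz on the trace of (S D) R, where D = B - A. It is
  sharp enough for truncation and for continuity in the entries.\<close>

lemma mtrace_resolvent_diff_le:
  assumes A: "hermitian_mat n A" and B: "hermitian_mat n B" and z: "Im z \<noteq> 0"
  shows "cmod (mtrace (resolvent B z) - mtrace (resolvent A z)) \<le> sqrt (real n * frob_sq (B - A)) / (Im z)\<^sup>2"
proof -
  let ?R = "resolvent A z" and ?S = "resolvent B z"
  note AD = hermitian_matD[OF A] and R = resolvent_hermitian[OF A z]
  note BD = hermitian_matD[OF B] and S = resolvent_hermitian[OF B z]
  have D: "B - A \<in> carrier_mat n n" using AD BD by auto
  have "mtrace ?S = mtrace ?R - mtrace (?S * (B - A) * ?R)"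
    using R S D by (subst resolvent_identity[OF A B z]) (simp add: mtrace_diff[of _ n])
  then have "cmod (mtrace ?S - mtrace ?R) = cmod (mtrace ((?S * (B - A)) * ?R))"
    by (simp add: norm_minus_commute)
  also have "\<dots> \<le> sqrt (frob_sq (?S * (B - A))) * sqrt (frob_sq ?R)"
    using R S D by (intro norm_mtrace_mult_le[of _ n n]) auto
  also have "\<dots> \<le> sqrt (frob_sq (B - A) / (Im z)\<^sup>2) * sqrt (real n / (Im z)\<^sup>2)"
    using frob_sq_resolvent_mult_le(1)[OF B z D] frob_sq_resolvent_le(1)[OF A z]
    by (intro mult_mono real_sqrt_le_mono) auto
  also have "\<dots> = sqrt (real n * frob_sq (B - A)) / (Im z)\<^sup>2"
    by (simp add: real_sqrt_divide real_sqrt_mult power2_eq_square flip: abs_mult)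
  finally show ?thesis .
qed

text \<open>The resolvent identity is substituted into itself, so the linear term involves the
  resolvent of \<open>A\<close> only and that of \<open>B\<close> enters just the quadratic
  remainder. Cyclicity turns tr (R D R) into tr (R R D); the remainder is the trace of (S D) times
  (R D R), which Cauchy-Schwarz bounds by one resolvent factor and two.\<close>

lemma mtrace_resolvent_taylor:
  assumes A: "hermitian_mat n A" and B: "hermitian_mat n B" and z: "Im z \<noteq> 0"
  shows "cmod (mtrace (resolvent B z) - mtrace (resolvent A z)) \<le>
    cmod (mtrace (resolvent A z * resolvent A z * (B - A))) + frob_sq (B - A) / \<bar>Im z\<bar> ^ 3"
proof -
  let ?R = "resolvent A z" and ?S = "resolvent B z" and ?D = "B - A"
  note AD = hermitian_matD[OF A] and R = resolvent_hermitian[OF A z]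
  note BD = hermitian_matD[OF B] and S = resolvent_hermitian[OF B z]
  have D: "?D \<in> carrier_mat n n" using AD BD by auto
  have c: "?S * ?D \<in> carrier_mat n n" "?D * ?R \<in> carrier_mat n n" "?R * ?D \<in> carrier_mat n n"
    "?S * ?D * ?R \<in> carrier_mat n n"  "?R * ?D * ?R \<in> carrier_mat n n"
    using R S D by auto
  have "?S * ?D * ?R = ?S * (?D * ?R)"
    using R S D by (intro assoc_mult_mat) auto
  \<comment> \<open>Only the leading \<open>?S\<close> is expanded by the identity.\<close>
  also have "\<dots> = (?R - ?S * ?D * ?R) * (?D * ?R)"
    by (subst resolvent_identity[OF A B z]) simp
  also have "\<dots> = ?R * (?D * ?R) - ?S * ?D * ?R * (?D * ?R)"
    using R c by (intro minus_mult_distrib_mat[of _ n n _ _ n]) auto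
  also have "?S * ?D * ?R * (?D * ?R) = (?S * ?D) * (?R * ?D * ?R)"
    using R S D c by (simp add: assoc_mult_mat[of _ n n _ n _ n])
  finally have e: "?S * ?D * ?R = ?R * (?D * ?R) - (?S * ?D) * (?R * ?D * ?R)" .
  have "mtrace ?S = mtrace ?R - mtrace (?S * ?D * ?R)"
    using R S D by (subst resolvent_identity[OF A B z]) (simp add: mtrace_diff[of _ n])
  also have "mtrace (?S * ?D * ?R) = mtrace (?R * (?D * ?R)) - mtrace ((?S * ?D) * (?R * ?D * ?R))"
    unfolding e using R c by (intro mtrace_diff[of _ n]) auto
  also have "mtrace (?R * (?D * ?R)) = mtrace (?R * ?R * ?D)"
    using mtrace_mult_commute[of "?R * ?D" n n ?R] R D c by (simp add: assoc_mult_mat[of _ n n _ n _ n])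
  finally have "mtrace ?S - mtrace ?R = mtrace ((?S * ?D) * (?R * ?D * ?R)) - mtrace (?R * ?R * ?D)"
    by simp
  then have "cmod (mtrace ?S - mtrace ?R) \<le> cmod (mtrace ((?S * ?D) * (?R * ?D * ?R))) + cmod (mtrace (?R * ?R * ?D))"
    by (simp add: norm_triangle_ineq4)
  also have "cmod (mtrace ((?S * ?D) * (?R * ?D * ?R))) \<le> sqrt (frob_sq (?S * ?D)) * sqrt (frob_sq (?R * ?D * ?R))"
    using c by (intro norm_mtrace_mult_le[of _ n n]) auto
  also have "\<dots> \<le> sqrt (frob_sq ?D / (Im z)\<^sup>2) * sqrt (frob_sq ?D / (Im z)\<^sup>2 / (Im z)\<^sup>2)"
  proof (intro mult_mono real_sqrt_le_mono)
    show "frob_sq (?R * ?D * ?R) \<le> frob_sq ?D / (Im z)\<^sup>2 / (Im z)\<^sup>2"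
      using frob_sq_resolvent_mult_le(2)[OF A z c(3)] frob_sq_resolvent_mult_le(1)[OF A z D]
      by (meson divide_right_mono order_trans zero_le_power2)
  qed (use frob_sq_resolvent_mult_le(1)[OF B z D] in auto)
  also have "\<dots> = frob_sq ?D / \<bar>Im z\<bar> ^ 3"
    unfolding real_sqrt_divide real_sqrt_abs by (simp add: power3_eq_cube)
  finally show ?thesis by simp
qed

section \<open>Spectral distributions\<close>

text \<open>\<open>eigvals\<close> is a choice, so a witness is required: the characteristic
  polynomial splits over the complex numbers, its roots are real by
  \<open>hermitian_kernel_shift\<close>, and sorting them permutes the linear factors.\<close>

lemma eigvals_hermitian:
  assumes A: "hermitian_mat n A"
  shows "length (eigvals A) = n" "char_poly A = (\<Prod>x\<leftarrow>eigvals A. [:- complex_of_real x, 1:])"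
proof -
  note AD = hermitian_matD[OF A]
  obtain as where as: "char_poly A = (\<Prod>a\<leftarrow>as. [:- a, 1:])" "length as = n"
    using char_poly_factorized[OF AD(1)] by blast
  have real: "complex_of_real (Re a) = a" if a: "a \<in> set as" for a
  proof -
    have "poly (char_poly A) a = 0"
      using a unfolding as(1) by (induction as) auto
    then have "eigenvalue A a"
      using eigenvalue_root_char_poly[OF AD(1)] by blast
    then obtain w where "w \<in> carrier_vec n" "w \<noteq> 0\<^sub>v n" "A *\<^sub>v w = a \<cdot>\<^sub>v w"
      using AD unfolding eigenvalue_def eigenvector_def by auto
    then have "Im a = 0" using hermitian_kernel_shift[OF A] by blast
    then show ?thesis by (simp add: complex_eq_iff)
  qed
  define xs where "xs = sort (map Re as)"
  have "mset (map complex_of_real xs) = mset as"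
  proof -
    have "mset (map complex_of_real xs) = mset (map (\<lambda>a. complex_of_real (Re a)) as)"
      by (simp add: xs_def multiset.map_comp comp_def)
    also have "map (\<lambda>a. complex_of_real (Re a)) as = as"
      using real by (intro map_idI)
    finally show ?thesis .
  qed
  then have "prod_mset (image_mset (\<lambda>a. [:- a, 1:]) (mset (map complex_of_real xs))) = prod_mset (image_mset (\<lambda>a. [:- a, 1:]) (mset as))"
    by simp
  then have "(\<Prod>x\<leftarrow>xs. [:- complex_of_real x, 1:]) = (\<Prod>a\<leftarrow>as. [:- a, 1:])"
    by (simp add: multiset.map_comp comp_def flip: prod_mset_prod_list mset_map)
  then have "sorted xs \<and> length xs = dim_row A \<and> char_poly A = (\<Prod>x\<leftarrow>xs. [:- complex_of_real x, 1:])"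
    using as AD by (simp add: xs_def)
  from someI[of "\<lambda>xs. sorted xs \<and> length xs = dim_row A \<and> char_poly A = (\<Prod>x\<leftarrow>xs. [:- complex_of_real x, 1:])", OF this]
  show "length (eigvals A) = n" "char_poly A = (\<Prod>x\<leftarrow>eigvals A. [:- complex_of_real x, 1:])"
    using AD unfolding eigvals_def by auto
qed

text \<open>The eigenvalues are read off the diagonal of a triangular form, ordered as in
  \<open>eigvals\<close>. Both uses below concern traces, which similarity preserves.\<close>

lemma hermitian_schur:
  assumes A: "hermitian_mat n A"
  obtains B P Q where "similar_mat_wit A B P Q" "upper_triangular B" "B \<in> carrier_mat n n"
    "P \<in> carrier_mat n n" "Q \<in> carrier_mat n n"
    "\<And>i. i < n \<Longrightarrow> B $$ (i,i) = complex_of_real (eigvals A ! i)"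
proof -
  note AD = hermitian_matD[OF A] and E = eigvals_hermitian[OF A]
  let ?es = "map complex_of_real (eigvals A)"
  have c: "char_poly A = (\<Prod>e\<leftarrow>?es. [:- e, 1:])"
    using E by (simp add: comp_def)
  obtain B P Q where s: "schur_decomposition A ?es = (B,P,Q)"
    by (cases "schur_decomposition A ?es") auto
  note S = schur_decomposition[OF AD(1) c s]
  have car: "B \<in> carrier_mat n n" "P \<in> carrier_mat n n" "Q \<in> carrier_mat n n"
    using similar_mat_witD2[OF AD(1), of B P Q] S by auto
  have "B $$ (i,i) = complex_of_real (eigvals A ! i)" if "i < n" for i
  proof -
    have "B $$ (i,i) = diag_mat B ! i" using car that by (simp add: diag_mat_def)
    also have "\<dots> = complex_of_real (eigvals A ! i)" using S E that by simp
    finally show ?thesis .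
  qed
  with S car that show ?thesis by blast
qed

text \<open>Both sides are tr (A A): the triangular form gives the eigenvalues, Hermitian symmetry
  gives the squared moduli of the entries. This later bounds the share of large eigenvalues.\<close>

lemma sum_squares_eigvals:
  assumes A: "hermitian_mat n A"
  shows "(\<Sum>i<n. (eigvals A ! i)\<^sup>2) = frob_sq A"
proof -
  note AD = hermitian_matD[OF A]
  obtain B P Q where B: "similar_mat_wit A B P Q" "upper_triangular B" "B \<in> carrier_mat n n"
    "P \<in> carrier_mat n n" "Q \<in> carrier_mat n n"
    "\<And>i. i < n \<Longrightarrow> B $$ (i,i) = complex_of_real (eigvals A ! i)"
    using hermitian_schur[OF A] by metis
  note W = similar_mat_witD2[OF AD(1) B(1)]
  have c: "P * B \<in> carrier_mat n n" "B * Q \<in> carrier_mat n n" using B by auto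
  have "A * A = P * B * Q * (P * (B * Q))"
    using W(3) B c by (simp add: assoc_mult_mat[of _ n n _ n _ n])
  also have "\<dots> = P * B * (Q * P) * (B * Q)"
    using B c by (simp add: assoc_mult_mat[of _ n n _ n _ n])
  also have "\<dots> = P * (B * B * Q)"
    using W B c by (simp add: assoc_mult_mat[of _ n n _ n _ n])
  finally have "mtrace (A * A) = mtrace (P * (B * B * Q))" by simp
  also have "\<dots> = mtrace (B * B * Q * P)"
    using B c by (intro mtrace_mult_commute[of _ n n]) auto
  also have "B * B * Q * P = B * B"
    using B W by (simp add: assoc_mult_mat[of _ n n _ n _ n])
  also have "mtrace (B * B) = (\<Sum>i<n. \<Sum>j<n. B $$ (i,j) * B $$ (j,i))"
    using mtrace_mult[OF B(3,3)] by (simp add: sum.cartesian_product)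
  \<comment> \<open>Off the diagonal one of the entries at (i,j) and (j,i) lies strictly below the
    diagonal and vanishes.\<close>
  also have "\<dots> = (\<Sum>i<n. \<Sum>j<n. if j = i then (B $$ (i,i))\<^sup>2 else 0)"
  proof (intro sum.cong refl)
    fix i j assume "i \<in> {..<n}" "j \<in> {..<n}"
    then show "B $$ (i,j) * B $$ (j,i) = (if j = i then (B $$ (i,i))\<^sup>2 else 0)"
      using B(2,3) upper_triangularD[of B i j] upper_triangularD[of B j i]
      by (cases i j rule: linorder_cases) (auto simp: power2_eq_square)
  qed
  also have "\<dots> = complex_of_real (\<Sum>i<n. (eigvals A ! i)\<^sup>2)"
    using B(6) by simp
  finally have 1: "mtrace (A * A) = complex_of_real (\<Sum>i<n. (eigvals A ! i)\<^sup>2)" .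
  have "mtrace (A * A) = (\<Sum>(i,j)\<in>{..<n} \<times> {..<n}. complex_of_real ((cmod (A $$ (i,j)))\<^sup>2))"
    unfolding mtrace_mult[OF AD(1,1)]
  proof (intro sum.cong refl, clarify)
    fix i j assume ij: "i < n" "j < n"
    show "A $$ (i,j) * A $$ (j,i) = complex_of_real ((cmod (A $$ (i,j)))\<^sup>2)"
      by (subst hermitian_mat_cnj[OF A ij(2,1)]) (rule complex_norm_square[symmetric])
  qed
  also have "\<dots> = complex_of_real (frob_sq A)"
    by (simp add: frob_sq_carrier[OF AD(1)] case_prod_beta)
  finally show ?thesis using 1 by (metis of_real_eq_iff)
qed

text \<open>The similarity that makes \<open>A\<close> triangular carries the resolvent to the
  inverse of the triangular T = B - z. That inverse is again upper triangular, with reciprocal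
  diagonal entries, and has the same trace as the resolvent.\<close>

lemma mtrace_resolvent_eigvals:
  assumes A: "hermitian_mat n A" and z: "Im z \<noteq> 0"
  shows "mtrace (resolvent A z) = (\<Sum>i<n. 1 / (complex_of_real (eigvals A ! i) - z))"
proof -
  let ?R = "resolvent A z"
  note AD = hermitian_matD[OF A] and R = resolvent_hermitian[OF A z]
  obtain B P Q where B: "similar_mat_wit A B P Q" "upper_triangular B" "B \<in> carrier_mat n n"
    "P \<in> carrier_mat n n" "Q \<in> carrier_mat n n"
    "\<And>i. i < n \<Longrightarrow> B $$ (i,i) = complex_of_real (eigvals A ! i)"
    using hermitian_schur[OF A] by metis
  note W = similar_mat_witD2[OF AD(1) B(1)]
  define S where "S = Q * ?R * P"
  define T where "T = shift_mat B z"
  have S: "S \<in> carrier_mat n n" and T: "T \<in> carrier_mat n n"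
    using B R by (auto simp: S_def T_def)
  have sA: "shift_mat A z \<in> carrier_mat n n" using AD by simp
  have "Q * shift_mat A z * P = T"
  proof -
    have "Q * shift_mat A z * P = (Q * A - z \<cdot>\<^sub>m Q) * P"
      unfolding shift_mat_def using AD B
      by (simp add: mult_minus_distrib_mat[of _ n n _ n] mult_smult_distrib[of _ n n _ n])
    also have "\<dots> = Q * A * P - z \<cdot>\<^sub>m (Q * P)"
      using AD B by (simp add: minus_mult_distrib_mat[of _ n n _ _ n] mult_smult_assoc_mat[of _ n n _ n])
    also have "Q * A * P = Q * P * B * (Q * P)"
      using W(3) B(3-5) by (simp add: assoc_mult_mat[of _ n n _ n _ n])
    also have "\<dots> = B" using W B by simp
    also have "Q * P = 1\<^sub>m n" by (rule W)
    finally show ?thesis using B by (simp add: T_def shift_mat_def)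
  qed
  then have "S * T = Q * ?R * P * (Q * (shift_mat A z * P))"
    using B(3-5) R sA by (simp add: S_def assoc_mult_mat[of _ n n _ n _ n])
  also have "\<dots> = Q * ?R * (P * Q) * (shift_mat A z * P)"
    using B(3-5) R sA by (simp add: assoc_mult_mat[of _ n n _ n _ n])
  also have "\<dots> = Q * (?R * shift_mat A z) * P"
    unfolding W(1) using B(3-5) R(1) sA by (simp add: assoc_mult_mat[of _ n n _ n _ n])
  also have "\<dots> = 1\<^sub>m n"
    unfolding R(3) using W B by simp
  finally have ST: "S * T = 1\<^sub>m n" .
  have Tu: "T $$ (l,k) = 0" if "k < l" "l < n" for k l
    using that B upper_triangularD[of B k l] by (simp add: T_def shift_mat_index[OF B(3)])
  have Td: "T $$ (k,k) = complex_of_real (eigvals A ! k) - z" "T $$ (k,k) \<noteq> 0" if "k < n" for k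
    using that B z by (auto simp: T_def shift_mat_index[OF B(3)] complex_eq_iff)
  have ent: "(\<Sum>l<n. S $$ (i,l) * T $$ (l,k)) = (if i = k then 1 else 0)" if "i < n" "k < n" for i k
    using mult_mat_index[OF S T that] ST that by simp
  \<comment> \<open>Induction along the columns: in the entry (i,k) of S T, terms with l < k vanish
    by induction and those with l > k because \<open>T\<close> is triangular, leaving one product
    with a nonzero diagonal factor.\<close>
  have Su: "S $$ (i,k) = 0" if "k < i" "i < n" for i k
    using that
  proof (induction k rule: less_induct)
    case (less k)
    have "0 = (\<Sum>l<n. S $$ (i,l) * T $$ (l,k))" using ent[of i k] less.prems by simp
    also have "\<dots> = (\<Sum>l<n. if l = k then S $$ (i,k) * T $$ (k,k) else 0)"
    proof (intro sum.cong refl)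
      fix l assume "l \<in> {..<n}"
      then show "S $$ (i,l) * T $$ (l,k) = (if l = k then S $$ (i,k) * T $$ (k,k) else 0)"
        using less.IH[of l] less.prems Tu[of k l] by (cases l k rule: linorder_cases) auto
    qed
    also have "\<dots> = S $$ (i,k) * T $$ (k,k)" using less.prems by simp
    finally show ?case using Td[of k] less.prems by simp
  qed
  have Sd: "S $$ (i,i) = 1 / (complex_of_real (eigvals A ! i) - z)" if i: "i < n" for i
  proof -
    have "1 = (\<Sum>l<n. S $$ (i,l) * T $$ (l,i))" using ent[of i i] i by simp
    also have "\<dots> = (\<Sum>l<n. if l = i then S $$ (i,i) * T $$ (i,i) else 0)"
    proof (intro sum.cong refl)
      fix l assume "l \<in> {..<n}"
      then show "S $$ (i,l) * T $$ (l,i) = (if l = i then S $$ (i,i) * T $$ (i,i) else 0)"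
        using i Su[of l i] Tu[of i l] by (cases l i rule: linorder_cases) auto
    qed
    also have "\<dots> = S $$ (i,i) * T $$ (i,i)" using i by simp
    finally show ?thesis using Td[OF i] by (metis nonzero_eq_divide_eq)
  qed
  have "mtrace S = mtrace (P * (Q * ?R))"
    unfolding S_def using B R by (intro mtrace_mult_commute[of _ n n]) auto
  also have "P * (Q * ?R) = ?R"
    using B(3-5) R W assoc_mult_mat[of P n n Q n ?R n] by simp
  finally show ?thesis
    using S Sd by (simp add: mtrace_def)
qed

section \<open>Spectral distributions and their Stieltjes transforms\<close>

lemma norm_stieltjes_kernel_le:
  assumes "Im z \<noteq> 0"
  shows "cmod (1 / (complex_of_real x - z)) \<le> 1 / \<bar>Im z\<bar>"
  using abs_Im_le_cmod[of "complex_of_real x - z"] assms by (simp add: norm_divide frac_le)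

lemma norm_mtrace_resolvent_le:
  assumes A: "hermitian_mat n A" and z: "Im z \<noteq> 0"
  shows "cmod (mtrace (resolvent A z)) \<le> real n / \<bar>Im z\<bar>"
proof -
  have "cmod (mtrace (resolvent A z)) \<le> (\<Sum>i<n. 1 / \<bar>Im z\<bar>)"
    unfolding mtrace_resolvent_eigvals[OF A z] by (intro sum_norm_le norm_stieltjes_kernel_le z)
  then show ?thesis by simp
qed

text \<open>The law of a uniformly chosen entry. \<open>esd\<close> is given through
  \<open>measure_of\<close>, whose values become available once a genuine measure with the
  prescribed values is exhibited; this is that measure.\<close>

definition unif_list :: "real list \<Rightarrow> real measure" where
  "unif_list xs = distr (measure_pmf (pmf_of_set {..<length xs})) borel (\<lambda>i. xs ! i)"

lemma emeasure_unif_list: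
  assumes "xs \<noteq> []" "S \<in> sets borel"
  shows "emeasure (unif_list xs) S = ennreal ((\<Sum>x\<leftarrow>xs. indicator S x) / real (length xs))"
proof -
  have ne: "{..<length xs} \<noteq> {}" using assms by auto
  have "emeasure (unif_list xs) S = emeasure (measure_pmf (pmf_of_set {..<length xs})) ((\<lambda>i. xs ! i) -` S)"
    unfolding unif_list_def using assms by (subst emeasure_distr) auto
  also have "\<dots> = ennreal (card ({..<length xs} \<inter> (\<lambda>i. xs ! i) -` S) / card {..<length xs})"
    using ne by (subst emeasure_pmf_of_set) auto
  also have "real (card ({..<length xs} \<inter> (\<lambda>i. xs ! i) -` S)) = (\<Sum>i<length xs. indicator S (xs ! i))"
    by (simp add: indicator_def sum.If_cases Int_def vimage_def)
  also have "\<dots> = (\<Sum>x\<leftarrow>xs. indicator S x)"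
    by (simp add: sum_list_sum_nth atLeast0LessThan)
  finally show ?thesis by simp
qed

lemma real_distribution_unif_list: "real_distribution (unif_list xs)"
  unfolding unif_list_def real_distribution_def real_distribution_axioms_def
  by (auto intro!: measure_pmf.prob_space_distr)

lemma integral_unif_list:
  fixes f :: "real \<Rightarrow> 'b::{banach, second_countable_topology}"
  assumes "xs \<noteq> []" "f \<in> borel_measurable borel"
  shows "(\<integral>x. f x \<partial>unif_list xs) = (\<Sum>i<length xs. f (xs ! i)) /\<^sub>R real (length xs)"
proof -
  have ne: "{..<length xs} \<noteq> {}" using assms by auto
  have "(\<integral>x. f x \<partial>unif_list xs) = (\<integral>i. f (xs ! i) \<partial>measure_pmf (pmf_of_set {..<length xs}))"
    unfolding unif_list_def using assms by (subst integral_distr) auto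
  also have "\<dots> = (\<Sum>i<length xs. pmf (pmf_of_set {..<length xs}) i *\<^sub>R f (xs ! i))"
    using ne by (subst integral_measure_pmf[of "{..<length xs}"]) auto
  also have "\<dots> = (\<Sum>i<length xs. f (xs ! i) /\<^sub>R real (length xs))"
    using ne by (intro sum.cong) (auto simp: inverse_eq_divide)
  finally show ?thesis by (simp add: scaleR_sum_right)
qed

lemma esd_hermitian:
  assumes A: "hermitian_mat n A" and n: "0 < n"
  shows "esd A = unif_list (eigvals A)"
proof -
  have ne: "eigvals A \<noteq> []" using eigvals_hermitian(1)[OF A] n by auto
  have sp: "space (unif_list (eigvals A)) = UNIV" "sets (unif_list (eigvals A)) = sets borel"
    by (auto simp: unif_list_def)
  have "unif_list (eigvals A) = measure_of UNIV (sets borel) (emeasure (unif_list (eigvals A)))"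
    using measure_of_of_measure[of "unif_list (eigvals A)"] sp by simp
  also have "\<dots> = esd A"
    unfolding esd_def
  proof (rule measure_of_eq)
    fix S :: "real set" assume "S \<in> sigma_sets UNIV (sets borel)"
    then have "S \<in> sets borel" using sets.sigma_sets_eq[of "borel :: real measure"] by simp
    then show "emeasure (unif_list (eigvals A)) S = ennreal ((\<Sum>x\<leftarrow>eigvals A. indicator S x) / real (dim_row A))"
      using emeasure_unif_list[OF ne] eigvals_hermitian(1)[OF A] hermitian_matD[OF A] by simp
  qed simp
  finally show ?thesis by simp
qed

lemma real_distribution_esd: "hermitian_mat n A \<Longrightarrow> 0 < n \<Longrightarrow> real_distribution (esd A)"
  by (simp add: esd_hermitian real_distribution_unif_list)

lemma integral_esd:
  fixes f :: "real \<Rightarrow> 'b::{banach, second_countable_topology}"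
  assumes "hermitian_mat n A" "0 < n" "f \<in> borel_measurable borel"
  shows "(\<integral>x. f x \<partial>esd A) = (\<Sum>i<n. f (eigvals A ! i)) /\<^sub>R real n"
  using integral_unif_list[of "eigvals A" f] assms eigvals_hermitian(1)[OF assms(1)]
  by (subst esd_hermitian[OF assms(1,2)]) auto

definition stieltjes :: "real measure \<Rightarrow> complex \<Rightarrow> complex" where
  "stieltjes \<mu> z = (\<integral>x. 1 / (complex_of_real x - z) \<partial>\<mu>)"

lemma borel_measurable_stieltjes_kernel [measurable]:
  "(\<lambda>x. 1 / (complex_of_real x - z)) \<in> borel_measurable borel"
  by measurable

lemma stieltjes_esd:
  assumes "hermitian_mat n A" "0 < n" "Im z \<noteq> 0"
  shows "stieltjes (esd A) z = mtrace (resolvent A z) / of_nat n"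
  unfolding stieltjes_def integral_esd[OF assms(1,2) borel_measurable_stieltjes_kernel] mtrace_resolvent_eigvals[OF assms(1,3)]
  by (simp add: scaleR_conv_of_real divide_inverse mult.commute)

section \<open>Stieltjes transforms and weak convergence\<close>

lemma stieltjes_kernel_nonzero: "Im z \<noteq> 0 \<Longrightarrow> complex_of_real x - z \<noteq> 0"
  by (auto simp: complex_eq_iff)

lemma stieltjes_kernel_diff:
  assumes "Im z \<noteq> 0" "Im w \<noteq> 0"
  shows "1 / (complex_of_real x - z) - 1 / (complex_of_real x - w) =
    (z - w) * (1 / (complex_of_real x - z)) * (1 / (complex_of_real x - w))"
  using stieltjes_kernel_nonzero[OF assms(1), of x] stieltjes_kernel_nonzero[OF assms(2), of x]
  by (simp add: divide_simps)

section \<open>Transform bounds and tails for a single law\<close>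

context real_distribution
begin

lemma prob_UNIV [simp]: "prob UNIV = 1"
  using prob_space by simp

lemma integrable_stieltjes_kernel:
  "Im z \<noteq> 0 \<Longrightarrow> integrable M (\<lambda>x. 1 / (complex_of_real x - z))"
  using norm_stieltjes_kernel_le by (intro integrable_bounded) auto

lemma norm_stieltjes_le:
  assumes "Im z \<noteq> 0"
  shows "cmod (stieltjes M z) \<le> 1 / \<bar>Im z\<bar>"
proof -
  have "cmod (stieltjes M z) \<le> (\<integral>x. cmod (1 / (complex_of_real x - z)) \<partial>M)"
    unfolding stieltjes_def by (rule integral_norm_bound)
  also have "\<dots> \<le> (\<integral>x. 1 / \<bar>Im z\<bar> \<partial>M)"
    using norm_stieltjes_kernel_le[OF assms] integrable_stieltjes_kernel[OF assms] by (intro integral_mono) auto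
  finally show ?thesis by simp
qed

lemma stieltjes_lipschitz:
  assumes z: "Im z \<noteq> 0" and w: "Im w \<noteq> 0"
  shows "cmod (stieltjes M z - stieltjes M w) \<le> cmod (z - w) / (\<bar>Im z\<bar> * \<bar>Im w\<bar>)"
proof -
  have "stieltjes M z - stieltjes M w = (\<integral>x. 1 / (complex_of_real x - z) - 1 / (complex_of_real x - w) \<partial>M)"
    unfolding stieltjes_def using integrable_stieltjes_kernel z w by simp
  also have "cmod \<dots> \<le> (\<integral>x. cmod (1 / (complex_of_real x - z) - 1 / (complex_of_real x - w)) \<partial>M)"
    by (rule integral_norm_bound)
  also have "\<dots> \<le> (\<integral>x. cmod (z - w) * (1 / \<bar>Im z\<bar>) * (1 / \<bar>Im w\<bar>) \<partial>M)"
  proof (rule integral_mono)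
    show "integrable M (\<lambda>x. cmod (1 / (complex_of_real x - z) - 1 / (complex_of_real x - w)))"
      by (intro integrable_norm Bochner_Integration.integrable_diff integrable_stieltjes_kernel z w)
    show "cmod (1 / (complex_of_real x - z) - 1 / (complex_of_real x - w)) \<le> cmod (z - w) * (1 / \<bar>Im z\<bar>) * (1 / \<bar>Im w\<bar>)" for x
      unfolding stieltjes_kernel_diff[OF z w] norm_mult
      by (intro mult_mono norm_stieltjes_kernel_le z w) auto
  qed auto
  finally show ?thesis by simp
qed

text \<open>On the imaginary axis the imaginary part of the kernel is the Poisson kernel; scaled by
  \<eta> it becomes a smooth cutoff at scale \<eta> with values in (0, 1].\<close>

lemma Im_stieltjes_imaginary:
  assumes "\<eta> > 0"
  shows "\<eta> * Im (stieltjes M (\<i> * complex_of_real \<eta>)) = (\<integral>x. \<eta>\<^sup>2 / (x\<^sup>2 + \<eta>\<^sup>2) \<partial>M)"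
proof -
  have "Im (stieltjes M (\<i> * complex_of_real \<eta>)) = (\<integral>x. Im (1 / (complex_of_real x - \<i> * complex_of_real \<eta>)) \<partial>M)"
    unfolding stieltjes_def using assms by (intro integral_Im[symmetric] integrable_stieltjes_kernel) auto
  also have "\<dots> = (\<integral>x. \<eta> / (x\<^sup>2 + \<eta>\<^sup>2) \<partial>M)"
    by (intro Bochner_Integration.integral_cong refl) (simp add: Im_divide power2_eq_square)
  finally have "\<eta> * Im (stieltjes M (\<i> * complex_of_real \<eta>)) = \<eta> * (\<integral>x. \<eta> / (x\<^sup>2 + \<eta>\<^sup>2) \<partial>M)"
    by simp
  also have "\<dots> = (\<integral>x. \<eta>\<^sup>2 / (x\<^sup>2 + \<eta>\<^sup>2) \<partial>M)"
    by (subst integral_mult_right_zero[symmetric]) (simp add: power2_eq_square)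
  finally show ?thesis .
qed

text \<open>The cutoff \<eta>^2 / (x^2 + \<eta>^2) is at most 1/2 for |x| \<ge> \<eta>, which
  explains the factor 2. The tail is thereby bounded by a single value of the transform, a bound
  that survives pointwise limits.\<close>

lemma tail_le_stieltjes:
  assumes \<eta>: "\<eta> > 0"
  shows "prob {x. \<eta> \<le> \<bar>x\<bar>} \<le> 2 * (1 - \<eta> * Im (stieltjes M (\<i> * complex_of_real \<eta>)))"
proof -
  have b: "\<bar>\<eta>\<^sup>2 / (x\<^sup>2 + \<eta>\<^sup>2)\<bar> \<le> 1" for x
    using \<eta> by (simp add: divide_simps add_nonneg_pos)
  have int: "integrable M (\<lambda>x. \<eta>\<^sup>2 / (x\<^sup>2 + \<eta>\<^sup>2))"
    using b by (intro integrable_bounded[where b=1]) auto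
  have m: "{x. \<eta> \<le> \<bar>x\<bar>} \<in> events" by auto
  have "prob {x. \<eta> \<le> \<bar>x\<bar>} = (\<integral>x. indicator {x. \<eta> \<le> \<bar>x\<bar>} x \<partial>M)"
    using m by simp
  also have "\<dots> \<le> (\<integral>x. 2 * (1 - \<eta>\<^sup>2 / (x\<^sup>2 + \<eta>\<^sup>2)) \<partial>M)"
  proof (rule integral_mono)
    show "integrable M (\<lambda>x. indicator {x. \<eta> \<le> \<bar>x\<bar>} x :: real)"
      using m by (intro integrable_bounded[where b=1]) auto
    fix x
    show "indicator {x. \<eta> \<le> \<bar>x\<bar>} x \<le> 2 * (1 - \<eta>\<^sup>2 / (x\<^sup>2 + \<eta>\<^sup>2))"
    proof (cases "\<eta> \<le> \<bar>x\<bar>")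
      case True
      then have "\<eta>\<^sup>2 \<le> x\<^sup>2" using \<eta> by (simp add: abs_le_square_iff[symmetric])
      then have "\<eta>\<^sup>2 / (x\<^sup>2 + \<eta>\<^sup>2) \<le> 1 / 2" using \<eta> by (simp add: divide_simps add_nonneg_pos)
      with True show ?thesis by (simp add: mult.commute)
    next
      case False
      with b[of x] show ?thesis by simp
    qed
    show "integrable M (\<lambda>x. 2 * (1 - \<eta>\<^sup>2 / (x\<^sup>2 + \<eta>\<^sup>2)))"
      by (intro integrable_mult_right Bochner_Integration.integrable_diff int) simp
  qed
  also have "\<dots> = 2 * (1 - (\<integral>x. \<eta>\<^sup>2 / (x\<^sup>2 + \<eta>\<^sup>2) \<partial>M))"
    unfolding integral_mult_right_zero by (subst Bochner_Integration.integral_diff) (use int in auto)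
  finally show ?thesis using Im_stieltjes_imaginary[OF \<eta>] by simp
qed

text \<open>As the scale grows the cutoff tends to 1 pointwise, so the transform recovers the total
  mass.\<close>

lemma Im_stieltjes_tendsto_1:
  "(\<lambda>k. real (Suc k) * Im (stieltjes M (\<i> * complex_of_real (real (Suc k))))) \<longlonglongrightarrow> 1"
proof -
  have "(\<lambda>k. \<integral>x. (real (Suc k))\<^sup>2 / (x\<^sup>2 + (real (Suc k))\<^sup>2) \<partial>M) \<longlonglongrightarrow> (\<integral>x. 1 \<partial>M)"
  proof (rule integral_dominated_convergence[where w="\<lambda>_. 1"])
    have "(\<lambda>k. (real (Suc k))\<^sup>2 / (x\<^sup>2 + (real (Suc k))\<^sup>2)) \<longlonglongrightarrow> 1" for x :: real
      by real_asymp
    then show "AE x in M. (\<lambda>k. (real (Suc k))\<^sup>2 / (x\<^sup>2 + (real (Suc k))\<^sup>2)) \<longlonglongrightarrow> 1" by simp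
    show "AE x in M. norm ((real (Suc k))\<^sup>2 / (x\<^sup>2 + (real (Suc k))\<^sup>2)) \<le> 1" for k
      by (rule AE_I2) (simp add: divide_simps add_nonneg_pos)
  qed auto
  then show ?thesis
    using Im_stieltjes_imaginary[of "real (Suc _)"] by simp
qed

end

text \<open>Differentiation in \<open>z\<close> raises the power of the kernel: the derivative of (x
  - z)^(-m) is m (x - z)^(-m-1). Each induction step passes difference quotients of the previous
  identity to the limit under the integral.\<close>

lemma stieltjes_eq_imp_power_eq:
  assumes \<mu>: "real_distribution \<mu>" and \<nu>: "real_distribution \<nu>"
    and eq: "\<And>z. Im z \<noteq> 0 \<Longrightarrow> stieltjes \<mu> z = stieltjes \<nu> z"
    and z: "Im z \<noteq> 0"
  shows "(\<integral>x. (1 / (complex_of_real x - z)) ^ Suc m \<partial>\<mu>) = (\<integral>x. (1 / (complex_of_real x - z)) ^ Suc m \<partial>\<nu>)"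
  using z
proof (induction m arbitrary: z)
  case 0
  then show ?case using eq[of z] by (simp add: stieltjes_def)
next
  case (Suc m)
  define c where "c = 1 / \<bar>Im z\<bar>"
  define b where "b x = 1 / (complex_of_real x - z)" for x
  \<comment> \<open>Real increments leave \<open>Im z\<close> unchanged, so one bound
    \<open>c\<close> serves all shifted kernels.\<close>
  define h where "h k = complex_of_real (1 / real (Suc k))" for k
  define a where "a k x = 1 / (complex_of_real x - (z + h k))" for k x
  \<comment> \<open>The difference quotient with \<open>h k\<close> already divided out, using a - b
    = h a b and the factorisation of a difference of powers; in this form its uniform bound is
    visible.\<close>
  define g where "g k x = a k x * b x * (\<Sum>p<Suc m. a k x ^ p * b x ^ (m - p))" for k x
  have h0: "h k \<noteq> 0" for k by (simp add: h_def del: of_nat_Suc)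
  have hlim: "h \<longlonglongrightarrow> 0"
    using tendsto_of_real[OF LIMSEQ_inverse_real_of_nat, where 'a=complex]
    by (simp add: h_def[abs_def] inverse_eq_divide del: of_nat_Suc)
  have Imh: "Im (z + h k) = Im z" for k by (simp add: h_def)
  have ac: "cmod (a k x) \<le> c" and bc: "cmod (b x) \<le> c" for k x
    unfolding a_def b_def c_def
    using norm_stieltjes_kernel_le[of "z + h k" x] norm_stieltjes_kernel_le[of z x] Suc.prems Imh by auto
  have c0: "0 \<le> c" by (simp add: c_def)
  have gb: "cmod (g k x) \<le> c * c * (real (Suc m) * c ^ m)" for k x
  proof -
    have "cmod (\<Sum>p<Suc m. a k x ^ p * b x ^ (m - p)) \<le> (\<Sum>p<Suc m. c ^ m)"
    proof (rule sum_norm_le)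
      fix p assume "p \<in> {..<Suc m}"
      then have p: "p \<le> m" by simp
      have "cmod (a k x ^ p * b x ^ (m - p)) \<le> c ^ p * c ^ (m - p)"
        unfolding norm_mult norm_power by (intro mult_mono power_mono ac bc) (auto simp: c0)
      also have "\<dots> = c ^ m" using p by (simp flip: power_add)
      finally show "cmod (a k x ^ p * b x ^ (m - p)) \<le> c ^ m" .
    qed
    then have "cmod (\<Sum>p<Suc m. a k x ^ p * b x ^ (m - p)) \<le> real (Suc m) * c ^ m" by simp
    then show ?thesis
      unfolding g_def norm_mult by (intro mult_mono ac bc) (auto simp: c0)
  qed
  have geq: "g k x = (a k x ^ Suc m - b x ^ Suc m) / h k" for k x
  proof -
    have "a k x - b x = h k * a k x * b x"
      unfolding a_def b_def using Suc.prems by (subst stieltjes_kernel_diff) (auto simp: h_def)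
    moreover have "a k x ^ Suc m - b x ^ Suc m = (a k x - b x) * (\<Sum>p<Suc m. a k x ^ p * b x ^ (m - p))"
      by (rule diff_power_eq_sum)
    ultimately show ?thesis using h0 by (simp add: g_def del: power_Suc)
  qed
  have ma[measurable]: "a k \<in> borel_measurable borel" "b \<in> borel_measurable borel" for k
    unfolding a_def[abs_def] b_def[abs_def] by measurable
  have lim: "(\<lambda>k. \<integral>x. g k x \<partial>N) \<longlonglongrightarrow> (\<integral>x. of_nat (Suc m) * b x ^ Suc (Suc m) \<partial>N)"
    if "real_distribution N" for N
  proof -
    interpret real_distribution N by fact
    show ?thesis
    proof (rule integral_dominated_convergence[where w="\<lambda>_. c * c * (real (Suc m) * c ^ m)"])
      show "g k \<in> borel_measurable N" for k unfolding g_def[abs_def] by measurable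
      show "AE x in N. (\<lambda>k. g k x) \<longlonglongrightarrow> of_nat (Suc m) * b x ^ Suc (Suc m)"
      proof (rule AE_I2)
        fix x
        have "(\<lambda>k. a k x) \<longlonglongrightarrow> 1 / (complex_of_real x - (z + 0))"
          unfolding a_def using Suc.prems stieltjes_kernel_nonzero[of z x] by (intro tendsto_intros hlim) auto
        then have "(\<lambda>k. a k x) \<longlonglongrightarrow> b x" by (simp add: b_def)
        then have "(\<lambda>k. g k x) \<longlonglongrightarrow> b x * b x * (\<Sum>p<Suc m. b x ^ p * b x ^ (m - p))"
          unfolding g_def by (intro tendsto_intros)
        also have "(\<Sum>p<Suc m. b x ^ p * b x ^ (m - p)) = (\<Sum>p<Suc m. b x ^ m)"
          by (intro sum.cong refl) (simp flip: power_add)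
        finally show "(\<lambda>k. g k x) \<longlonglongrightarrow> of_nat (Suc m) * b x ^ Suc (Suc m)"
          by (simp add: mult_ac)
      qed
      show "AE x in N. norm (g k x) \<le> c * c * (real (Suc m) * c ^ m)" for k
        using gb by simp
    qed (auto simp: b_def)
  qed
  have gint: "(\<integral>x. g k x \<partial>\<mu>) = (\<integral>x. g k x \<partial>\<nu>)" for k
  proof -
    have "(\<integral>x. g k x \<partial>N) = ((\<integral>x. a k x ^ Suc m \<partial>N) - (\<integral>x. b x ^ Suc m \<partial>N)) / h k"
      if "real_distribution N" for N
    proof -
      interpret real_distribution N by fact
      have "cmod (a k x ^ Suc m) \<le> c ^ Suc m" "cmod (b x ^ Suc m) \<le> c ^ Suc m" for x
        unfolding norm_power by (intro power_mono ac bc norm_ge_zero)+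
      then have "integrable N (\<lambda>x. a k x ^ Suc m)" "integrable N (\<lambda>x. b x ^ Suc m)"
        by (auto intro!: integrable_bounded[where b="c ^ Suc m"] simp del: power_Suc)
      then show ?thesis unfolding geq by (simp del: power_Suc)
    qed
    moreover have "(\<integral>x. a k x ^ Suc m \<partial>\<mu>) = (\<integral>x. a k x ^ Suc m \<partial>\<nu>)"
      unfolding a_def using Suc.IH[of "z + h k"] Suc.prems Imh by simp
    moreover have "(\<integral>x. b x ^ Suc m \<partial>\<mu>) = (\<integral>x. b x ^ Suc m \<partial>\<nu>)"
      unfolding b_def using Suc.IH[of z] Suc.prems by simp
    ultimately show ?thesis using \<mu> \<nu> by simp
  qed
  have "(\<integral>x. of_nat (Suc m) * b x ^ Suc (Suc m) \<partial>\<mu>) = (\<integral>x. of_nat (Suc m) * b x ^ Suc (Suc m) \<partial>\<nu>)"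
    using LIMSEQ_unique[OF lim[OF \<mu>]] lim[OF \<nu>] unfolding gint by blast
  then have "of_nat (Suc m) * (\<integral>x. b x ^ Suc (Suc m) \<partial>\<mu>) = of_nat (Suc m) * (\<integral>x. b x ^ Suc (Suc m) \<partial>\<nu>)"
    by (simp only: integral_mult_right_zero)
  then show ?case
    unfolding b_def by (simp del: power_Suc of_nat_Suc)
qed

text \<open>The exponential is the power of iexp (\<theta> / (m+1)). For numbers of modulus at most
  1 the difference of (m+1)-st powers is at most m+1 times the difference of the bases, here of
  order (\<theta> / (m+1))^2.\<close>

lemma iexp_resolvent_limit:
  "(\<lambda>m. (1 / (1 - \<i> * complex_of_real (\<theta> / real (Suc m)))) ^ Suc m) \<longlonglongrightarrow> iexp \<theta>"
proof -
  define a where "a m = 1 - \<i> * complex_of_real (\<theta> / real (Suc m))" for m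
  define e where "e m = iexp (\<theta> / real (Suc m))" for m
  have est: "cmod ((1 / a m) ^ Suc m - iexp \<theta>) \<le> \<theta>\<^sup>2 / real (Suc m)" for m
  proof -
    let ?t = "\<theta> / real (Suc m)"
    have a1: "1 \<le> cmod (a m)"
      using abs_Re_le_cmod[of "a m"] by (simp add: a_def)
    have e1: "cmod (e m) = 1" by (simp add: e_def)
    have "iexp \<theta> = e m ^ Suc m"
    proof -
      have "\<i> * complex_of_real \<theta> = of_nat (Suc m) * (\<i> * complex_of_real ?t)"
        by (simp del: of_nat_Suc)
      then show ?thesis unfolding e_def by (simp only: exp_of_nat_mult)
    qed
    then have "cmod ((1 / a m) ^ Suc m - iexp \<theta>) = cmod ((1 / a m) ^ Suc m - e m ^ Suc m)" by simp
    also have "\<dots> \<le> real (Suc m) * cmod (1 / a m - e m)"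
      using a1 e1 by (intro norm_power_diff) (auto simp: norm_divide divide_le_eq_1)
    also have "cmod (1 / a m - e m) \<le> \<bar>?t\<bar>\<^sup>2"
    proof -
      have "a m \<noteq> 0" using a1 by auto
      \<comment> \<open>Here \<open>a m\<close> is the first-order Taylor polynomial of
        \<open>iexp (- ?t)\<close>, so the last factor is a Taylor remainder and the other two have
        modulus at most 1.\<close>
      then have "1 / a m - e m = (1 / a m) * e m * (iexp (- ?t) - a m)"
        unfolding e_def by (simp add: field_simps flip: exp_add)
      then have "cmod (1 / a m - e m) = cmod (1 / a m) * cmod (iexp (- ?t) - a m)"
        by (simp only: norm_mult e1 mult_1_right)
      also have "\<dots> \<le> 1 * cmod (iexp (- ?t) - a m)"
        using a1 by (intro mult_right_mono) (auto simp: norm_divide divide_le_eq_1)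
      also have "iexp (- ?t) - a m = iexp (- ?t) - (\<Sum>k\<le>1. (\<i> * complex_of_real (- ?t)) ^ k / fact k)"
        by (simp add: a_def)
      also have "1 * cmod \<dots> \<le> \<bar>- ?t\<bar> ^ Suc 1 / fact (Suc 1)"
        using iexp_approx1[of "- ?t" 1] by simp
      also have "\<dots> = \<bar>?t\<bar>\<^sup>2 / 2"
        by (simp add: power2_eq_square)
      also have "\<dots> \<le> \<bar>?t\<bar>\<^sup>2"
        using zero_le_power2[of "\<bar>?t\<bar>"] by linarith
      finally show ?thesis .
    qed
    also have "real (Suc m) * \<bar>?t\<bar>\<^sup>2 = \<theta>\<^sup>2 / real (Suc m)"
      by (simp add: power2_eq_square del: of_nat_Suc)
    finally show ?thesis by (simp del: of_nat_Suc power_Suc)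
  qed
  have lim: "(\<lambda>m. \<theta>\<^sup>2 / real (Suc m)) \<longlonglongrightarrow> 0" by real_asymp
  have "\<forall>\<^sub>F m in sequentially. norm ((1 / a m) ^ Suc m - iexp \<theta>) \<le> \<theta>\<^sup>2 / real (Suc m)"
    by (rule always_eventually, rule allI, rule est)
  then have "(\<lambda>m. (1 / a m) ^ Suc m - iexp \<theta>) \<longlonglongrightarrow> 0"
    by (rule Lim_null_comparison[OF _ lim])
  then show ?thesis unfolding a_def by (rule LIM_zero_cancel)
qed

text \<open>Since \<open>(1 - itx/m)\<^bsup>-m\<^esup> \<rightarrow> e\<^bsup>itx\<^esup>\<close>, the characteristic function is a limit of integrals of powers
  of the Cauchy kernel.\<close>
lemma stieltjes_unique:
  assumes \<mu>: "real_distribution \<mu>" and \<nu>: "real_distribution \<nu>"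
    and eq: "\<And>z. Im z \<noteq> 0 \<Longrightarrow> stieltjes \<mu> z = stieltjes \<nu> z"
  shows "\<mu> = \<nu>"
proof (rule Levy_uniqueness[OF \<mu> \<nu>], rule ext)
  fix t
  show "char \<mu> t = char \<nu> t"
  proof (cases "t = 0")
    case True
    interpret m: real_distribution \<mu> by fact
    interpret n: real_distribution \<nu> by fact
    show ?thesis using True m.char_zero n.char_zero by simp
  next
    case False
    define q where "q m x = (1 / (1 - \<i> * complex_of_real (t * x / real (Suc m)))) ^ Suc m" for m x
    have q1: "cmod (q m x) \<le> 1" for m x
    proof -
      have "1 \<le> cmod (1 - \<i> * complex_of_real (t * x / real (Suc m)))"
        using abs_Re_le_cmod[of "1 - \<i> * complex_of_real (t * x / real (Suc m))"] by simp
      then have "cmod (1 / (1 - \<i> * complex_of_real (t * x / real (Suc m)))) \<le> 1"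
        by (simp add: norm_divide)
      then show ?thesis unfolding q_def norm_power by (intro power_le_one) auto
    qed
    have lim: "(\<lambda>m. \<integral>x. q m x \<partial>N) \<longlonglongrightarrow> char N t" if "real_distribution N" for N
    proof -
      interpret real_distribution N by fact
      show ?thesis unfolding char_def
      proof (rule integral_dominated_convergence[where w="\<lambda>_. 1"])
        show "AE x in N. (\<lambda>m. q m x) \<longlonglongrightarrow> iexp (t * x)"
          unfolding q_def using iexp_resolvent_limit[of "t * _"] by simp
        show "AE x in N. norm (q m x) \<le> 1" for m using q1 by simp
        show "q m \<in> borel_measurable N" for m unfolding q_def[abs_def] by measurable
      qed auto
    qed
    have "(\<integral>x. q m x \<partial>\<mu>) = (\<integral>x. q m x \<partial>\<nu>)" for m
    proof -
      \<comment> \<open>This is the zero in x of 1 - i t x / (m+1); with l = -z that expression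
        equals (x - z) / l. The division by \<open>t\<close> is why \<open>t = 0\<close> is treated
        apart.\<close>
      define z where "z = Complex 0 (- real (Suc m) / t)"
      define l where "l = complex_of_real (real (Suc m)) * \<i> / complex_of_real t"
      have z: "Im z \<noteq> 0" using False by (simp add: z_def)
      have "1 / (1 - \<i> * complex_of_real (t * x / real (Suc m))) = l * (1 / (complex_of_real x - z))" for x
      proof -
        have zl: "z = - l" using False by (simp add: z_def l_def complex_eq_iff Re_divide Im_divide power2_eq_square diff_divide_distrib add_divide_distrib)
        have l0: "l \<noteq> 0" using False by (simp add: l_def del: of_nat_Suc)
        have "\<i> * complex_of_real (t * x / real (Suc m)) = - complex_of_real x / l"
          using False by (simp add: l_def field_simps del: of_nat_Suc)
        then have "1 - \<i> * complex_of_real (t * x / real (Suc m)) = (complex_of_real x - z) / l"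
          using l0 by (simp add: zl field_simps)
        then show ?thesis by simp
      qed
      then have "q m x = l ^ Suc m * (1 / (complex_of_real x - z)) ^ Suc m" for x
        unfolding q_def by (simp only: power_mult_distrib)
      moreover have "(\<integral>x. (1 / (complex_of_real x - z)) ^ Suc m \<partial>\<mu>) = (\<integral>x. (1 / (complex_of_real x - z)) ^ Suc m \<partial>\<nu>)"
        by (rule stieltjes_eq_imp_power_eq[OF \<mu> \<nu> eq z])
      ultimately show ?thesis by (simp only: integral_mult_right_zero)
    qed
    then show ?thesis using LIMSEQ_unique[OF lim[OF \<mu>]] lim[OF \<nu>] by simp
  qed
qed

section \<open>Convergence of transforms and weak convergence\<close>

lemma weak_conv_imp_stieltjes_conv:
  assumes "\<And>k. real_distribution (\<nu> k)" "real_distribution \<mu>" "weak_conv_m \<nu> \<mu>" "Im z \<noteq> 0"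
  shows "(\<lambda>k. stieltjes (\<nu> k) z) \<longlonglongrightarrow> stieltjes \<mu> z"
  unfolding stieltjes_def
  using norm_stieltjes_kernel_le[OF assms(4)] stieltjes_kernel_nonzero[OF assms(4)]
  by (intro weak_conv_imp_integral_bdd_continuous_conv[OF assms(1-3), of _ "1 / \<bar>Im z\<bar>"]) (auto intro!: continuous_intros)

text \<open>The Lipschitz constant away from the real axis is the same for all probability laws, so
  convergence at a nearby point of \<open>D\<close> carries over to \<open>z\<close>.\<close>

lemma stieltjes_conv_dense:
  assumes \<nu>: "\<And>k. real_distribution (\<nu> k)" and \<mu>: "real_distribution \<mu>"
    and D: "\<And>X. open X \<Longrightarrow> X \<noteq> {} \<Longrightarrow> \<exists>d\<in>D. d \<in> X"
    and conv: "\<And>z. z \<in> D \<Longrightarrow> Im z \<noteq> 0 \<Longrightarrow> (\<lambda>k. stieltjes (\<nu> k) z) \<longlonglongrightarrow> stieltjes \<mu> z"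
    and z: "Im z \<noteq> 0"
  shows "(\<lambda>k. stieltjes (\<nu> k) z) \<longlonglongrightarrow> stieltjes \<mu> z"
proof (rule LIMSEQ_I)
  fix r :: real assume r: "0 < r"
  define c where "c = \<bar>Im z\<bar>"
  have c: "0 < c" using z by (simp add: c_def)
  \<comment> \<open>The first bound keeps |Im w| at least c / 2; the second makes the Lipschitz
    estimate (r c^2 / 8) / (c (c / 2)) = r / 4.\<close>
  define e where "e = min (c / 2) (r * c\<^sup>2 / 8)"
  have e: "0 < e" using c r by (simp add: e_def)
  obtain w where w: "w \<in> D" "w \<in> ball z e" using D[of "ball z e"] e by auto
  have zw: "cmod (z - w) < e" using w by (simp add: dist_norm)
  have "\<bar>Im z - Im w\<bar> \<le> cmod (z - w)" using abs_Im_le_cmod[of "z - w"] by simp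
  then have Imw: "c / 2 \<le> \<bar>Im w\<bar>" using zw unfolding e_def c_def by linarith
  then have w0: "Im w \<noteq> 0" using c by auto
  have close: "cmod (stieltjes N z - stieltjes N w) \<le> r / 4" if "real_distribution N" for N
  proof -
    interpret real_distribution N by fact
    have "cmod (stieltjes N z - stieltjes N w) \<le> cmod (z - w) / (\<bar>Im z\<bar> * \<bar>Im w\<bar>)"
      by (rule stieltjes_lipschitz[OF z w0])
    also have "\<dots> \<le> (r * c\<^sup>2 / 8) / (c * (c / 2))"
      using zw c r Imw by (intro frac_le mult_mono) (auto simp: e_def c_def[symmetric])
    also have "\<dots> = r / 4" using c by (simp add: power2_eq_square)
    finally show ?thesis .
  qed
  obtain N where N: "\<And>k. k \<ge> N \<Longrightarrow> cmod (stieltjes (\<nu> k) w - stieltjes \<mu> w) < r / 4"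
    using LIMSEQ_D[OF conv[OF w(1) w0], of "r / 4"] r by auto
  show "\<exists>N. \<forall>k\<ge>N. cmod (stieltjes (\<nu> k) z - stieltjes \<mu> z) < r"
  proof (intro exI[of _ N] allI impI)
    fix k assume "k \<ge> N"
    have "stieltjes (\<nu> k) z - stieltjes \<mu> z = (stieltjes (\<nu> k) z - stieltjes (\<nu> k) w) +
       (stieltjes (\<nu> k) w - stieltjes \<mu> w) - (stieltjes \<mu> z - stieltjes \<mu> w)" by simp
    also have "cmod \<dots> \<le> cmod (stieltjes (\<nu> k) z - stieltjes (\<nu> k) w) +
       cmod (stieltjes (\<nu> k) w - stieltjes \<mu> w) + cmod (stieltjes \<mu> z - stieltjes \<mu> w)"
      by (intro order_trans[OF norm_triangle_ineq4] add_right_mono norm_triangle_ineq)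
    also have "\<dots> < r"
      using close[OF \<nu>[of k]] close[OF \<mu>] N[OF \<open>k \<ge> N\<close>] r by linarith
    finally show "cmod (stieltjes (\<nu> k) z - stieltjes \<mu> z) < r" .
  qed
qed

lemma (in real_distribution) stieltjes_tail_small:
  assumes "0 < \<epsilon>"
  shows "\<exists>\<eta>>0. 2 * (1 - \<eta> * Im (stieltjes M (\<i> * complex_of_real \<eta>))) < \<epsilon>"
proof -
  have "\<forall>\<^sub>F k in sequentially. real (Suc k) * Im (stieltjes M (\<i> * complex_of_real (real (Suc k)))) > 1 - \<epsilon> / 2"
    using order_tendstoD(1)[OF Im_stieltjes_tendsto_1, of "1 - \<epsilon> / 2"] assms by simp
  then obtain k where "real (Suc k) * Im (stieltjes M (\<i> * complex_of_real (real (Suc k)))) > 1 - \<epsilon> / 2"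
    by (auto simp: eventually_sequentially)
  then show ?thesis by (intro exI[of _ "real (Suc k)"]) auto
qed

text \<open>Each single law has small tails at some scale, so the finitely many early indices are
  absorbed by adding their scales to the common one.\<close>

lemma tightI_eventually:
  assumes \<nu>: "\<And>k. real_distribution (\<nu> k)"
    and tail: "\<And>\<epsilon>::real. 0 < \<epsilon> \<Longrightarrow> \<exists>\<eta>>0. \<forall>\<^sub>F k in sequentially. measure (\<nu> k) {x. \<eta> \<le> \<bar>x\<bar>} < \<epsilon>"
  shows "tight \<nu>"
  unfolding tight_def
proof (intro conjI allI impI)
  fix \<epsilon> :: real assume \<epsilon>: "0 < \<epsilon>"
  obtain e where e: "\<And>k. e k > 0" "\<And>k. measure (\<nu> k) {x. e k \<le> \<bar>x\<bar>} < \<epsilon>"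
    using real_distribution.stieltjes_tail_small[OF \<nu> \<epsilon>] real_distribution.tail_le_stieltjes[OF \<nu>]
    by (metis order.strict_trans1)
  obtain \<eta> N where \<eta>: "\<eta> > 0" and N: "\<And>k. k \<ge> N \<Longrightarrow> measure (\<nu> k) {x. \<eta> \<le> \<bar>x\<bar>} < \<epsilon>"
    using tail[OF \<epsilon>] by (auto simp: eventually_sequentially)
  define b where "b = \<eta> + (\<Sum>k<N. e k)"
  have b: "\<eta> \<le> b" "\<And>k. k < N \<Longrightarrow> e k \<le> b"
    using e(1) \<eta> sum_nonneg[of "{..<N}" e] member_le_sum[of _ "{..<N}" e]
    by (auto simp: b_def less_imp_le intro!: add_increasing)
  have "1 - \<epsilon> < measure (\<nu> k) {- b<..b}" for k
  proof -
    interpret real_distribution "\<nu> k" by (rule \<nu>)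
    obtain r where r: "0 < r" "r \<le> b" "prob {x. r \<le> \<bar>x\<bar>} < \<epsilon>"
      using b N[of k] \<eta> e[of k] by (cases "k < N") (auto simp: not_less)
    have "prob (space (\<nu> k) - {x. r \<le> \<bar>x\<bar>}) = 1 - prob {x. r \<le> \<bar>x\<bar>}"
      by (intro prob_compl) auto
    moreover have "prob (space (\<nu> k) - {x. r \<le> \<bar>x\<bar>}) \<le> prob {- b<..b}"
      using r by (intro finite_measure_mono) auto
    ultimately show ?thesis using r(3) by linarith
  qed
  then show "\<exists>a b. a < b \<and> (\<forall>k. 1 - \<epsilon> < measure (\<nu> k) {a<..b})"
    using b(1) \<eta> by (intro exI[of _ "-b"] exI[of _ b]) auto
qed (rule \<nu>)

text \<open>The scale is chosen for the limit law; convergence at the one point i \<eta> then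
  transfers the tail bound to all late indices.\<close>

lemma stieltjes_conv_imp_tight:
  assumes \<nu>: "\<And>k. real_distribution (\<nu> k)" and \<mu>: "real_distribution \<mu>"
    and conv: "\<And>z. Im z \<noteq> 0 \<Longrightarrow> (\<lambda>k. stieltjes (\<nu> k) z) \<longlonglongrightarrow> stieltjes \<mu> z"
  shows "tight \<nu>"
proof (rule tightI_eventually[OF \<nu>])
  fix \<epsilon> :: real assume \<epsilon>: "0 < \<epsilon>"
  obtain \<eta> where \<eta>: "\<eta> > 0" "2 * (1 - \<eta> * Im (stieltjes \<mu> (\<i> * complex_of_real \<eta>))) < \<epsilon>"
    using real_distribution.stieltjes_tail_small[OF \<mu> \<epsilon>] by metis
  have "(\<lambda>k. 2 * (1 - \<eta> * Im (stieltjes (\<nu> k) (\<i> * complex_of_real \<eta>)))) \<longlonglongrightarrow>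
      2 * (1 - \<eta> * Im (stieltjes \<mu> (\<i> * complex_of_real \<eta>)))"
    using \<eta> by (intro tendsto_intros conv) auto
  from order_tendstoD(2)[OF this \<eta>(2)]
  have "\<forall>\<^sub>F k in sequentially. measure (\<nu> k) {x. \<eta> \<le> \<bar>x\<bar>} < \<epsilon>"
    by (rule eventually_mono) (use real_distribution.tail_le_stieltjes[OF \<nu> \<eta>(1)] in \<open>rule order.strict_trans1\<close>)
  with \<eta>(1) show "\<exists>\<eta>>0. \<forall>\<^sub>F k in sequentially. measure (\<nu> k) {x. \<eta> \<le> \<bar>x\<bar>} < \<epsilon>" by blast
qed

text \<open>The counterpart of the Levy continuity theorem: tightness provides subsequential limits,
  each has the transform of \<mu>, and uniqueness identifies them.\<close>

theorem stieltjes_conv_imp_weak_conv: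
  assumes \<nu>: "\<And>k. real_distribution (\<nu> k)" and \<mu>: "real_distribution \<mu>"
    and conv: "\<And>z. Im z \<noteq> 0 \<Longrightarrow> (\<lambda>k. stieltjes (\<nu> k) z) \<longlonglongrightarrow> stieltjes \<mu> z"
  shows "weak_conv_m \<nu> \<mu>"
proof (rule tight_subseq_weak_converge[OF \<nu> \<mu> stieltjes_conv_imp_tight[OF assms]])
  fix s N assume s: "strict_mono (s :: nat \<Rightarrow> nat)" and N: "real_distribution N" "weak_conv_m (\<nu> \<circ> s) N"
  have "stieltjes N z = stieltjes \<mu> z" if z: "Im z \<noteq> 0" for z
  proof (rule LIMSEQ_unique)
    show "(\<lambda>k. stieltjes ((\<nu> \<circ> s) k) z) \<longlonglongrightarrow> stieltjes N z"
      using \<nu> N z by (intro weak_conv_imp_stieltjes_conv) (auto simp: comp_def)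
    show "(\<lambda>k. stieltjes ((\<nu> \<circ> s) k) z) \<longlonglongrightarrow> stieltjes \<mu> z"
      using LIMSEQ_subseq_LIMSEQ[OF conv[OF z] s] by (simp add: comp_def)
  qed
  then have "N = \<mu>" by (rule stieltjes_unique[OF N(1) \<mu>])
  with N show "weak_conv_m (\<nu> \<circ> s) \<mu>" by simp
qed

section \<open>Measurability\<close>

lemma frob_sq_diff_tendsto_0:
  assumes A: "\<And>k. A k \<in> carrier_mat n n" and B: "B \<in> carrier_mat n n"
    and lim: "\<And>i j. i < n \<Longrightarrow> j < n \<Longrightarrow> (\<lambda>k. A k $$ (i,j)) \<longlonglongrightarrow> B $$ (i,j)"
  shows "(\<lambda>k. frob_sq (A k - B)) \<longlonglongrightarrow> 0"
proof -
  have "(\<lambda>k. \<Sum>p\<in>{..<n} \<times> {..<n}. (cmod (A k $$ p - B $$ p))\<^sup>2) \<longlonglongrightarrow> (\<Sum>p\<in>{..<n} \<times> {..<n}. (cmod (B $$ p - B $$ p))\<^sup>2)"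
    using lim by (intro tendsto_intros) auto
  moreover have "frob_sq (A k - B) = (\<Sum>p\<in>{..<n} \<times> {..<n}. (cmod (A k $$ p - B $$ p))\<^sup>2)" for k
    using A[of k] B by (subst frob_sq_carrier[of _ n n]) (auto intro!: sum.cong)
  ultimately show ?thesis by simp
qed

text \<open>The list \<open>eigvals\<close> is obtained by choice and carries no regularity by
  itself; dependence on the entries is controlled through resolvent traces. All measurability of
  spectral quantities rests on this continuity.\<close>

lemma esd_continuous:
  assumes A: "\<And>k. hermitian_mat n (A k)" and B: "hermitian_mat n B" and n: "0 < n"
    and lim: "\<And>i j. i < n \<Longrightarrow> j < n \<Longrightarrow> (\<lambda>k. A k $$ (i,j)) \<longlonglongrightarrow> B $$ (i,j)"
  shows "weak_conv_m (\<lambda>k. esd (A k)) (esd B)"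
proof (rule stieltjes_conv_imp_weak_conv)
  fix z assume z: "Im z \<noteq> 0"
  have "(\<lambda>k. sqrt (real n * frob_sq (A k - B)) / (Im z)\<^sup>2) \<longlonglongrightarrow> sqrt (real n * 0) / (Im z)\<^sup>2"
    using z hermitian_matD[OF A] hermitian_matD[OF B] lim by (intro tendsto_intros frob_sq_diff_tendsto_0) auto
  then have l: "(\<lambda>k. sqrt (real n * frob_sq (A k - B)) / (Im z)\<^sup>2) \<longlonglongrightarrow> 0" by simp
  have "(\<lambda>k. mtrace (resolvent (A k) z) - mtrace (resolvent B z)) \<longlonglongrightarrow> 0"
    by (rule Lim_null_comparison[OF _ l]) (simp add: mtrace_resolvent_diff_le[OF B A z])
  then have "(\<lambda>k. mtrace (resolvent (A k) z)) \<longlonglongrightarrow> mtrace (resolvent B z)"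
    by (rule LIM_zero_cancel)
  then show "(\<lambda>k. stieltjes (esd (A k)) z) \<longlonglongrightarrow> stieltjes (esd B) z"
    using n by (simp only: stieltjes_esd[OF A n z] stieltjes_esd[OF B n z]) (intro tendsto_intros, auto)
qed (use real_distribution_esd A B n in auto)

text \<open>Individual entries are required as well, because the oscillation bounds for Efron-Stein
  are built from entries of the squared resolvent and must be measurable.\<close>

lemma resolvent_continuous:
  assumes A: "\<And>k. hermitian_mat n (A k)" and B: "hermitian_mat n B" and z: "Im z \<noteq> 0"
    and lim: "\<And>i j. i < n \<Longrightarrow> j < n \<Longrightarrow> (\<lambda>k. A k $$ (i,j)) \<longlonglongrightarrow> B $$ (i,j)"
    and ij: "i < n" "j < n"
  shows "(\<lambda>k. resolvent (A k) z $$ (i,j)) \<longlonglongrightarrow> resolvent B z $$ (i,j)"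
proof -
  have "(\<lambda>k. sqrt (frob_sq (A k - B) / (Im z)\<^sup>2 / (Im z)\<^sup>2)) \<longlonglongrightarrow> sqrt (0 / (Im z)\<^sup>2 / (Im z)\<^sup>2)"
    using z hermitian_matD[OF A] hermitian_matD[OF B] lim by (intro tendsto_intros frob_sq_diff_tendsto_0) auto
  then have l: "(\<lambda>k. sqrt (frob_sq (A k - B) / (Im z)\<^sup>2 / (Im z)\<^sup>2)) \<longlonglongrightarrow> 0" by simp
  have est: "cmod (resolvent (A k) z $$ (i,j) - resolvent B z $$ (i,j)) \<le> sqrt (frob_sq (A k - B) / (Im z)\<^sup>2 / (Im z)\<^sup>2)" for k
  proof -
    let ?R = "resolvent (A k) z" and ?S = "resolvent B z" and ?D = "A k - B"
    note R = resolvent_hermitian[OF A z, of k] and S = resolvent_hermitian[OF B z]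
    have D: "?D \<in> carrier_mat n n" using hermitian_matD[OF A, of k] hermitian_matD[OF B] by auto
    have c: "?R * ?D * ?S \<in> carrier_mat n n" "?R * ?D \<in> carrier_mat n n" using R S D by auto
    have "?R $$ (i,j) = ?S $$ (i,j) - (?R * ?D * ?S) $$ (i,j)"
      by (subst resolvent_identity[OF B A z]) (use c S ij in auto)
    then have "cmod (?R $$ (i,j) - ?S $$ (i,j)) = cmod ((?R * ?D * ?S) $$ (i,j))"
      by (metis add_diff_cancel_left' diff_add_cancel norm_minus_commute)
    also have "\<dots> = sqrt ((cmod ((?R * ?D * ?S) $$ (i,j)))\<^sup>2)" by simp
    also have "\<dots> \<le> sqrt (frob_sq (?R * ?D * ?S))"
      unfolding frob_sq_carrier[OF c(1)]
      using ij member_le_sum[of "(i,j)" "{..<n} \<times> {..<n}" "\<lambda>p. (cmod ((?R * ?D * ?S) $$ p))\<^sup>2"]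
      by (intro real_sqrt_le_mono) auto
    also have "frob_sq (?R * ?D * ?S) \<le> frob_sq ?D / (Im z)\<^sup>2 / (Im z)\<^sup>2"
      using frob_sq_resolvent_mult_le(2)[OF B z c(2)] frob_sq_resolvent_mult_le(1)[OF A z D]
      by (meson divide_right_mono order_trans zero_le_power2)
    finally show ?thesis by simp
  qed
  have "(\<lambda>k. resolvent (A k) z $$ (i,j) - resolvent B z $$ (i,j)) \<longlonglongrightarrow> 0"
    by (rule Lim_null_comparison[OF _ l], rule always_eventually, rule allI, rule est)
  then show ?thesis by (rule LIM_zero_cancel)
qed

text \<open>Independence of the blocks is used on a product space, whose points need not define Hermitian matrices;
  they are therefore symmetrised.\<close>
definition herm_part :: "nat \<Rightarrow> (nat \<times> nat \<Rightarrow> complex) \<Rightarrow> complex mat" where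
  "herm_part n f = mat n n (\<lambda>(i,j). (f (i,j) + cnj (f (j,i))) / 2)"

lemma herm_part_hermitian [simp]: "hermitian_mat n (herm_part n f)"
  unfolding hermitian_mat_def herm_part_def by (auto simp: add.commute)

lemma herm_part_index: "i < n \<Longrightarrow> j < n \<Longrightarrow> herm_part n f $$ (i,j) = (f (i,j) + cnj (f (j,i))) / 2"
  by (simp add: herm_part_def)

lemma herm_part_eq:
  assumes "hermitian_mat n A" "\<And>i j. i < n \<Longrightarrow> j < n \<Longrightarrow> f (i,j) = A $$ (i,j)"
  shows "herm_part n f = A"
proof (rule eq_matI)
  fix i j assume "i < dim_row A" "j < dim_col A"
  then have ij: "i < n" "j < n" using hermitian_matD[OF assms(1)] by auto
  then show "herm_part n f $$ (i,j) = A $$ (i,j)"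
    using hermitian_mat_cnj[OF assms(1) ij] by (simp add: herm_part_index assms(2))
qed (use hermitian_matD[OF assms(1)] in \<open>auto simp: herm_part_def\<close>)

text \<open>Continuity of \<open>F\<close> is known on Hermitian matrices only. Composition with
  \<open>herm_part\<close> extends it to a continuous function of arbitrary entries, which is then
  evaluated at the entries of \<open>Y\<close>.\<close>

lemma borel_measurable_hermitian_functional:
  fixes F :: "complex mat \<Rightarrow> 'b::topological_space"
  assumes Y: "\<And>\<omega>. \<omega> \<in> space N \<Longrightarrow> hermitian_mat n (Y \<omega>)"
    and meas: "\<And>i j. i < n \<Longrightarrow> j < n \<Longrightarrow> (\<lambda>\<omega>. Y \<omega> $$ (i,j)) \<in> borel_measurable N"
    and cont: "\<And>A B. (\<And>k. hermitian_mat n (A k)) \<Longrightarrow> hermitian_mat n B \<Longrightarrow>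
      (\<And>i j. i < n \<Longrightarrow> j < n \<Longrightarrow> (\<lambda>k. A k $$ (i,j)) \<longlonglongrightarrow> B $$ (i,j)) \<Longrightarrow> (\<lambda>k. F (A k)) \<longlonglongrightarrow> F B"
  shows "(\<lambda>\<omega>. F (Y \<omega>)) \<in> borel_measurable N"
proof -
  \<comment> \<open>Padding with 0 turns the matrix entries into a point of the product space of all
    functions on index pairs, where sequential continuity suffices.\<close>
  define G where "G \<omega> = (\<lambda>p. if fst p < n \<and> snd p < n then Y \<omega> $$ p else 0)" for \<omega>
  have G: "G \<in> borel_measurable N"
  proof (rule measurable_coordinatewise_then_product)
    fix p :: "nat \<times> nat"
    show "(\<lambda>\<omega>. G \<omega> p) \<in> borel_measurable N"
      using meas[of "fst p" "snd p"] by (cases "fst p < n \<and> snd p < n") (auto simp: G_def)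
  qed
  have "continuous_on UNIV (\<lambda>f. F (herm_part n f))"
    unfolding continuous_on_sequentially
  proof (intro allI ballI impI, elim conjE)
    fix x :: "nat \<Rightarrow> nat \<times> nat \<Rightarrow> complex" and a
    assume "x \<longlonglongrightarrow> a"
    then have xa: "(\<lambda>k. x k p) \<longlonglongrightarrow> a p" for p
      using continuous_on_tendsto_compose[OF continuous_on_product_coordinates[of p], of x a sequentially] by simp
    have "(\<lambda>k. F (herm_part n (x k))) \<longlonglongrightarrow> F (herm_part n a)"
      by (rule cont) (auto simp: herm_part_index intro!: tendsto_intros xa)
    then show "((\<lambda>f. F (herm_part n f)) \<circ> x) \<longlonglongrightarrow> F (herm_part n a)" by (simp add: comp_def)
  qed
  then have "(\<lambda>f. F (herm_part n f)) \<in> borel_measurable borel" by (rule borel_measurable_continuous_onI)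
  from measurable_compose[OF G this]
  have "(\<lambda>\<omega>. F (herm_part n (G \<omega>))) \<in> borel_measurable N" .
  moreover have "F (herm_part n (G \<omega>)) = F (Y \<omega>)" if "\<omega> \<in> space N" for \<omega>
    using herm_part_eq[OF Y[OF that], of "G \<omega>"] by (simp add: G_def)
  ultimately show ?thesis by (simp cong: measurable_cong)
qed

section \<open>Random spectral distributions and their mean\<close>

lemma norm_cts_step_le: "a < b \<Longrightarrow> norm (cts_step a b x) \<le> 1"
  by (auto simp: cts_step_def divide_le_eq)

text \<open>Dimension 0 is excluded because \<open>esd\<close> of the empty matrix is the zero
  measure, not a probability measure.\<close>

locale random_hermitian = prob_space M for M :: "'a measure" +
  fixes n :: nat and Y :: "'a \<Rightarrow> complex mat"
  assumes herm: "\<And>\<omega>. \<omega> \<in> space M \<Longrightarrow> hermitian_mat n (Y \<omega>)"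
    and entry_measurable: "\<And>i j. i < n \<Longrightarrow> j < n \<Longrightarrow> (\<lambda>\<omega>. Y \<omega> $$ (i,j)) \<in> borel_measurable M"
    and n_pos: "0 < n"
begin

text \<open>Used for integrals of continuous functions, for Stieltjes transforms and for the
  distance to a fixed law.\<close>

lemma measurable_of_weakly_continuous:
  fixes \<phi> :: "real measure \<Rightarrow> 'b::topological_space"
  assumes "\<And>\<nu> \<nu>'. (\<And>k. real_distribution (\<nu> k)) \<Longrightarrow> real_distribution \<nu>' \<Longrightarrow> weak_conv_m \<nu> \<nu>' \<Longrightarrow>
    (\<lambda>k. \<phi> (\<nu> k)) \<longlonglongrightarrow> \<phi> \<nu>'"
  shows "(\<lambda>\<omega>. \<phi> (esd (Y \<omega>))) \<in> borel_measurable M"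
proof (rule borel_measurable_hermitian_functional[OF herm entry_measurable])
  fix A :: "nat \<Rightarrow> complex mat" and B
  assume A: "\<And>k. hermitian_mat n (A k)" and B: "hermitian_mat n B"
    and lim: "\<And>i j. i < n \<Longrightarrow> j < n \<Longrightarrow> (\<lambda>k. A k $$ (i,j)) \<longlonglongrightarrow> B $$ (i,j)"
  show "(\<lambda>k. \<phi> (esd (A k))) \<longlonglongrightarrow> \<phi> (esd B)"
    using esd_continuous[OF A B n_pos lim] A B by (intro assms) (auto intro: real_distribution_esd n_pos)
qed

lemma real_distribution_Y: "\<omega> \<in> space M \<Longrightarrow> real_distribution (esd (Y \<omega>))"
  using real_distribution_esd[OF herm n_pos] .

text \<open>Half-lines generate the Borel sets and are closed under intersection, so measurable
  distribution functions suffice; these are limits of integrals of continuous steps.\<close>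

lemma measurable_esd: "(\<lambda>\<omega>. esd (Y \<omega>)) \<in> M \<rightarrow>\<^sub>M prob_algebra borel"
proof (rule measurable_prob_algebra_generated[where \<Omega>=UNIV and G="range (\<lambda>a::real. {..a})"])
  show "sets borel = sigma_sets UNIV (range (\<lambda>a::real. {..a}))"
    by (subst borel_eq_atMost) simp
  show "Int_stable (range (\<lambda>a::real. {..a}))"
    by (auto simp: Int_stable_def)
  fix \<omega> assume "\<omega> \<in> space M"
  then interpret e: real_distribution "esd (Y \<omega>)" by (rule real_distribution_Y)
  show "prob_space (esd (Y \<omega>))" "sets (esd (Y \<omega>)) = sets borel"
    by (rule e.prob_space_axioms, rule e.events_eq_borel)
next
  fix S :: "real set" assume "S \<in> range (\<lambda>a::real. {..a})"
  then obtain a where S: "S = {..a}" by auto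
  have "(\<lambda>\<omega>. cdf (esd (Y \<omega>)) a) \<in> borel_measurable M"
  proof (rule borel_measurable_LIMSEQ_real)
    fix k :: nat
    let ?b = "a + 1 / real (Suc k)"
    have ab: "a < ?b" by simp
    have bd: "norm (cts_step a ?b x) \<le> 1" for x
      using ab by (rule norm_cts_step_le)
    from ab have cont: "isCont (cts_step a (a + 1 / real (Suc k))) x" for x
      using uniformly_continuous_imp_continuous[OF cts_step_uniformly_continuous] by (auto simp: continuous_on_eq_continuous_at)
    show "(\<lambda>\<omega>. integral\<^sup>L (esd (Y \<omega>)) (cts_step a (a + 1 / real (Suc k)))) \<in> borel_measurable M"
      by (rule measurable_of_weakly_continuous, rule weak_conv_imp_integral_bdd_continuous_conv[OF _ _ _ cont bd])
  next
    fix \<omega> assume "\<omega> \<in> space M"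
    then interpret e: real_distribution "esd (Y \<omega>)" by (rule real_distribution_Y)
    have "(cdf (esd (Y \<omega>)) \<longlongrightarrow> cdf (esd (Y \<omega>)) a) (at_right a)"
      using e.cdf_is_right_cont[of a] by (simp add: continuous_within)
    moreover have "filterlim (\<lambda>k. a + 1 / real (Suc k)) (at_right a) sequentially"
      by real_asymp
    ultimately have r: "(\<lambda>k. cdf (esd (Y \<omega>)) (a + 1 / real (Suc k))) \<longlonglongrightarrow> cdf (esd (Y \<omega>)) a"
      by (rule filterlim_compose)
    \<comment> \<open>The step from \<open>a\<close> to a + 1/(k+1) has integral between the
      distribution function at these two points, and right continuity closes the gap.\<close>
    show "(\<lambda>k. integral\<^sup>L (esd (Y \<omega>)) (cts_step a (a + 1 / real (Suc k)))) \<longlonglongrightarrow> cdf (esd (Y \<omega>)) a"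
      by (rule tendsto_sandwich[OF _ _ tendsto_const r]) (auto intro!: always_eventually e.cdf_cts_step)
  qed
  moreover have "emeasure (esd (Y \<omega>)) S = ennreal (cdf (esd (Y \<omega>)) a)" if "\<omega> \<in> space M" for \<omega>
  proof -
    interpret e: real_distribution "esd (Y \<omega>)" using that by (rule real_distribution_Y)
    show ?thesis unfolding S cdf_def by (rule e.emeasure_eq_measure)
  qed
  ultimately show "(\<lambda>\<omega>. emeasure (esd (Y \<omega>)) S) \<in> borel_measurable M"
    by (simp cong: measurable_cong)
qed auto

text \<open>As a monadic bind the mean law inherits the probability property and Fubini for bounded
  integrands.\<close>

lemma mean_measure_eq_bind: "mean_measure M (\<lambda>\<omega>. esd (Y \<omega>)) = M \<bind> (\<lambda>\<omega>. esd (Y \<omega>))"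
proof -
  let ?B = "M \<bind> (\<lambda>\<omega>. esd (Y \<omega>))"
  have s: "sets ?B = sets borel"
    by (rule sets_bind'[OF _ measurable_esd]) (simp add: space_prob_algebra prob_space_axioms)
  then have sp: "space ?B = UNIV" using sets_eq_imp_space_eq[OF s] by simp
  have "?B = measure_of UNIV (sets borel) (emeasure ?B)"
    using measure_of_of_measure[of ?B] s sp by simp
  also have "\<dots> = mean_measure M (\<lambda>\<omega>. esd (Y \<omega>))"
    unfolding mean_measure_def
  proof (rule measure_of_eq)
    fix S :: "real set" assume "S \<in> sigma_sets UNIV (sets borel)"
    then have "S \<in> sets borel" using sets.sigma_sets_eq[of "borel :: real measure"] by simp
    then show "emeasure ?B S = (\<integral>\<^sup>+\<omega>. emeasure (esd (Y \<omega>)) S \<partial>M)"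
      using emeasure_bind[OF not_empty measurable_prob_algebraD[OF measurable_esd]] by simp
  qed simp
  finally show ?thesis by simp
qed

lemma real_distribution_mean: "real_distribution (mean_measure M (\<lambda>\<omega>. esd (Y \<omega>)))"
proof -
  have M: "M \<in> space (prob_algebra M)" by (simp add: space_prob_algebra prob_space_axioms)
  show ?thesis
    unfolding mean_measure_eq_bind real_distribution_def real_distribution_axioms_def
    using prob_space_bind'[OF M measurable_esd] sets_bind'[OF M measurable_esd] by simp
qed

lemma measurable_stieltjes_esd: "Im z \<noteq> 0 \<Longrightarrow> (\<lambda>\<omega>. stieltjes (esd (Y \<omega>)) z) \<in> borel_measurable M"
  by (rule measurable_of_weakly_continuous) (rule weak_conv_imp_stieltjes_conv)

lemma integral_mean_measure:
  fixes f :: "real \<Rightarrow> real"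
  assumes "f \<in> borel_measurable borel" "\<And>x. \<bar>f x\<bar> \<le> B"
  shows "(\<integral>x. f x \<partial>mean_measure M (\<lambda>\<omega>. esd (Y \<omega>))) = (\<integral>\<omega>. (\<integral>x. f x \<partial>esd (Y \<omega>)) \<partial>M)"
  unfolding mean_measure_eq_bind
proof (rule integral_bind[where K=borel and B=B and B'=1])
  show "(\<lambda>\<omega>. esd (Y \<omega>)) \<in> M \<rightarrow>\<^sub>M subprob_algebra borel"
    by (rule measurable_prob_algebraD[OF measurable_esd])
  show "AE \<omega> in M. emeasure (esd (Y \<omega>)) (space (esd (Y \<omega>))) \<le> ennreal 1"
    using real_distribution_Y by (intro AE_I2) (simp add: real_distribution_def prob_space.emeasure_space_1)
qed (use assms finite_measure_axioms in auto)

text \<open>Fubini for the kernel, taken separately for real and imaginary parts because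
  \<open>integral_mean_measure\<close> concerns real integrands.\<close>

lemma stieltjes_mean_measure:
  assumes z: "Im z \<noteq> 0"
  shows "stieltjes (mean_measure M (\<lambda>\<omega>. esd (Y \<omega>))) z = (\<integral>\<omega>. stieltjes (esd (Y \<omega>)) z \<partial>M)"
proof -
  let ?m = "mean_measure M (\<lambda>\<omega>. esd (Y \<omega>))"
  let ?K = "\<lambda>x. 1 / (complex_of_real x - z)"
  note [measurable] = measurable_stieltjes_esd[OF z]
  have bR: "\<bar>Re (?K x)\<bar> \<le> 1 / \<bar>Im z\<bar>" and bI: "\<bar>Im (?K x)\<bar> \<le> 1 / \<bar>Im z\<bar>" for x
    using norm_stieltjes_kernel_le[OF z, of x] abs_Re_le_cmod[of "?K x"] abs_Im_le_cmod[of "?K x"] by linarith+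
  have int: "integrable M (\<lambda>\<omega>. stieltjes (esd (Y \<omega>)) z)"
    using real_distribution.norm_stieltjes_le[OF real_distribution_Y z]
    by (intro integrable_bounded[where b="1 / \<bar>Im z\<bar>"]) auto
  have re: "Re (stieltjes N z) = (\<integral>x. Re (?K x) \<partial>N)" and im: "Im (stieltjes N z) = (\<integral>x. Im (?K x) \<partial>N)"
    if "real_distribution N" for N
    unfolding stieltjes_def
    using integral_Re[OF real_distribution.integrable_stieltjes_kernel[OF that z]]
      integral_Im[OF real_distribution.integrable_stieltjes_kernel[OF that z]] by simp_all
  have "Re (stieltjes ?m z) = (\<integral>\<omega>. (\<integral>x. Re (?K x) \<partial>esd (Y \<omega>)) \<partial>M)"
    unfolding re[OF real_distribution_mean] by (rule integral_mean_measure[OF _ bR]) measurable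
  also have "\<dots> = (\<integral>\<omega>. Re (stieltjes (esd (Y \<omega>)) z) \<partial>M)"
    by (intro Bochner_Integration.integral_cong refl re[symmetric] real_distribution_Y)
  also have "\<dots> = Re (\<integral>\<omega>. stieltjes (esd (Y \<omega>)) z \<partial>M)" using int by simp
  finally have 1: "Re (stieltjes ?m z) = Re (\<integral>\<omega>. stieltjes (esd (Y \<omega>)) z \<partial>M)" .
  have "Im (stieltjes ?m z) = (\<integral>\<omega>. (\<integral>x. Im (?K x) \<partial>esd (Y \<omega>)) \<partial>M)"
    unfolding im[OF real_distribution_mean] by (rule integral_mean_measure[OF _ bI]) measurable
  also have "\<dots> = (\<integral>\<omega>. Im (stieltjes (esd (Y \<omega>)) z) \<partial>M)"
    by (intro Bochner_Integration.integral_cong refl im[symmetric] real_distribution_Y)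
  also have "\<dots> = Im (\<integral>\<omega>. stieltjes (esd (Y \<omega>)) z \<partial>M)" using int by simp
  finally show ?thesis using 1 by (simp add: complex_eq_iff)
qed

end

section \<open>Variance of the truncated Stieltjes transform\<close>

lemma sum_square_eq_sum_block:
  fixes f :: "nat \<times> nat \<Rightarrow> 'b::comm_monoid_add"
  assumes "B \<subseteq> {..<n} \<times> {..<n}" "\<And>p. p \<in> {..<n} \<times> {..<n} \<Longrightarrow> p \<notin> B \<Longrightarrow> f p = 0"
  shows "(\<Sum>p\<in>{..<n} \<times> {..<n}. f p) = (\<Sum>p\<in>B. f p)"
  using assms by (intro sum.mono_neutral_right) auto

text \<open>A change of the raw entries on \<open>B\<close> alters the symmetrised matrix on
  \<open>B\<close> and on its transpose; pulling the linear term back to \<open>B\<close> pairs it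
  with S at p and at the swapped p. The factor 2 comes from (t + u)^2 \<le> 2 (t^2 + u^2) for linear
  term and remainder.\<close>

lemma resolvent_block_perturbation:
  fixes f g :: "nat \<times> nat \<Rightarrow> complex"
  assumes B: "B \<subseteq> {..<n} \<times> {..<n}"
    and eq: "\<And>p. p \<in> {..<n} \<times> {..<n} \<Longrightarrow> p \<notin> B \<Longrightarrow> f p = g p"
    and bd: "\<And>p. p \<in> B \<Longrightarrow> cmod (g p - f p) \<le> l"
    and z: "Im z \<noteq> 0"
  defines "S \<equiv> resolvent (herm_part n f) z * resolvent (herm_part n f) z"
  shows "(cmod (mtrace (resolvent (herm_part n g) z) - mtrace (resolvent (herm_part n f) z)))\<^sup>2 \<le>
    2 * (l\<^sup>2 * card B * (\<Sum>p\<in>B. ((cmod (S $$ p))\<^sup>2 + (cmod (S $$ prod.swap p))\<^sup>2) / 2)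
       + (l\<^sup>2 * card B)\<^sup>2 / \<bar>Im z\<bar> ^ 6)"
proof -
  let ?Q = "{..<n} \<times> {..<n}"
  let ?F = "herm_part n f" and ?G = "herm_part n g"
  define \<delta> where "\<delta> p = g p - f p" for p
  define s where "s = (\<Sum>p\<in>B. (cmod (\<delta> p))\<^sup>2)"
  have FG: "hermitian_mat n ?F" "hermitian_mat n ?G" by simp_all
  note R = resolvent_hermitian[OF FG(1) z]
  have S: "S \<in> carrier_mat n n" using R by (simp add: S_def)
  have fB: "finite B" using B finite_subset by blast
  have D: "?G - ?F \<in> carrier_mat n n" using hermitian_matD(1)[OF FG(1)] hermitian_matD(1)[OF FG(2)] by auto
  have Dp: "(?G - ?F) $$ p = (\<delta> p + cnj (\<delta> (prod.swap p))) / 2" if pQ: "p \<in> ?Q" for p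
  proof -
    obtain i j where p: "p = (i,j)" "i < n" "j < n" using pQ by auto
    then have "(?G - ?F) $$ p = ?G $$ (i,j) - ?F $$ (i,j)"
      using hermitian_matD(2,3)[OF FG(1)] by simp
    also have "\<dots> = (\<delta> p + cnj (\<delta> (prod.swap p))) / 2"
      using p by (simp add: herm_part_index \<delta>_def diff_divide_distrib add_divide_distrib)
    finally show ?thesis .
  qed
  have \<delta>0: "\<delta> p = 0" if "p \<in> ?Q" "p \<notin> B" for p using eq[OF that] by (simp add: \<delta>_def)
  have s0: "0 \<le> s" by (simp add: s_def sum_nonneg)
  have s_le: "s \<le> l\<^sup>2 * card B"
  proof -
    have "s \<le> (\<Sum>p\<in>B. l\<^sup>2)"
      unfolding s_def \<delta>_def by (intro sum_mono power_mono bd) auto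
    then show ?thesis by (simp add: mult.commute)
  qed
  have sQ: "(\<Sum>p\<in>?Q. (cmod (\<delta> p))\<^sup>2) = s"
    unfolding s_def by (rule sum_square_eq_sum_block[OF B]) (simp add: \<delta>0)
  have swapQ: "(\<Sum>p\<in>?Q. h (prod.swap p)) = (\<Sum>p\<in>?Q. h p)" for h :: "nat \<times> nat \<Rightarrow> 'c::comm_monoid_add"
    by (subst (2) sum_transpose) (auto intro!: sum.cong)
  \<comment> \<open>Symmetrisation averages an entry with a conjugated transposed one, and the swap
    permutes the index square, so by convexity the Frobenius norm does not grow.\<close>
  have fro: "frob_sq (?G - ?F) \<le> s"
  proof -
    have "(cmod ((a + cnj b) / 2))\<^sup>2 \<le> ((cmod a)\<^sup>2 + (cmod b)\<^sup>2) / 2" for a b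
    proof -
      have "cmod ((a + cnj b) / 2) \<le> (cmod a + cmod b) / 2"
        using norm_triangle_ineq[of a "cnj b"] by (simp add: norm_divide)
      then have "(cmod ((a + cnj b) / 2))\<^sup>2 \<le> ((cmod a + cmod b) / 2)\<^sup>2" by (intro power_mono) auto
      also have "\<dots> \<le> ((cmod a)\<^sup>2 + (cmod b)\<^sup>2) / 2"
        using sum_squares_bound[of "cmod a" "cmod b"] by (simp add: power2_eq_square field_simps)
      finally show ?thesis .
    qed
    then have "frob_sq (?G - ?F) \<le> (\<Sum>p\<in>?Q. ((cmod (\<delta> p))\<^sup>2 + (cmod (\<delta> (prod.swap p)))\<^sup>2) / 2)"
      unfolding frob_sq_carrier[OF D] by (intro sum_mono) (simp add: Dp)
    also have "\<dots> = ((\<Sum>p\<in>?Q. (cmod (\<delta> p))\<^sup>2) + (\<Sum>p\<in>?Q. (cmod (\<delta> (prod.swap p)))\<^sup>2)) / 2"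
      by (simp add: sum.distrib flip: sum_divide_distrib)
    also have "\<dots> = s" using swapQ[of "\<lambda>p. (cmod (\<delta> p))\<^sup>2"] sQ by simp
    finally show ?thesis .
  qed
  define a where "a = (\<Sum>p\<in>B. (cmod (S $$ p))\<^sup>2)"
  define b where "b = (\<Sum>p\<in>B. (cmod (S $$ prod.swap p))\<^sup>2)"
  have ab0: "0 \<le> a" "0 \<le> b" by (auto simp: a_def b_def sum_nonneg)
  have tr: "(cmod (mtrace (S * (?G - ?F))))\<^sup>2 \<le> s * ((a + b) / 2)"
  proof -
    have "mtrace (S * (?G - ?F)) = (\<Sum>p\<in>?Q. S $$ p * (?G - ?F) $$ prod.swap p)"
      unfolding mtrace_mult[OF S D] by (rule sum.cong) auto
    also have "\<dots> = (\<Sum>p\<in>?Q. (S $$ p * \<delta> (prod.swap p) + S $$ p * cnj (\<delta> p)) / 2)"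
      by (intro sum.cong refl) (subst Dp, auto simp: algebra_simps)
    also have "\<dots> = ((\<Sum>p\<in>?Q. S $$ p * \<delta> (prod.swap p)) + (\<Sum>p\<in>?Q. S $$ p * cnj (\<delta> p))) / 2"
      by (simp add: sum.distrib flip: sum_divide_distrib)
    also have "(\<Sum>p\<in>?Q. S $$ p * \<delta> (prod.swap p)) = (\<Sum>p\<in>?Q. S $$ prod.swap p * \<delta> p)"
      using swapQ[of "\<lambda>p. S $$ prod.swap p * \<delta> p"] by simp
    also have "\<dots> = (\<Sum>p\<in>B. S $$ prod.swap p * \<delta> p)"
      by (rule sum_square_eq_sum_block[OF B]) (simp add: \<delta>0)
    also have "(\<Sum>p\<in>?Q. S $$ p * cnj (\<delta> p)) = (\<Sum>p\<in>B. S $$ p * cnj (\<delta> p))"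
      by (rule sum_square_eq_sum_block[OF B]) (simp add: \<delta>0)
    finally have e: "mtrace (S * (?G - ?F)) = ((\<Sum>p\<in>B. S $$ prod.swap p * \<delta> p) + (\<Sum>p\<in>B. S $$ p * cnj (\<delta> p))) / 2" .
    have "cmod (mtrace (S * (?G - ?F))) \<le>
        (cmod (\<Sum>p\<in>B. S $$ prod.swap p * \<delta> p) + cmod (\<Sum>p\<in>B. S $$ p * cnj (\<delta> p))) / 2"
      unfolding e by (simp add: norm_divide norm_triangle_ineq)
    also have "\<dots> \<le> (sqrt b * sqrt s + sqrt a * sqrt s) / 2"
      using norm_sum_mult_le[of "\<lambda>p. S $$ prod.swap p" \<delta> B] norm_sum_mult_le[of "\<lambda>p. S $$ p" "\<lambda>p. cnj (\<delta> p)" B]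
      by (simp add: a_def b_def s_def)
    finally have "(cmod (mtrace (S * (?G - ?F))))\<^sup>2 \<le> ((sqrt b * sqrt s + sqrt a * sqrt s) / 2)\<^sup>2"
      by (intro power_mono) auto
    also have "\<dots> = s * ((sqrt a + sqrt b) / 2)\<^sup>2"
    proof -
      have "((sqrt b * sqrt s + sqrt a * sqrt s) / 2)\<^sup>2 = (sqrt s * ((sqrt a + sqrt b) / 2))\<^sup>2"
        by (simp add: algebra_simps)
      then show ?thesis using s0 by (simp only: power_mult_distrib real_sqrt_pow2)
    qed
    also have "\<dots> \<le> s * ((a + b) / 2)"
    proof (intro mult_left_mono s0)
      have "2 * sqrt a * sqrt b \<le> a + b"
        using sum_squares_bound[of "sqrt a" "sqrt b"] ab0 by simp
      then show "((sqrt a + sqrt b) / 2)\<^sup>2 \<le> (a + b) / 2"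
        using ab0 by (simp add: power_divide power2_sum)
    qed
    finally show ?thesis .
  qed
  define t where "t = cmod (mtrace (S * (?G - ?F)))"
  define u where "u = frob_sq (?G - ?F) / \<bar>Im z\<bar> ^ 3"
  have "(cmod (mtrace (resolvent ?G z) - mtrace (resolvent ?F z)))\<^sup>2 \<le> (t + u)\<^sup>2"
    unfolding t_def u_def S_def by (intro power_mono mtrace_resolvent_taylor[OF FG z]) simp
  also have "\<dots> \<le> 2 * (t\<^sup>2 + u\<^sup>2)"
    using sum_squares_bound[of t u] by (simp add: power2_sum)
  also have "\<dots> \<le> 2 * (l\<^sup>2 * card B * ((a + b) / 2) + (l\<^sup>2 * card B)\<^sup>2 / \<bar>Im z\<bar> ^ 6)"
  proof (intro mult_left_mono add_mono)
    have "t\<^sup>2 \<le> s * ((a + b) / 2)" unfolding t_def by (rule tr)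
    also have "\<dots> \<le> l\<^sup>2 * card B * ((a + b) / 2)" using s_le ab0 by (intro mult_right_mono) auto
    finally show "t\<^sup>2 \<le> l\<^sup>2 * card B * ((a + b) / 2)" .
    have "u\<^sup>2 = (frob_sq (?G - ?F))\<^sup>2 / \<bar>Im z\<bar> ^ 6"
      by (simp add: u_def power_divide flip: power_mult)
    also have "\<dots> \<le> (l\<^sup>2 * card B)\<^sup>2 / \<bar>Im z\<bar> ^ 6"
      using fro s_le by (intro divide_right_mono power_mono) auto
    finally show "u\<^sup>2 \<le> (l\<^sup>2 * card B)\<^sup>2 / \<bar>Im z\<bar> ^ 6" .
  qed simp
  also have "(a + b) / 2 = (\<Sum>p\<in>B. ((cmod (S $$ p))\<^sup>2 + (cmod (S $$ prod.swap p))\<^sup>2) / 2)"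
    by (simp add: a_def b_def sum.distrib flip: sum_divide_distrib)
  finally show ?thesis .
qed

text \<open>Large values are set to 0 instead of being clipped, so what is removed is exactly the
  part of an entry that property L measures.\<close>

definition trunc :: "real \<Rightarrow> complex \<Rightarrow> complex" where
  "trunc K w = (if cmod w \<le> K then w else 0)"

lemma norm_trunc_le: "0 \<le> K \<Longrightarrow> cmod (trunc K w) \<le> K"
  by (simp add: trunc_def)

lemma measurable_trunc [measurable]: "trunc K \<in> borel_measurable borel"
  unfolding trunc_def[abs_def] by measurable

section \<open>Entries organised by blocks\<close>

lemma sum_partition:
  assumes P: "partition_on A P" "finite A"
  shows "(\<Sum>B\<in>P. \<Sum>p\<in>B. h p) = (\<Sum>p\<in>A. h p :: 'b::comm_monoid_add)"
proof -
  have "\<Union>P = A" "disjoint P" using P by (auto simp: partition_on_def)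
  moreover have "finite B" if "B \<in> P" for B
    using that P by (metis Union_upper finite_subset partition_onD1)
  moreover have "finite P" using P by (metis finite_UnionD partition_onD1)
  ultimately show ?thesis
    using sum.Union_disjoint[of P h] by (auto simp: disjoint_def)
qed

text \<open>A point \<open>x\<close> of the product space assigns to each block a function on its
  positions; the entry at \<open>p\<close> is therefore \<open>x (block_of P p) p\<close>.\<close>

definition block_of :: "'p set set \<Rightarrow> 'p \<Rightarrow> 'p set" where
  "block_of P p = (THE B. B \<in> P \<and> p \<in> B)"

lemma block_of_eq:
  assumes "partition_on A P" "B \<in> P" "p \<in> B"
  shows "block_of P p = B"
  unfolding block_of_def
proof (rule the_equality)
  fix C assume "C \<in> P \<and> p \<in> C"
  then show "C = B" using partition_onD2[OF assms(1)] assms(2,3) by (auto simp: disjoint_def)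
qed (use assms in auto)

lemma block_of_mem:
  assumes "partition_on A P" "p \<in> A"
  shows "block_of P p \<in> P" "p \<in> block_of P p"
proof -
  obtain B where "B \<in> P" "p \<in> B" using assms by (auto simp: partition_on_def)
  then show "block_of P p \<in> P" "p \<in> block_of P p" using block_of_eq[OF assms(1)] by auto
qed

lemma sum_frob_sq_blocks:
  assumes P: "partition_on ({..<n} \<times> {..<n}) P" and S: "S \<in> carrier_mat n n"
  shows "(\<Sum>B\<in>P. \<Sum>p\<in>B. ((cmod (S $$ p))\<^sup>2 + (cmod (S $$ prod.swap p))\<^sup>2) / 2) = frob_sq S"
proof -
  let ?Q = "{..<n} \<times> {..<n}"
  have "(\<Sum>B\<in>P. \<Sum>p\<in>B. ((cmod (S $$ p))\<^sup>2 + (cmod (S $$ prod.swap p))\<^sup>2) / 2) =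
      (\<Sum>p\<in>?Q. ((cmod (S $$ p))\<^sup>2 + (cmod (S $$ prod.swap p))\<^sup>2) / 2)"
    by (rule sum_partition[OF P]) simp
  also have "\<dots> = ((\<Sum>p\<in>?Q. (cmod (S $$ p))\<^sup>2) + (\<Sum>p\<in>?Q. (cmod (S $$ prod.swap p))\<^sup>2)) / 2"
    by (simp add: sum.distrib flip: sum_divide_distrib)
  also have "(\<Sum>p\<in>?Q. (cmod (S $$ prod.swap p))\<^sup>2) = (\<Sum>p\<in>?Q. (cmod (S $$ p))\<^sup>2)"
    by (subst (2) sum_transpose) (auto intro!: sum.cong)
  finally show ?thesis unfolding frob_sq_carrier[OF S] by simp
qed

text \<open>Two truncated scaled entries differ by at most l = 2 K / sqrt n, so l^2 = 4 K^2 / n. The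
  linear terms sum to l^2 d n / |Im z|^4 and the remainders to l^4 d n^2 / |Im z|^6; division by n^2
  and the factor 2 of the block estimate give this constant times d / n^2.\<close>

definition var_const :: "real \<Rightarrow> complex \<Rightarrow> real" where
  "var_const K z = 2 * (4 * K\<^sup>2 / \<bar>Im z\<bar> ^ 4 + 16 * K ^ 4 / \<bar>Im z\<bar> ^ 6)"

text \<open>Efron-Stein on the product of the block laws. \<open>h\<close> stands for the real or
  the imaginary part, since \<open>efron_stein\<close> concerns real functions.\<close>

lemma product_variance_le:
  fixes N :: "(nat \<times> nat) set \<Rightarrow> (nat \<times> nat \<Rightarrow> complex) measure" and h :: "complex \<Rightarrow> real"
  assumes P: "partition_on ({..<n} \<times> {..<n}) P" and card: "\<And>B. B \<in> P \<Longrightarrow> card B \<le> d"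
    and N: "\<And>B. prob_space (N B)" "\<And>B. sets (N B) = sets (PiM B (\<lambda>_. borel))"
    and z: "Im z \<noteq> 0" and K: "0 \<le> K" and n: "0 < n"
    and h: "h \<in> borel_measurable borel" "\<And>v w. \<bar>h v - h w\<bar> \<le> cmod (v - w)" "h 0 = 0"
  defines "T \<equiv> (\<lambda>x. herm_part n (\<lambda>p. complex_of_real (1 / sqrt n) * trunc K (x (block_of P p) p)))"
  defines "f \<equiv> (\<lambda>x. h (mtrace (resolvent (T x) z) / of_nat n))"
  shows "f \<in> borel_measurable (PiM P N)"
    "(\<integral>x. (f x)\<^sup>2 \<partial>PiM P N) - (\<integral>x. f x \<partial>PiM P N)\<^sup>2 \<le> var_const K z * (real d / (real n)\<^sup>2)"
proof -
  let ?Q = "{..<n} \<times> {..<n}"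
  define S where "S x = resolvent (T x) z * resolvent (T x) z" for x
  define l where "l = 2 * K / sqrt n"
  have l2: "l\<^sup>2 = 4 * K\<^sup>2 / n" using n by (simp add: l_def power_divide power_mult_distrib)
  define \<sigma> where "\<sigma> B x = (\<Sum>p\<in>B. ((cmod (S x $$ p))\<^sup>2 + (cmod (S x $$ prod.swap p))\<^sup>2) / 2)" for B x
  \<comment> \<open>In the quadratic term one factor \<open>card B\<close> is raised to
    \<open>d\<close> and the other kept: summed over the blocks, \<open>card B\<close> gives n^2,
    while \<sigma> gives the squared Frobenius norm of \<open>S x\<close>.\<close>
  define G where "G B x = 2 / (real n)\<^sup>2 * (l\<^sup>2 * d * \<sigma> B x + (l\<^sup>2 * d) * (l\<^sup>2 * card B) / \<bar>Im z\<bar> ^ 6)" for B x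
  have T: "hermitian_mat n (T x)" for x by (simp add: T_def)
  have finP: "finite P" using P by (metis finite_UnionD finite_cartesian_product finite_lessThan partition_onD1)
  have BQ: "B \<subseteq> ?Q" if "B \<in> P" for B using partition_onD1[OF P] that by auto
  have ent: "(\<lambda>x. trunc K (x (block_of P p) p)) \<in> borel_measurable (PiM P N)" if p: "p \<in> ?Q" for p
  proof -
    note b = block_of_mem[OF P p]
    have "(\<lambda>y. y p) \<in> N (block_of P p) \<rightarrow>\<^sub>M borel"
      using measurable_component_singleton[OF b(2), of "\<lambda>_. borel :: complex measure"]
      by (simp cong: measurable_cong_sets add: N(2))
    from measurable_compose[OF measurable_component_singleton[OF b(1), of N] this]
    have "(\<lambda>x. x (block_of P p) p) \<in> borel_measurable (PiM P N)" .
    from measurable_compose[OF this measurable_trunc] show ?thesis .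
  qed
  have Tm: "(\<lambda>x. T x $$ (i,j)) \<in> borel_measurable (PiM P N)" if ij: "i < n" "j < n" for i j
  proof -
    have "cnj \<in> borel_measurable borel"
      by (intro borel_measurable_continuous_onI continuous_intros)
    then have "(\<lambda>x. cnj (complex_of_real (1 / sqrt n) * trunc K (x (block_of P (j,i)) (j,i)))) \<in> borel_measurable (PiM P N)"
      by (rule measurable_compose[rotated]) (intro borel_measurable_times borel_measurable_const ent, use ij in auto)
    then show ?thesis
      unfolding T_def herm_part_index[OF ij] using ij
      by (intro borel_measurable_divide borel_measurable_add borel_measurable_times borel_measurable_const ent) auto
  qed
  have Rm: "(\<lambda>x. resolvent (T x) z $$ (i,j)) \<in> borel_measurable (PiM P N)" if ij: "i < n" "j < n" for i j
    by (rule borel_measurable_hermitian_functional[OF T Tm resolvent_continuous[OF _ _ z _ ij]])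
  have Rc: "resolvent (T x) z \<in> carrier_mat n n" for x by (rule resolvent_hermitian[OF T z])
  then have Sc: "S x \<in> carrier_mat n n" for x unfolding S_def by (rule mult_carrier_mat) (rule Rc)
  have Sm: "(\<lambda>x. S x $$ p) \<in> borel_measurable (PiM P N)" if pQ: "p \<in> ?Q" for p
  proof -
    obtain i j where p: "p = (i,j)" "i < n" "j < n" using pQ by auto
    show ?thesis unfolding S_def p(1) mult_mat_index[OF Rc Rc p(2,3)]
      using Rm p by (intro borel_measurable_sum borel_measurable_times) auto
  qed
  have "(\<lambda>x. mtrace (resolvent (T x) z) / of_nat n) \<in> borel_measurable (PiM P N)"
    unfolding mtrace_def using Rm Rc by (intro borel_measurable_divide borel_measurable_sum) (auto simp: carrier_matD(1)[OF Rc])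
  from measurable_compose[OF this h(1)] show fm: "f \<in> borel_measurable (PiM P N)" unfolding f_def .
  have fb: "\<bar>f x\<bar> \<le> 1 / \<bar>Im z\<bar>" for x
  proof -
    have "\<bar>f x\<bar> \<le> cmod (mtrace (resolvent (T x) z) / of_nat n)"
      unfolding f_def using h(2)[of "mtrace (resolvent (T x) z) / of_nat n" 0] h(3) by simp
    also have "\<dots> \<le> 1 / \<bar>Im z\<bar>"
      using norm_mtrace_resolvent_le[OF T z, of x] n by (simp add: norm_divide divide_le_eq)
    finally show ?thesis .
  qed
  have \<sigma>0: "0 \<le> \<sigma> B x" for B x by (simp add: \<sigma>_def sum_nonneg)
  have sumS: "(\<Sum>B\<in>P. \<sigma> B x) \<le> n / \<bar>Im z\<bar> ^ 4" for x
    unfolding \<sigma>_def sum_frob_sq_blocks[OF P Sc]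
    using frob_sq_resolvent_le(2)[OF T z, of x] by (simp add: S_def)
  have \<sigma>1: "\<sigma> B x \<le> n / \<bar>Im z\<bar> ^ 4" if "B \<in> P" for B x
    using member_le_sum[OF that, of "\<lambda>B. \<sigma> B x"] finP \<sigma>0 sumS[of x] by auto
  define c where "c = 2 / (real n)\<^sup>2 * (l\<^sup>2 * d * (n / \<bar>Im z\<bar> ^ 4) + (l\<^sup>2 * d) * (l\<^sup>2 * d) / \<bar>Im z\<bar> ^ 6)"
  have Gb: "\<bar>G B x\<bar> \<le> c" if B: "B \<in> P" for B x
  proof -
    have "0 \<le> G B x" using \<sigma>0[of B x] by (simp add: G_def)
    moreover have "G B x \<le> c"
      unfolding G_def c_def using \<sigma>1[OF B, of x] card[OF B]
      by (intro mult_left_mono add_mono divide_right_mono) auto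
    ultimately show ?thesis by simp
  qed
  have Gm: "G B \<in> borel_measurable (PiM P N)" if B: "B \<in> P" for B
  proof -
    have "(\<lambda>x. cmod (S x $$ p)) \<in> borel_measurable (PiM P N)" if "p \<in> ?Q" for p
      by (rule measurable_compose[OF Sm[OF that] borel_measurable_norm])
    then have "\<sigma> B \<in> borel_measurable (PiM P N)"
      unfolding \<sigma>_def using BQ[OF B]
      by (intro borel_measurable_sum borel_measurable_divide borel_measurable_add borel_measurable_power) auto
    then show ?thesis unfolding G_def by measurable
  qed
  have osc: "(f x - f (x(B := v)))\<^sup>2 \<le> G B x" if B: "B \<in> P" for B x v
  proof -
    let ?w = "mtrace (resolvent (T x) z)" and ?w' = "mtrace (resolvent (T (x(B := v))) z)"
    have "\<bar>f x - f (x(B := v))\<bar> \<le> cmod (?w / of_nat n - ?w' / of_nat n)"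
      unfolding f_def by (rule h(2))
    also have "\<dots> = cmod (?w' - ?w) / n"
      by (simp add: norm_divide norm_minus_commute flip: diff_divide_distrib)
    finally have "(f x - f (x(B := v)))\<^sup>2 \<le> (cmod (?w' - ?w) / n)\<^sup>2"
      by (rule power2_le_if_abs_le)
    also have "\<dots> = (cmod (?w' - ?w))\<^sup>2 / (real n)\<^sup>2" by (simp add: power_divide)
    also have "(cmod (?w' - ?w))\<^sup>2 \<le> 2 * (l\<^sup>2 * card B * \<sigma> B x + (l\<^sup>2 * card B)\<^sup>2 / \<bar>Im z\<bar> ^ 6)"
      unfolding \<sigma>_def S_def T_def
    proof (rule resolvent_block_perturbation[OF BQ[OF B] _ _ z])
      fix p assume p: "p \<in> ?Q" "p \<notin> B"
      then have "block_of P p \<noteq> B" using block_of_mem[OF P p(1)] by auto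
      then show "complex_of_real (1 / sqrt n) * trunc K (x (block_of P p) p) =
          complex_of_real (1 / sqrt n) * trunc K ((x(B := v)) (block_of P p) p)" by simp
    next
      fix p assume "p \<in> B"
      have "cmod (trunc K a - trunc K b) \<le> 2 * K" for a b
        using norm_triangle_ineq4[of "trunc K a" "trunc K b"] norm_trunc_le[OF K, of a] norm_trunc_le[OF K, of b] by linarith
      then have "cmod (complex_of_real (1 / sqrt n)) * cmod (trunc K a - trunc K b) \<le> l" for a b
        using n unfolding l_def by (simp add: norm_divide divide_right_mono)
      then show "cmod (complex_of_real (1 / sqrt n) * trunc K ((x(B := v)) (block_of P p) p) -
          complex_of_real (1 / sqrt n) * trunc K (x (block_of P p) p)) \<le> l"
        by (simp only: norm_mult right_diff_distrib[symmetric])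
    qed
    also have "2 * (l\<^sup>2 * card B * \<sigma> B x + (l\<^sup>2 * card B)\<^sup>2 / \<bar>Im z\<bar> ^ 6) / (real n)\<^sup>2 \<le> G B x"
    proof -
      have "l\<^sup>2 * card B * \<sigma> B x + (l\<^sup>2 * card B)\<^sup>2 / \<bar>Im z\<bar> ^ 6 \<le>
          l\<^sup>2 * d * \<sigma> B x + (l\<^sup>2 * d) * (l\<^sup>2 * card B) / \<bar>Im z\<bar> ^ 6"
        using card[OF B] \<sigma>0[of B x] unfolding power2_eq_square[of "l\<^sup>2 * card B"]
        by (intro add_mono divide_right_mono mult_mono mult_right_mono) auto
      then show ?thesis unfolding G_def by (simp add: divide_right_mono)
    qed
    finally show ?thesis by (simp add: divide_right_mono)
  qed
  interpret PP: prob_space "PiM P N" by (intro prob_space_PiM N)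
  have "(\<integral>x. (f x)\<^sup>2 \<partial>PiM P N) - (\<integral>x. f x \<partial>PiM P N)\<^sup>2 \<le> (\<Sum>B\<in>P. \<integral>x. G B x \<partial>PiM P N)"
    by (rule efron_stein[where b="1 / \<bar>Im z\<bar>" and c=c]) (rule N(1) finP fm fb Gm Gb osc; assumption)+
  also have "\<dots> = (\<integral>x. (\<Sum>B\<in>P. G B x) \<partial>PiM P N)"
    using Gm Gb by (intro Bochner_Integration.integral_sum[symmetric] PP.integrable_bounded[where b=c]) auto
  also have "\<dots> \<le> (\<integral>x. var_const K z * (real d / (real n)\<^sup>2) \<partial>PiM P N)"
  proof (rule integral_mono)
    show "integrable (PiM P N) (\<lambda>x. \<Sum>B\<in>P. G B x)"
      using Gm Gb by (intro Bochner_Integration.integrable_sum PP.integrable_bounded[where b=c]) auto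
    fix x
    have cardP: "(\<Sum>B\<in>P. real (card B)) = (real n)\<^sup>2"
    proof -
      have "(\<Sum>B\<in>P. real (card B)) = (\<Sum>B\<in>P. \<Sum>p\<in>B. 1)" by simp
      also have "\<dots> = (\<Sum>p\<in>?Q. 1)" by (rule sum_partition[OF P]) simp
      finally show ?thesis by (simp add: power2_eq_square)
    qed
    have "(\<Sum>B\<in>P. G B x) = 2 / (real n)\<^sup>2 * (l\<^sup>2 * d * (\<Sum>B\<in>P. \<sigma> B x) + (l\<^sup>2 * d) * (l\<^sup>2 * (\<Sum>B\<in>P. real (card B))) / \<bar>Im z\<bar> ^ 6)"
      unfolding G_def by (simp only: sum.distrib flip: sum_distrib_left sum_divide_distrib)
    also have "\<dots> \<le> 2 / (real n)\<^sup>2 * (l\<^sup>2 * d * (n / \<bar>Im z\<bar> ^ 4) + (l\<^sup>2 * d) * (l\<^sup>2 * (real n)\<^sup>2) / \<bar>Im z\<bar> ^ 6)"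
      unfolding cardP using sumS[of x] by (intro mult_left_mono add_mono) auto
    also have "\<dots> = var_const K z * (real d / (real n)\<^sup>2)"
      unfolding l2 var_const_def using n z by (simp add: field_simps power2_eq_square power4_eq_xxxx)
    finally show "(\<Sum>B\<in>P. G B x) \<le> var_const K z * (real d / (real n)\<^sup>2)" .
  qed simp
  finally show "(\<integral>x. (f x)\<^sup>2 \<partial>PiM P N) - (\<integral>x. f x \<partial>PiM P N)\<^sup>2 \<le> var_const K z * (real d / (real n)\<^sup>2)"
    by (simp add: PP.prob_space)
qed

definition trunc_mat :: "real \<Rightarrow> complex mat \<Rightarrow> complex mat" where
  "trunc_mat K A = map_mat (trunc K) A"

lemma hermitian_trunc_mat:
  assumes "hermitian_mat n A"
  shows "hermitian_mat n (trunc_mat K A)"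
  unfolding hermitian_mat_def
proof (intro conjI allI impI)
  show "trunc_mat K A \<in> carrier_mat n n" using hermitian_matD(1)[OF assms] by (simp add: trunc_mat_def)
  fix i j assume ij: "i < n" "j < n"
  have "trunc K (cnj w) = cnj (trunc K w)" for w by (simp add: trunc_def)
  then show "trunc_mat K A $$ (i,j) = cnj (trunc_mat K A $$ (j,i))"
    using ij hermitian_matD[OF assms] hermitian_mat_cnj[OF assms ij] by (simp add: trunc_mat_def)
qed

lemma hermitian_smult_real:
  assumes "hermitian_mat n A"
  shows "hermitian_mat n (complex_of_real c \<cdot>\<^sub>m A)"
  unfolding hermitian_mat_def
proof (intro conjI allI impI)
  show "complex_of_real c \<cdot>\<^sub>m A \<in> carrier_mat n n" using hermitian_matD(1)[OF assms] by simp
  fix i j assume ij: "i < n" "j < n"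
  then show "(complex_of_real c \<cdot>\<^sub>m A) $$ (i,j) = cnj ((complex_of_real c \<cdot>\<^sub>m A) $$ (j,i))"
    using hermitian_matD[OF assms] hermitian_mat_cnj[OF assms ij] by simp
qed

text \<open>The passage from variance to an L1 deviation is made here because truncation errors are
  later added in L1.\<close>

lemma (in prob_space) L1_deviation_le:
  fixes g :: "'a \<Rightarrow> real"
  assumes g: "g \<in> borel_measurable M" "\<And>x. x \<in> space M \<Longrightarrow> \<bar>g x\<bar> \<le> b"
  shows "(\<integral>x. \<bar>g x - (\<integral>x. g x \<partial>M)\<bar> \<partial>M) \<le> sqrt ((\<integral>x. (g x)\<^sup>2 \<partial>M) - (\<integral>x. g x \<partial>M)\<^sup>2)"
proof -
  have i1: "integrable M g" using g by (intro integrable_bounded[where b=b]) auto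
  have i2: "integrable M (\<lambda>x. (g x)\<^sup>2)"
    using g by (intro integrable_bounded[where b="b\<^sup>2"]) (auto intro: power2_le_if_abs_le)
  have "(\<integral>x. \<bar>g x - (\<integral>x. g x \<partial>M)\<bar> \<partial>M)\<^sup>2 \<le> (\<integral>x. \<bar>g x - (\<integral>x. g x \<partial>M)\<bar>\<^sup>2 \<partial>M)"
  proof (rule square_integral_le)
    fix x assume "x \<in> space M"
    then show "\<bar>\<bar>g x - (\<integral>x. g x \<partial>M)\<bar>\<bar> \<le> b + \<bar>\<integral>x. g x \<partial>M\<bar>" using g(2)[of x] by simp
  qed (use g in measurable)
  also have "\<dots> = variance g" by simp
  also have "\<dots> = (\<integral>x. (g x)\<^sup>2 \<partial>M) - (\<integral>x. g x \<partial>M)\<^sup>2" by (rule variance_eq[OF i1 i2])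
  finally show ?thesis by (rule real_le_rsqrt)
qed

section \<open>One matrix with independent blocks, and its truncation\<close>

locale block_matrix = prob_space M for M :: "'a measure" +
  fixes n d :: nat and X :: "'a \<Rightarrow> complex mat"
  assumes herm: "\<And>\<omega>. \<omega> \<in> space M \<Longrightarrow> hermitian_mat n (X \<omega>)"
    and meas: "\<And>i j. i < n \<Longrightarrow> j < n \<Longrightarrow> (\<lambda>\<omega>. X \<omega> $$ (i,j)) \<in> borel_measurable M"
    and S: "satisfies_S M n n X d"
    and n_pos: "0 < n"
begin

definition Y :: "'a \<Rightarrow> complex mat" where
  "Y \<omega> = complex_of_real (1 / sqrt n) \<cdot>\<^sub>m X \<omega>"

definition YK :: "real \<Rightarrow> 'a \<Rightarrow> complex mat" where
  "YK K \<omega> = complex_of_real (1 / sqrt n) \<cdot>\<^sub>m trunc_mat K (X \<omega>)"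

text \<open>The random variable of property L. By \<open>frob_sq_truncation\<close> it is the
  squared Frobenius norm of Y - YK divided by n.\<close>

definition excess :: "real \<Rightarrow> 'a \<Rightarrow> real" where
  "excess K \<omega> = (\<Sum>i<n. \<Sum>j<n. (cmod (X \<omega> $$ (i,j)))\<^sup>2 * indicator {K<..} (cmod (X \<omega> $$ (i,j)))) / (real n)\<^sup>2"

lemma hermitian_Y: "\<omega> \<in> space M \<Longrightarrow> hermitian_mat n (Y \<omega>)"
  unfolding Y_def by (intro hermitian_smult_real herm)

lemma hermitian_YK: "\<omega> \<in> space M \<Longrightarrow> hermitian_mat n (YK K \<omega>)"
  unfolding YK_def by (intro hermitian_smult_real hermitian_trunc_mat herm)

lemma YK_index:
  "\<omega> \<in> space M \<Longrightarrow> i < n \<Longrightarrow> j < n \<Longrightarrow> YK K \<omega> $$ (i,j) = complex_of_real (1 / sqrt n) * trunc K (X \<omega> $$ (i,j))"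
  using hermitian_matD[OF herm] by (simp add: YK_def trunc_mat_def)

lemma Y_index:
  "\<omega> \<in> space M \<Longrightarrow> i < n \<Longrightarrow> j < n \<Longrightarrow> Y \<omega> $$ (i,j) = complex_of_real (1 / sqrt n) * X \<omega> $$ (i,j)"
  using hermitian_matD[OF herm] by (simp add: Y_def)

sublocale Y: random_hermitian M n Y
proof
  fix i j assume ij: "i < n" "j < n"
  have "(\<lambda>\<omega>. complex_of_real (1 / sqrt n) * X \<omega> $$ (i,j)) \<in> borel_measurable M"
    using meas[OF ij] by measurable
  then show "(\<lambda>\<omega>. Y \<omega> $$ (i,j)) \<in> borel_measurable M"
    using Y_index[OF _ ij] by (simp cong: measurable_cong)
qed (use hermitian_Y n_pos in auto)

lemmas random_hermitian_Y = Y.random_hermitian_axioms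

lemma random_hermitian_YK: "random_hermitian M n (YK K)"
proof
  fix i j assume ij: "i < n" "j < n"
  have "(\<lambda>\<omega>. complex_of_real (1 / sqrt n) * trunc K (X \<omega> $$ (i,j))) \<in> borel_measurable M"
    using measurable_compose[OF meas[OF ij] measurable_trunc] by measurable
  then show "(\<lambda>\<omega>. YK K \<omega> $$ (i,j)) \<in> borel_measurable M"
    using YK_index[OF _ ij] by (simp cong: measurable_cong)
qed (use hermitian_YK n_pos in auto)

text \<open>Independence says that the family of blocks has the product of the block laws as its
  distribution, so the product estimate transfers to \<open>M\<close>.\<close>

lemma variance_truncated_le:
  fixes h :: "complex \<Rightarrow> real"
  assumes z: "Im z \<noteq> 0" and K: "0 \<le> K"
    and h: "h \<in> borel_measurable borel" "\<And>v w. \<bar>h v - h w\<bar> \<le> cmod (v - w)" "h 0 = 0"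
  shows "(\<integral>\<omega>. (h (stieltjes (esd (YK K \<omega>)) z))\<^sup>2 \<partial>M) - (\<integral>\<omega>. h (stieltjes (esd (YK K \<omega>)) z) \<partial>M)\<^sup>2
    \<le> var_const K z * (real d / (real n)\<^sup>2)"
proof -
  let ?Q = "{..<n} \<times> {..<n}"
  obtain P where P: "partition_on ?Q P" and card: "\<And>B. B \<in> P \<Longrightarrow> card B \<le> d"
    and ind: "indep_vars (\<lambda>B. PiM B (\<lambda>_. borel)) (\<lambda>B \<omega>. restrict (\<lambda>p. X \<omega> $$ p) B) P"
    using S unfolding satisfies_S_def by auto
  \<comment> \<open>The value 0 off \<open>P\<close> makes \<open>Z B\<close> measurable, and hence
    \<open>N B\<close> a probability measure, for every index and not just for blocks.\<close>
  define Z where "Z B \<omega> = restrict (\<lambda>p. if B \<in> P then X \<omega> $$ p else 0) B" for B \<omega>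
  define N where "N B = distr M (PiM B (\<lambda>_. borel)) (Z B)" for B
  define T where "T x = herm_part n (\<lambda>p. complex_of_real (1 / sqrt n) * trunc K (x (block_of P p) p))" for x
  define f where "f x = h (mtrace (resolvent (T x) z) / of_nat n)" for x
  have Pne: "P \<noteq> {}"
    using partition_onD1[OF P] n_pos by auto
  have Zm: "Z B \<in> M \<rightarrow>\<^sub>M PiM B (\<lambda>_. borel)" for B
    unfolding Z_def
  proof (rule measurable_restrict)
    fix p assume p: "p \<in> B"
    show "(\<lambda>\<omega>. if B \<in> P then X \<omega> $$ p else 0) \<in> borel_measurable M"
    proof (cases "B \<in> P")
      case True
      then have "p \<in> ?Q" using p partition_onD1[OF P] by auto
      then show ?thesis using True meas[of "fst p" "snd p"] by auto
    qed simp
  qed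
  have N: "prob_space (N B)" "sets (N B) = sets (PiM B (\<lambda>_. borel))" for B
    unfolding N_def using prob_space_distr[OF Zm] by simp_all
  have "indep_vars (\<lambda>B. PiM B (\<lambda>_. borel)) Z P \<longleftrightarrow>
      indep_vars (\<lambda>B. PiM B (\<lambda>_. borel)) (\<lambda>B \<omega>. restrict (\<lambda>p. X \<omega> $$ p) B) P"
    by (intro indep_vars_cong) (auto simp: Z_def)
  with ind have "indep_vars (\<lambda>B. PiM B (\<lambda>_. borel)) Z P" by simp
  then have distr: "distr M (PiM P (\<lambda>B. PiM B (\<lambda>_. borel))) (\<lambda>\<omega>. \<lambda>B\<in>P. Z B \<omega>) = PiM P N"
    unfolding N_def using indep_vars_iff_distr_eq_PiM[OF Pne Zm] by simp
  note PV = product_variance_le[OF P card N z K n_pos h, folded T_def f_def]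
  have sPN: "sets (PiM P N) = sets (PiM P (\<lambda>B. PiM B (\<lambda>_. borel)))"
    by (intro sets_PiM_cong refl N)
  have fm: "f \<in> borel_measurable (PiM P (\<lambda>B. PiM B (\<lambda>_. borel)))"
    using PV(1) by (simp cong: measurable_cong_sets add: sPN)
  have Zm': "(\<lambda>\<omega>. \<lambda>B\<in>P. Z B \<omega>) \<in> M \<rightarrow>\<^sub>M PiM P (\<lambda>B. PiM B (\<lambda>_. borel))"
    by (intro measurable_restrict Zm)
  \<comment> \<open>At points coming from actual samples the reassembled matrix is already
    Hermitian, so symmetrisation changes nothing.\<close>
  have val: "f (\<lambda>B\<in>P. Z B \<omega>) = h (stieltjes (esd (YK K \<omega>)) z)" if \<omega>: "\<omega> \<in> space M" for \<omega>
  proof -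
    have "T (\<lambda>B\<in>P. Z B \<omega>) = YK K \<omega>"
      unfolding T_def
    proof (rule herm_part_eq[OF hermitian_YK[OF \<omega>]])
      fix i j assume ij: "i < n" "j < n"
      then have "block_of P (i,j) \<in> P" "(i,j) \<in> block_of P (i,j)" using block_of_mem[OF P, of "(i,j)"] by auto
      then show "complex_of_real (1 / sqrt n) * trunc K ((\<lambda>B\<in>P. Z B \<omega>) (block_of P (i,j)) (i,j)) = YK K \<omega> $$ (i,j)"
        using YK_index[OF \<omega> ij] by (simp add: Z_def)
    qed
    then show ?thesis
      unfolding f_def by (simp add: stieltjes_esd[OF hermitian_YK[OF \<omega>] n_pos z])
  qed
  have tr: "(\<integral>x. \<phi> (f x) \<partial>PiM P N) = (\<integral>\<omega>. \<phi> (h (stieltjes (esd (YK K \<omega>)) z)) \<partial>M)"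
    if "\<phi> \<in> borel_measurable borel" for \<phi> :: "real \<Rightarrow> real"
  proof -
    have "(\<integral>x. \<phi> (f x) \<partial>PiM P N) = (\<integral>\<omega>. \<phi> (f (\<lambda>B\<in>P. Z B \<omega>)) \<partial>M)"
      unfolding distr[symmetric] by (rule integral_distr[OF Zm' measurable_compose[OF fm that]])
    then show ?thesis by (simp add: val cong: Bochner_Integration.integral_cong)
  qed
  show ?thesis
    using PV(2) tr[of "\<lambda>x. x\<^sup>2"] tr[of "\<lambda>x. x"] by simp
qed

lemma norm_stieltjes_esd_le:
  "\<omega> \<in> space M \<Longrightarrow> Im z \<noteq> 0 \<Longrightarrow> cmod (stieltjes (esd (Y \<omega>)) z) \<le> 1 / \<bar>Im z\<bar>"
  "\<omega> \<in> space M \<Longrightarrow> Im z \<noteq> 0 \<Longrightarrow> cmod (stieltjes (esd (YK K \<omega>)) z) \<le> 1 / \<bar>Im z\<bar>"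
  using real_distribution.norm_stieltjes_le Y.real_distribution_Y
    random_hermitian.real_distribution_Y[OF random_hermitian_YK] by blast+

text \<open>Real and imaginary part are 1-Lipschitz and vanish at 0; each contributes one square
  root.\<close>

lemma L1_truncated_le:
  assumes z: "Im z \<noteq> 0" and K: "0 \<le> K"
  defines "s \<equiv> (\<lambda>\<omega>. stieltjes (esd (YK K \<omega>)) z)"
  shows "(\<integral>\<omega>. cmod (s \<omega> - (\<integral>\<omega>. s \<omega> \<partial>M)) \<partial>M) \<le> 2 * sqrt (var_const K z * (real d / (real n)\<^sup>2))"
proof -
  have m[measurable]: "s \<in> borel_measurable M"
    unfolding s_def by (rule random_hermitian.measurable_stieltjes_esd[OF random_hermitian_YK z])
  have b: "cmod (s \<omega>) \<le> 1 / \<bar>Im z\<bar>" if "\<omega> \<in> space M" for \<omega>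
    unfolding s_def by (rule norm_stieltjes_esd_le(2)[OF that z])
  have i: "integrable M s" using m b by (rule integrable_bounded)
  have bR: "\<bar>Re (s \<omega>)\<bar> \<le> 1 / \<bar>Im z\<bar>" and bI: "\<bar>Im (s \<omega>)\<bar> \<le> 1 / \<bar>Im z\<bar>" if "\<omega> \<in> space M" for \<omega>
    using b[OF that] abs_Re_le_cmod[of "s \<omega>"] abs_Im_le_cmod[of "s \<omega>"] by linarith+
  have R: "(\<integral>\<omega>. \<bar>Re (s \<omega>) - (\<integral>\<omega>. Re (s \<omega>) \<partial>M)\<bar> \<partial>M) \<le> sqrt (var_const K z * (real d / (real n)\<^sup>2))"
  proof (rule order_trans[OF L1_deviation_le[OF _ bR] real_sqrt_le_mono])
    show "(\<integral>\<omega>. (Re (s \<omega>))\<^sup>2 \<partial>M) - (\<integral>\<omega>. Re (s \<omega>) \<partial>M)\<^sup>2 \<le> var_const K z * (real d / (real n)\<^sup>2)"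
      unfolding s_def by (rule variance_truncated_le[OF z K]) (auto intro: abs_Re_le_cmod simp flip: minus_complex.sel)
  qed auto
  have I: "(\<integral>\<omega>. \<bar>Im (s \<omega>) - (\<integral>\<omega>. Im (s \<omega>) \<partial>M)\<bar> \<partial>M) \<le> sqrt (var_const K z * (real d / (real n)\<^sup>2))"
  proof (rule order_trans[OF L1_deviation_le[OF _ bI] real_sqrt_le_mono])
    show "(\<integral>\<omega>. (Im (s \<omega>))\<^sup>2 \<partial>M) - (\<integral>\<omega>. Im (s \<omega>) \<partial>M)\<^sup>2 \<le> var_const K z * (real d / (real n)\<^sup>2)"
      unfolding s_def by (rule variance_truncated_le[OF z K]) (auto intro: abs_Im_le_cmod simp flip: minus_complex.sel)
  qed auto
  have iR: "integrable M (\<lambda>\<omega>. \<bar>Re (s \<omega>) - (\<integral>\<omega>. Re (s \<omega>) \<partial>M)\<bar>)" and iI: "integrable M (\<lambda>\<omega>. \<bar>Im (s \<omega>) - (\<integral>\<omega>. Im (s \<omega>) \<partial>M)\<bar>)"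
    using i by (intro integrable_abs Bochner_Integration.integrable_diff; simp)+
  have "(\<integral>\<omega>. cmod (s \<omega> - (\<integral>\<omega>. s \<omega> \<partial>M)) \<partial>M) \<le>
      (\<integral>\<omega>. \<bar>Re (s \<omega>) - (\<integral>\<omega>. Re (s \<omega>) \<partial>M)\<bar> + \<bar>Im (s \<omega>) - (\<integral>\<omega>. Im (s \<omega>) \<partial>M)\<bar> \<partial>M)"
  proof (rule integral_mono)
    show "integrable M (\<lambda>\<omega>. cmod (s \<omega> - (\<integral>\<omega>. s \<omega> \<partial>M)))"
      using i by (intro integrable_norm Bochner_Integration.integrable_diff) simp_all
    fix \<omega>
    show "cmod (s \<omega> - (\<integral>\<omega>. s \<omega> \<partial>M)) \<le> \<bar>Re (s \<omega>) - (\<integral>\<omega>. Re (s \<omega>) \<partial>M)\<bar> + \<bar>Im (s \<omega>) - (\<integral>\<omega>. Im (s \<omega>) \<partial>M)\<bar>"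
      using cmod_le[of "s \<omega> - (\<integral>\<omega>. s \<omega> \<partial>M)"] i by simp
  qed (intro Bochner_Integration.integrable_add iR iI)
  also have "\<dots> = (\<integral>\<omega>. \<bar>Re (s \<omega>) - (\<integral>\<omega>. Re (s \<omega>) \<partial>M)\<bar> \<partial>M) + (\<integral>\<omega>. \<bar>Im (s \<omega>) - (\<integral>\<omega>. Im (s \<omega>) \<partial>M)\<bar> \<partial>M)"
    by (rule Bochner_Integration.integral_add[OF iR iI])
  finally show ?thesis using R I by linarith
qed

lemma excess_measurable [measurable]: "excess K \<in> borel_measurable M"
  unfolding excess_def
proof (intro borel_measurable_divide borel_measurable_sum borel_measurable_times borel_measurable_power borel_measurable_const)
  fix i j assume ij: "i \<in> {..<n}" "j \<in> {..<n}"
  then show m: "(\<lambda>\<omega>. cmod (X \<omega> $$ (i,j))) \<in> borel_measurable M" using meas[of i j] by auto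
  show "(\<lambda>\<omega>. indicator {K<..} (cmod (X \<omega> $$ (i,j))) :: real) \<in> borel_measurable M"
    by (rule measurable_compose[OF m]) simp
qed

lemma frob_sq_truncation:
  assumes "\<omega> \<in> space M"
  shows "frob_sq (Y \<omega> - YK K \<omega>) = n * excess K \<omega>"
proof -
  note XD = hermitian_matD[OF herm[OF assms]]
  have c: "Y \<omega> - YK K \<omega> \<in> carrier_mat n n"
    using hermitian_matD(1)[OF hermitian_Y[OF assms]] hermitian_matD(1)[OF hermitian_YK[OF assms, of K]] by auto
  have "frob_sq (Y \<omega> - YK K \<omega>) = (\<Sum>i<n. \<Sum>j<n. (cmod ((Y \<omega> - YK K \<omega>) $$ (i,j)))\<^sup>2)"
    unfolding frob_sq_carrier[OF c] by (simp add: sum.cartesian_product case_prod_beta)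
  also have "\<dots> = (\<Sum>i<n. \<Sum>j<n. ((cmod (X \<omega> $$ (i,j)))\<^sup>2 * indicator {K<..} (cmod (X \<omega> $$ (i,j)))) / n)"
  proof (intro sum.cong refl)
    fix i j assume "i \<in> {..<n}" "j \<in> {..<n}"
    then have ij: "i < n" "j < n" by auto
    have "(Y \<omega> - YK K \<omega>) $$ (i,j) = Y \<omega> $$ (i,j) - YK K \<omega> $$ (i,j)"
      using ij hermitian_matD[OF hermitian_YK[OF assms, of K]] by simp
    also have "\<dots> = complex_of_real (1 / sqrt n) * (X \<omega> $$ (i,j) - trunc K (X \<omega> $$ (i,j)))"
      unfolding Y_index[OF assms ij] YK_index[OF assms ij] by (simp add: right_diff_distrib)
    finally have "(cmod ((Y \<omega> - YK K \<omega>) $$ (i,j)))\<^sup>2 = (cmod (complex_of_real (1 / sqrt n)))\<^sup>2 * (cmod (X \<omega> $$ (i,j) - trunc K (X \<omega> $$ (i,j))))\<^sup>2"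
      by (simp only: norm_mult power_mult_distrib)
    also have "(cmod (complex_of_real (1 / sqrt n)))\<^sup>2 = 1 / n"
      by (simp add: norm_divide power_divide)
    also have "(cmod (X \<omega> $$ (i,j) - trunc K (X \<omega> $$ (i,j))))\<^sup>2 = (cmod (X \<omega> $$ (i,j)))\<^sup>2 * indicator {K<..} (cmod (X \<omega> $$ (i,j)))"
      by (simp add: trunc_def indicator_def)
    finally show "(cmod ((Y \<omega> - YK K \<omega>) $$ (i,j)))\<^sup>2 = ((cmod (X \<omega> $$ (i,j)))\<^sup>2 * indicator {K<..} (cmod (X \<omega> $$ (i,j)))) / n"
      by simp
  qed
  also have "\<dots> = n * excess K \<omega>"
    using n_pos by (simp add: excess_def power2_eq_square flip: sum_divide_distrib)
  finally show ?thesis .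
qed

lemma frob_sq_Y_le:
  assumes "\<omega> \<in> space M" and K: "0 \<le> K"
  shows "frob_sq (Y \<omega>) \<le> n * (K\<^sup>2 + excess K \<omega>)"
proof -
  have c: "Y \<omega> \<in> carrier_mat n n" using hermitian_matD(1)[OF hermitian_Y[OF assms(1)]] .
  have "frob_sq (Y \<omega>) = (\<Sum>i<n. \<Sum>j<n. (cmod (Y \<omega> $$ (i,j)))\<^sup>2)"
    unfolding frob_sq_carrier[OF c] by (simp add: sum.cartesian_product case_prod_beta)
  also have "\<dots> \<le> (\<Sum>i<n. \<Sum>j<n. (K\<^sup>2 + (cmod (X \<omega> $$ (i,j)))\<^sup>2 * indicator {K<..} (cmod (X \<omega> $$ (i,j)))) / n)"
  proof (intro sum_mono)
    fix i j assume "i \<in> {..<n}" "j \<in> {..<n}"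
    then have ij: "i < n" "j < n" by auto
    have "(cmod (Y \<omega> $$ (i,j)))\<^sup>2 = (cmod (X \<omega> $$ (i,j)))\<^sup>2 / n"
      unfolding Y_index[OF assms(1) ij] by (simp add: norm_mult norm_divide power_divide power_mult_distrib)
    also have "(cmod (X \<omega> $$ (i,j)))\<^sup>2 \<le> K\<^sup>2 + (cmod (X \<omega> $$ (i,j)))\<^sup>2 * indicator {K<..} (cmod (X \<omega> $$ (i,j)))"
      using K by (auto simp: indicator_def intro!: power_mono)
    finally show "(cmod (Y \<omega> $$ (i,j)))\<^sup>2 \<le> (K\<^sup>2 + (cmod (X \<omega> $$ (i,j)))\<^sup>2 * indicator {K<..} (cmod (X \<omega> $$ (i,j)))) / n"
      by (simp add: divide_right_mono)
  qed
  also have "\<dots> = n * (K\<^sup>2 + excess K \<omega>)"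
    using n_pos by (simp add: excess_def power2_eq_square sum.distrib field_simps flip: sum_divide_distrib)
  finally show ?thesis .
qed

text \<open>Here the first-order trace bound suffices: the difference has squared Frobenius norm n
  times the excess, so the dimension cancels after normalisation.\<close>

lemma stieltjes_truncation_le:
  assumes \<omega>: "\<omega> \<in> space M" and z: "Im z \<noteq> 0"
  shows "cmod (stieltjes (esd (Y \<omega>)) z - stieltjes (esd (YK K \<omega>)) z) \<le> sqrt (excess K \<omega>) / (Im z)\<^sup>2"
proof -
  have "cmod (stieltjes (esd (Y \<omega>)) z - stieltjes (esd (YK K \<omega>)) z) =
      cmod (mtrace (resolvent (Y \<omega>) z) - mtrace (resolvent (YK K \<omega>) z)) / n"
    unfolding stieltjes_esd[OF hermitian_Y[OF \<omega>] n_pos z] stieltjes_esd[OF hermitian_YK[OF \<omega>] n_pos z]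
    by (simp add: norm_divide flip: diff_divide_distrib)
  also have "\<dots> \<le> sqrt (real n * frob_sq (Y \<omega> - YK K \<omega>)) / (Im z)\<^sup>2 / n"
    by (intro divide_right_mono mtrace_resolvent_diff_le hermitian_Y hermitian_YK \<omega> z) simp
  also have "\<dots> = sqrt (excess K \<omega>) / (Im z)\<^sup>2"
  proof -
    have "real n * frob_sq (Y \<omega> - YK K \<omega>) = (real n)\<^sup>2 * excess K \<omega>"
      unfolding frob_sq_truncation[OF \<omega>] by (simp add: power2_eq_square)
    then have "sqrt (real n * frob_sq (Y \<omega> - YK K \<omega>)) = real n * sqrt (excess K \<omega>)"
      by (simp only: real_sqrt_mult real_sqrt_abs abs_of_nat)
    then show ?thesis using n_pos by simp
  qed
  finally show ?thesis .
qed

text \<open>The truncated transform concentrates by Efron--Stein; truncation changes it by at most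
  \<open>\<surd>\<epsilon> / (Im z)\<^sup>2\<close> outside the event whose probability property \<open>\<L>\<close> controls.\<close>
lemma L1_stieltjes_le:
  assumes z: "Im z \<noteq> 0" and K: "0 \<le> K" and \<epsilon>: "0 < \<epsilon>"
  defines "s \<equiv> (\<lambda>\<omega>. stieltjes (esd (Y \<omega>)) z)"
  shows "(\<integral>\<omega>. cmod (s \<omega> - (\<integral>\<omega>. s \<omega> \<partial>M)) \<partial>M) \<le>
    2 * (sqrt \<epsilon> / (Im z)\<^sup>2 + 2 / \<bar>Im z\<bar> * prob {\<omega> \<in> space M. excess K \<omega> > \<epsilon>})
    + 2 * sqrt (var_const K z * (real d / (real n)\<^sup>2))"
proof -
  define t where "t \<omega> = stieltjes (esd (YK K \<omega>)) z" for \<omega>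
  have m[measurable]: "s \<in> borel_measurable M" "t \<in> borel_measurable M"
    unfolding s_def t_def by (rule Y.measurable_stieltjes_esd[OF z],
        rule random_hermitian.measurable_stieltjes_esd[OF random_hermitian_YK z])
  have sb: "cmod (s \<omega>) \<le> 1 / \<bar>Im z\<bar>" and tb: "cmod (t \<omega>) \<le> 1 / \<bar>Im z\<bar>" if "\<omega> \<in> space M" for \<omega>
    unfolding s_def t_def by (rule norm_stieltjes_esd_le[OF that z])+
  have si: "integrable M s" and ti: "integrable M t"
    using integrable_bounded[OF m(1) sb] integrable_bounded[OF m(2) tb] by auto
  define e where "e = (\<integral>\<omega>. cmod (s \<omega> - t \<omega>) \<partial>M)"
  let ?A = "{\<omega> \<in> space M. excess K \<omega> > \<epsilon>}"
  have A: "?A \<in> events" by measurable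
  have "e \<le> (\<integral>\<omega>. sqrt \<epsilon> / (Im z)\<^sup>2 + 2 / \<bar>Im z\<bar> * indicator ?A \<omega> \<partial>M)"
    unfolding e_def
  proof (rule integral_mono)
    show "integrable M (\<lambda>\<omega>. cmod (s \<omega> - t \<omega>))" using si ti by simp
    show "integrable M (\<lambda>\<omega>. sqrt \<epsilon> / (Im z)\<^sup>2 + 2 / \<bar>Im z\<bar> * indicator ?A \<omega>)"
      using A by (intro Bochner_Integration.integrable_add integrable_mult_right) (auto simp: emeasure_eq_measure)
    fix \<omega> assume \<omega>: "\<omega> \<in> space M"
    show "cmod (s \<omega> - t \<omega>) \<le> sqrt \<epsilon> / (Im z)\<^sup>2 + 2 / \<bar>Im z\<bar> * indicator ?A \<omega>"
    proof (cases "excess K \<omega> > \<epsilon>")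
      case True
      have "cmod (s \<omega> - t \<omega>) \<le> 2 / \<bar>Im z\<bar>"
        using norm_triangle_ineq4[of "s \<omega>" "t \<omega>"] sb[OF \<omega>] tb[OF \<omega>] by simp
      moreover have "0 \<le> sqrt \<epsilon> / (Im z)\<^sup>2" using \<epsilon> by simp
      ultimately show ?thesis using True \<omega> by simp
    next
      case False
      have "cmod (s \<omega> - t \<omega>) \<le> sqrt (excess K \<omega>) / (Im z)\<^sup>2"
        unfolding s_def t_def by (rule stieltjes_truncation_le[OF \<omega> z])
      also have "\<dots> \<le> sqrt \<epsilon> / (Im z)\<^sup>2" using False by (intro divide_right_mono) auto
      finally show ?thesis using False by simp
    qed
  qed
  also have "\<dots> = sqrt \<epsilon> / (Im z)\<^sup>2 + 2 / \<bar>Im z\<bar> * prob ?A"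
    using A by (subst Bochner_Integration.integral_add) (auto simp: emeasure_eq_measure prob_space)
  finally have e: "e \<le> sqrt \<epsilon> / (Im z)\<^sup>2 + 2 / \<bar>Im z\<bar> * prob ?A" .
  let ?s = "\<integral>\<omega>. s \<omega> \<partial>M" and ?t = "\<integral>\<omega>. t \<omega> \<partial>M"
  have "cmod (?s - ?t) \<le> e"
    using integral_norm_bound[of M "\<lambda>\<omega>. s \<omega> - t \<omega>"] si ti by (simp add: e_def)
  \<comment> \<open>The truncation error enters twice, once for the transform and once for its mean,
    whence the factor 2 in the claim.\<close>
  have "(\<integral>\<omega>. cmod (s \<omega> - ?s) \<partial>M) \<le> (\<integral>\<omega>. cmod (s \<omega> - t \<omega>) + cmod (t \<omega> - ?t) + cmod (?s - ?t) \<partial>M)"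
  proof (rule integral_mono)
    fix \<omega>
    have "s \<omega> - ?s = (s \<omega> - t \<omega>) + (t \<omega> - ?t) - (?s - ?t)" by simp
    then show "cmod (s \<omega> - ?s) \<le> cmod (s \<omega> - t \<omega>) + cmod (t \<omega> - ?t) + cmod (?s - ?t)"
      by (simp only:) (intro order_trans[OF norm_triangle_ineq4] add_right_mono norm_triangle_ineq)
  qed (use si ti in simp_all)
  also have "\<dots> = e + (\<integral>\<omega>. cmod (t \<omega> - ?t) \<partial>M) + cmod (?s - ?t)"
    using si ti by (simp add: e_def prob_space)
  finally have "(\<integral>\<omega>. cmod (s \<omega> - ?s) \<partial>M) \<le> e + (\<integral>\<omega>. cmod (t \<omega> - ?t) \<partial>M) + cmod (?s - ?t)" .
  moreover have "(\<integral>\<omega>. cmod (t \<omega> - ?t) \<partial>M) \<le> 2 * sqrt (var_const K z * (real d / (real n)\<^sup>2))"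
    using L1_truncated_le[OF z K, folded t_def] by simp
  ultimately show ?thesis
    using \<open>cmod (?s - ?t) \<le> e\<close> e by argo
qed

text \<open>Chebyshev for the eigenvalues: a fraction of at most tr (Y Y) / (n T^2) of them exceeds
  T in modulus. The mean of this trace may be infinite, so it is used only where the excess is at
  most 1; elsewhere the fraction is bounded by 1.\<close>

lemma mean_tail_le:
  assumes T: "0 < T" and K: "0 \<le> K"
  shows "measure (mean_measure M (\<lambda>\<omega>. esd (Y \<omega>))) {x. T \<le> \<bar>x\<bar>} \<le>
    prob {\<omega> \<in> space M. excess K \<omega> > 1} + (K\<^sup>2 + 1) / T\<^sup>2"
proof -
  let ?A = "{\<omega> \<in> space M. excess K \<omega> > 1}" and ?S = "{x::real. T \<le> \<bar>x\<bar>}"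
  have A: "?A \<in> events" by measurable
  have S: "?S \<in> sets borel" by measurable
  interpret m: real_distribution "mean_measure M (\<lambda>\<omega>. esd (Y \<omega>))" by (rule Y.real_distribution_mean)
  have "measure (mean_measure M (\<lambda>\<omega>. esd (Y \<omega>))) ?S = (\<integral>x. indicator ?S x \<partial>mean_measure M (\<lambda>\<omega>. esd (Y \<omega>)))"
    using S by simp
  also have "\<dots> = (\<integral>\<omega>. (\<integral>x. indicator ?S x \<partial>esd (Y \<omega>)) \<partial>M)"
    using S by (intro Y.integral_mean_measure[where B=1]) auto
  also have "\<dots> \<le> (\<integral>\<omega>. indicator ?A \<omega> + (K\<^sup>2 + 1) / T\<^sup>2 \<partial>M)"
  proof (rule integral_mono_AE')
    show "integrable M (\<lambda>\<omega>. indicator ?A \<omega> + (K\<^sup>2 + 1) / T\<^sup>2)"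
      using A by (intro Bochner_Integration.integrable_add) (auto simp: emeasure_eq_measure)
    show "AE \<omega> in M. (\<integral>x. indicator ?S x \<partial>esd (Y \<omega>)) \<le> indicator ?A \<omega> + (K\<^sup>2 + 1) / T\<^sup>2"
    proof (rule AE_I2)
      fix \<omega> assume \<omega>: "\<omega> \<in> space M"
      then interpret e: real_distribution "esd (Y \<omega>)" by (rule Y.real_distribution_Y)
      show "(\<integral>x. indicator ?S x \<partial>esd (Y \<omega>)) \<le> indicator ?A \<omega> + (K\<^sup>2 + 1) / T\<^sup>2"
      proof (cases "excess K \<omega> > 1")
        case True
        have "(\<integral>x. indicator ?S x \<partial>esd (Y \<omega>)) \<le> (1::real)" using S e.prob_le_1 by simp
        moreover have "0 \<le> (K\<^sup>2 + 1) / T\<^sup>2" by simp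
        moreover have "indicator ?A \<omega> = (1::real)" using True \<omega> by simp
        ultimately show ?thesis by linarith
      next
        case False
        have "(\<integral>x. indicator ?S x \<partial>esd (Y \<omega>)) = (\<Sum>i<n. indicator ?S (eigvals (Y \<omega>) ! i) :: real) /\<^sub>R real n"
          using S by (intro integral_esd[OF hermitian_Y[OF \<omega>] n_pos, of "indicator ?S"]) simp
        also have "\<dots> \<le> (\<Sum>i<n. (eigvals (Y \<omega>) ! i)\<^sup>2 / T\<^sup>2) /\<^sub>R real n"
        proof (intro scaleR_left_mono sum_mono)
          fix i
          show "indicator ?S (eigvals (Y \<omega>) ! i) \<le> (eigvals (Y \<omega>) ! i)\<^sup>2 / T\<^sup>2"
            using T by (auto simp: indicator_def divide_simps abs_le_square_iff[symmetric])
        qed simp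
        also have "\<dots> = frob_sq (Y \<omega>) / T\<^sup>2 / n"
          by (simp add: sum_squares_eigvals[OF hermitian_Y[OF \<omega>]] divide_inverse mult_ac flip: sum_divide_distrib sum_distrib_left)
        also have "\<dots> \<le> (n * (K\<^sup>2 + 1)) / T\<^sup>2 / n"
        proof (intro divide_right_mono)
          have "frob_sq (Y \<omega>) \<le> n * (K\<^sup>2 + excess K \<omega>)" by (rule frob_sq_Y_le[OF \<omega> K])
          also have "\<dots> \<le> n * (K\<^sup>2 + 1)" using False by (intro mult_left_mono) auto
          finally show "frob_sq (Y \<omega>) \<le> n * (K\<^sup>2 + 1)" by simp
        qed auto
        also have "\<dots> = (K\<^sup>2 + 1) / T\<^sup>2" using n_pos by simp
        finally show ?thesis using False by simp
      qed
    qed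
  qed auto
  also have "\<dots> = prob ?A + (K\<^sup>2 + 1) / T\<^sup>2"
    using A by (subst Bochner_Integration.integral_add) (auto simp: emeasure_eq_measure prob_space)
  finally show ?thesis .
qed

end

section \<open>Concentration in metrics for weak convergence\<close>

lemma metrizes_weak_convD:
  assumes "metrizes_weak_conv \<rho>"
  shows "\<And>\<mu> \<nu>. real_distribution \<mu> \<Longrightarrow> real_distribution \<nu> \<Longrightarrow> \<rho> \<mu> \<nu> = \<rho> \<nu> \<mu>"
    "\<And>\<mu> \<nu> \<eta>. real_distribution \<mu> \<Longrightarrow> real_distribution \<nu> \<Longrightarrow> real_distribution \<eta> \<Longrightarrow>
        \<rho> \<mu> \<eta> \<le> \<rho> \<mu> \<nu> + \<rho> \<nu> \<eta>"
    "\<And>\<nu> \<mu>. (\<And>k. real_distribution (\<nu> k)) \<Longrightarrow> real_distribution \<mu> \<Longrightarrow> weak_conv_m \<nu> \<mu> \<Longrightarrow>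
        (\<lambda>k. \<rho> (\<nu> k) \<mu>) \<longlonglongrightarrow> 0"
  using assms unfolding metrizes_weak_conv_def by blast+

text \<open>By the triangle inequality the distance to a fixed law is weakly continuous; this is
  what makes the random distance measurable.\<close>

lemma metrizes_weak_conv_tendsto:
  assumes \<rho>: "metrizes_weak_conv \<rho>" and \<nu>: "\<And>k. real_distribution (\<nu> k)" and \<nu>': "real_distribution \<nu>'"
    and \<mu>: "real_distribution \<mu>" and conv: "weak_conv_m \<nu> \<nu>'"
  shows "(\<lambda>k. \<rho> (\<nu> k) \<mu>) \<longlonglongrightarrow> \<rho> \<nu>' \<mu>"
proof (rule LIM_zero_cancel, rule Lim_null_comparison)
  note D = metrizes_weak_convD[OF \<rho>]
  show "(\<lambda>k. \<rho> (\<nu> k) \<nu>') \<longlonglongrightarrow> 0" by (rule D(3)[OF \<nu> \<nu>' conv])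
  have "\<bar>\<rho> (\<nu> k) \<mu> - \<rho> \<nu>' \<mu>\<bar> \<le> \<rho> (\<nu> k) \<nu>'" for k
    using D(2)[OF \<nu>[of k] \<nu>' \<mu>] D(2)[OF \<nu>' \<nu>[of k] \<mu>] D(1)[OF \<nu>[of k] \<nu>'] by linarith
  then show "\<forall>\<^sub>F k in sequentially. norm (\<rho> (\<nu> k) \<mu> - \<rho> \<nu>' \<mu>) \<le> \<rho> (\<nu> k) \<nu>'" by simp
qed

text \<open>Every \<open>\<rho>\<close>-ball contains a neighbourhood given by finitely many Stieltjes transforms: otherwise
  some sequence outside the ball would converge at a countable dense set of points.\<close>
lemma metric_ball_contains_stieltjes_nbhd:
  assumes \<rho>: "metrizes_weak_conv \<rho>" and \<mu>: "real_distribution \<mu>" and \<epsilon>: "0 < \<epsilon>"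
  shows "\<exists>J \<delta>. finite J \<and> (\<forall>z\<in>J. Im z \<noteq> 0) \<and> 0 < \<delta> \<and>
    (\<forall>\<nu>. real_distribution \<nu> \<longrightarrow> (\<forall>z\<in>J. cmod (stieltjes \<nu> z - stieltjes \<mu> z) < \<delta>) \<longrightarrow> \<rho> \<nu> \<mu> < \<epsilon>)"
proof (rule ccontr)
  assume no: "\<not> ?thesis"
  obtain D :: "complex set" where D: "countable D" "\<And>X. open X \<Longrightarrow> X \<noteq> {} \<Longrightarrow> \<exists>d\<in>D. d \<in> X"
    by (rule countable_dense_setE) blast
  \<comment> \<open>The nonreal ones among the first \<open>k\<close> points of an enumeration of
    the dense set; with tolerance 1/(k+1) every nonreal point of \<open>D\<close> is eventually
    controlled.\<close>
  define J where "J k = {z \<in> from_nat_into D ` {..<k}. Im z \<noteq> 0}" for k :: nat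
  have "\<exists>\<nu>. real_distribution \<nu> \<and> (\<forall>z\<in>J k. cmod (stieltjes \<nu> z - stieltjes \<mu> z) < 1 / real (Suc k)) \<and> \<epsilon> \<le> \<rho> \<nu> \<mu>" for k
  proof -
    have "finite (J k)" "\<forall>z\<in>J k. Im z \<noteq> 0" "0 < 1 / real (Suc k)" by (auto simp: J_def)
    with no show ?thesis by (meson not_less)
  qed
  then obtain \<nu> where \<nu>: "\<And>k. real_distribution (\<nu> k)"
    "\<And>k z. z \<in> J k \<Longrightarrow> cmod (stieltjes (\<nu> k) z - stieltjes \<mu> z) < 1 / real (Suc k)" "\<And>k. \<epsilon> \<le> \<rho> (\<nu> k) \<mu>"
    by metis
  have "(\<lambda>k. stieltjes (\<nu> k) z) \<longlonglongrightarrow> stieltjes \<mu> z" if z: "z \<in> D" "Im z \<noteq> 0" for z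
  proof (rule LIM_zero_cancel, rule Lim_null_comparison)
    obtain i where i: "z = from_nat_into D i" using from_nat_into_surj[OF D(1) z(1)] by metis
    have "z \<in> J k" if "k > i" for k using that i z by (auto simp: J_def)
    then show "\<forall>\<^sub>F k in sequentially. norm (stieltjes (\<nu> k) z - stieltjes \<mu> z) \<le> 1 / real (Suc k)"
      using \<nu>(2) by (intro eventually_mono[OF eventually_gt_at_top[of i]]) (auto intro: less_imp_le)
    show "(\<lambda>k. 1 / real (Suc k)) \<longlonglongrightarrow> 0" by real_asymp
  qed
  from stieltjes_conv_dense[OF \<nu>(1) \<mu> D(2) this]
  have "weak_conv_m \<nu> \<mu>" by (intro stieltjes_conv_imp_weak_conv \<nu> \<mu>)
  then have "(\<lambda>k. \<rho> (\<nu> k) \<mu>) \<longlonglongrightarrow> 0" by (intro metrizes_weak_convD[OF \<rho>] \<nu> \<mu>)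
  from order_tendstoD(2)[OF this \<epsilon>] \<nu>(3) show False
    by (auto simp: eventually_sequentially not_less[symmetric])
qed

text \<open>The iterated limit reduces to one truncation level that works for all large n.\<close>

lemma property_L_eventually:
  assumes L: "property_L M X" and \<epsilon>: "0 < \<epsilon>" and \<delta>: "0 < \<delta>"
  obtains K where "0 \<le> K" "\<forall>\<^sub>F n in sequentially. measure (M n) {\<omega> \<in> space (M n).
         (\<Sum>i<n. \<Sum>j<n. (cmod (X n \<omega> $$ (i,j)))\<^sup>2 * indicator {K<..} (cmod (X n \<omega> $$ (i,j))))
           / (real n)\<^sup>2 > \<epsilon>} < \<delta>"
proof -
  let ?m = "\<lambda>K n. measure (M n) {\<omega> \<in> space (M n).
         (\<Sum>i<n. \<Sum>j<n. (cmod (X n \<omega> $$ (i,j)))\<^sup>2 * indicator {K<..} (cmod (X n \<omega> $$ (i,j))))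
           / (real n)\<^sup>2 > \<epsilon>}"
  have "((\<lambda>K. limsup (\<lambda>n. ereal (?m K n))) \<longlongrightarrow> 0) at_top"
    using L \<epsilon> unfolding property_L_def by blast
  then have "\<forall>\<^sub>F K in at_top. limsup (\<lambda>n. ereal (?m K n)) < ereal \<delta>"
    by (rule order_tendstoD) (use \<delta> in simp)
  then have "\<forall>\<^sub>F K in at_top. limsup (\<lambda>n. ereal (?m K n)) < ereal \<delta> \<and> 0 \<le> K"
    by (rule eventually_conj[OF _ eventually_ge_at_top])
  then obtain K where K: "limsup (\<lambda>n. ereal (?m K n)) < ereal \<delta>" "0 \<le> K"
    by (auto dest!: eventually_happens'[OF trivial_limit_at_top_linorder])
  have "\<forall>\<^sub>F n in sequentially. ereal (?m K n) < ereal \<delta>" by (rule Limsup_lessD[OF K(1)])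
  then show ?thesis using that[OF K(2)] by simp
qed

section \<open>Sequences of matrices with independent blocks\<close>

locale block_matrix_sequence =
  fixes M :: "nat \<Rightarrow> 'a measure" and X :: "nat \<Rightarrow> 'a \<Rightarrow> complex mat" and d :: "nat \<Rightarrow> nat"
  assumes prob: "\<And>n. prob_space (M n)"
    and herm: "\<And>n \<omega>. \<omega> \<in> space (M n) \<Longrightarrow> hermitian_mat n (X n \<omega>)"
    and meas: "\<And>n i j. i < n \<Longrightarrow> j < n \<Longrightarrow> (\<lambda>\<omega>. X n \<omega> $$ (i,j)) \<in> borel_measurable (M n)"
    and S: "\<And>n. satisfies_S (M n) n n (X n) (d n)"
    and d_small: "(\<lambda>n. real (d n)) \<in> o(\<lambda>n. (real n)\<^sup>2)"
    and L: "property_L M X"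
begin

definition LL :: "nat \<Rightarrow> 'a \<Rightarrow> real measure" where
  "LL n \<omega> = esd (complex_of_real (1 / sqrt (real n)) \<cdot>\<^sub>m X n \<omega>)"

definition EL :: "nat \<Rightarrow> real measure" where
  "EL n = mean_measure (M n) (LL n)"

lemma block: "0 < n \<Longrightarrow> block_matrix (M n) n (d n) (X n)"
  using prob herm meas S by (simp add: block_matrix_def block_matrix_axioms_def)

lemma LL_eq: "0 < n \<Longrightarrow> LL n = (\<lambda>\<omega>. esd (block_matrix.Y n (X n) \<omega>))"
  by (simp add: LL_def fun_eq_iff block_matrix.Y_def[OF block])

lemma random_hermitian: "0 < n \<Longrightarrow> random_hermitian (M n) n (block_matrix.Y n (X n))"
  by (rule block_matrix.random_hermitian_Y[OF block])

lemma real_distribution_LL: "0 < n \<Longrightarrow> \<omega> \<in> space (M n) \<Longrightarrow> real_distribution (LL n \<omega>)"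
  by (simp add: LL_eq random_hermitian.real_distribution_Y[OF random_hermitian])

lemma real_distribution_EL: "0 < n \<Longrightarrow> real_distribution (EL n)"
  unfolding EL_def by (simp add: LL_eq random_hermitian.real_distribution_mean[OF random_hermitian])

text \<open>For n = 0 the only Hermitian matrix is the empty one, so the distance is constant. The
  law \<mu> is constrained for positive n only, so that \<open>EL n\<close> can be inserted for
  every n.\<close>

lemma measurable_metric_LL:
  assumes \<rho>: "metrizes_weak_conv \<rho>" and \<mu>: "0 < n \<Longrightarrow> real_distribution \<mu>"
  shows "(\<lambda>\<omega>. \<rho> (LL n \<omega>) \<mu>) \<in> borel_measurable (M n)"
proof (cases "n = 0")
  case True
  have "LL n \<omega> = esd (1\<^sub>m 0)" if "\<omega> \<in> space (M n)" for \<omega>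
  proof -
    have "complex_of_real (1 / sqrt (real n)) \<cdot>\<^sub>m X n \<omega> = 1\<^sub>m 0"
      using hermitian_matD[OF herm[OF that]] True by (intro eq_matI) auto
    then show ?thesis by (simp only: LL_def)
  qed
  then show ?thesis by (simp cong: measurable_cong)
next
  case False
  then have n: "0 < n" by simp
  show ?thesis
    unfolding LL_eq[OF n]
    by (rule random_hermitian.measurable_of_weakly_continuous[OF random_hermitian[OF n]])
      (rule metrizes_weak_conv_tendsto[OF \<rho> _ _ \<mu>[OF n]])
qed

definition dev :: "complex \<Rightarrow> nat \<Rightarrow> real" where
  "dev z n = (\<integral>\<omega>. cmod (stieltjes (LL n \<omega>) z - stieltjes (EL n) z) \<partial>M n)"

lemma stieltjes_EL: "0 < n \<Longrightarrow> Im z \<noteq> 0 \<Longrightarrow> stieltjes (EL n) z = (\<integral>\<omega>. stieltjes (LL n \<omega>) z \<partial>M n)"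
  unfolding EL_def by (simp add: LL_eq random_hermitian.stieltjes_mean_measure[OF random_hermitian])

lemma d_ratio: "(\<lambda>n. real (d n) / (real n)\<^sup>2) \<longlonglongrightarrow> 0"
  using smalloD_tendsto[OF d_small] .

lemma dev_tendsto_0:
  assumes z: "Im z \<noteq> 0"
  shows "dev z \<longlonglongrightarrow> 0"
proof (rule order_tendstoI)
  fix a :: real assume "a < 0"
  moreover have "0 \<le> dev z n" for n by (simp add: dev_def)
  ultimately show "\<forall>\<^sub>F n in sequentially. a < dev z n" by (intro always_eventually allI) (rule order.strict_trans2)
next
  fix r :: real assume r: "0 < r"
  \<comment> \<open>Both truncation contributions are set to r / 8, by \<epsilon> here and by
    \<delta> below; doubled they give r / 2, and the variance term adds less than r / 4.\<close>
  define \<epsilon> where "\<epsilon> = (r * (Im z)\<^sup>2 / 8)\<^sup>2"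
  have \<epsilon>: "0 < \<epsilon>" using r z by (simp add: \<epsilon>_def)
  have s\<epsilon>: "sqrt \<epsilon> / (Im z)\<^sup>2 = r / 8" using r z by (simp add: \<epsilon>_def)
  define \<delta> where "\<delta> = r * \<bar>Im z\<bar> / 16"
  have \<delta>: "0 < \<delta>" using r z by (simp add: \<delta>_def)
  obtain K where K: "0 \<le> K" and ev: "\<forall>\<^sub>F n in sequentially. measure (M n) {\<omega> \<in> space (M n).
         (\<Sum>i<n. \<Sum>j<n. (cmod (X n \<omega> $$ (i,j)))\<^sup>2 * indicator {K<..} (cmod (X n \<omega> $$ (i,j))))
           / (real n)\<^sup>2 > \<epsilon>} < \<delta>"
    by (rule property_L_eventually[OF L \<epsilon> \<delta>])
  have "(\<lambda>n. 2 * sqrt (var_const K z * (real (d n) / (real n)\<^sup>2))) \<longlonglongrightarrow> 2 * sqrt (var_const K z * 0)"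
    by (intro tendsto_intros d_ratio)
  then have "\<forall>\<^sub>F n in sequentially. 2 * sqrt (var_const K z * (real (d n) / (real n)\<^sup>2)) < r / 4"
    by (rule order_tendstoD) (use r in simp)
  with ev eventually_gt_at_top[of 0] show "\<forall>\<^sub>F n in sequentially. dev z n < r"
  proof eventually_elim
    case (elim n)
    interpret b: block_matrix "M n" n "d n" "X n" by (rule block[OF elim(2)])
    have p: "b.prob {\<omega> \<in> space (M n). \<epsilon> < b.excess K \<omega>} < \<delta>"
      using elim(1) by (simp add: b.excess_def)
    have "dev z n \<le> 2 * (sqrt \<epsilon> / (Im z)\<^sup>2 + 2 / \<bar>Im z\<bar> * b.prob {\<omega> \<in> space (M n). \<epsilon> < b.excess K \<omega>})
      + 2 * sqrt (var_const K z * (real (d n) / (real n)\<^sup>2))"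
      unfolding dev_def stieltjes_EL[OF elim(2) z] LL_eq[OF elim(2)] by (rule b.L1_stieltjes_le[OF z K \<epsilon>])
    also have "\<dots> \<le> 2 * (r / 8 + 2 / \<bar>Im z\<bar> * \<delta>) + 2 * sqrt (var_const K z * (real (d n) / (real n)\<^sup>2))"
      unfolding s\<epsilon> using p by (intro add_right_mono mult_left_mono add_left_mono) auto
    also have "2 / \<bar>Im z\<bar> * \<delta> = r / 8" using z by (simp add: \<delta>_def)
    finally show ?case using elim(3) r by simp
  qed
qed

text \<open>The index is shifted because \<open>EL 0\<close> is not a probability measure. One level
  K from property L serves all large n, and the scale T is then chosen to make the Chebyshev term
  \<epsilon> / 2.\<close>

lemma tight_EL: "tight (\<lambda>k. EL (Suc k))"
proof (rule tightI_eventually)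
  show "real_distribution (EL (Suc k))" for k by (rule real_distribution_EL) simp
  fix \<epsilon> :: real assume \<epsilon>: "0 < \<epsilon>"
  obtain K where K: "0 \<le> K" and ev: "\<forall>\<^sub>F n in sequentially. measure (M n) {\<omega> \<in> space (M n).
         (\<Sum>i<n. \<Sum>j<n. (cmod (X n \<omega> $$ (i,j)))\<^sup>2 * indicator {K<..} (cmod (X n \<omega> $$ (i,j))))
           / (real n)\<^sup>2 > 1} < \<epsilon> / 2"
    by (rule property_L_eventually[OF L, of 1 "\<epsilon> / 2"]) (use \<epsilon> in auto)
  define c where "c = K\<^sup>2 + 1"
  have c: "0 < c" using zero_le_power2[of K] by (simp add: c_def add_nonneg_pos)
  define T where "T = sqrt (2 * c / \<epsilon>)"
  have T: "0 < T" using \<epsilon> c by (simp add: T_def)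
  have "c / T\<^sup>2 = \<epsilon> / 2" using \<epsilon> c by (simp add: T_def)
  then have T2: "(K\<^sup>2 + 1) / T\<^sup>2 = \<epsilon> / 2" by (simp only: c_def)
  have "\<forall>\<^sub>F n in sequentially. measure (EL n) {x. T \<le> \<bar>x\<bar>} < \<epsilon>"
    using ev eventually_gt_at_top[of 0]
  proof eventually_elim
    case (elim n)
    interpret b: block_matrix "M n" n "d n" "X n" by (rule block[OF elim(2)])
    have "b.prob {\<omega> \<in> space (M n). 1 < b.excess K \<omega>} < \<epsilon> / 2"
      using elim(1) by (simp add: b.excess_def)
    then show ?case
      using b.mean_tail_le[OF T K] unfolding EL_def LL_eq[OF elim(2)] T2 by linarith
  qed
  then have "\<forall>\<^sub>F k in sequentially. measure (EL (Suc k)) {x. T \<le> \<bar>x\<bar>} < \<epsilon>"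
    by (subst eventually_sequentially_Suc)
  with T show "\<exists>\<eta>>0. \<forall>\<^sub>F k in sequentially. measure (EL (Suc k)) {x. \<eta> \<le> \<bar>x\<bar>} < \<epsilon>" by blast
qed

text \<open>Around the fixed limit \<mu> the ball contains a neighbourhood given by finitely many
  Stieltjes values, so a union bound and Markov's inequality reduce the claim to \<open>dev\<close>
  and to convergence of the mean transforms. Stated along subsequences because both conclusions of
  the theorem draw on it.\<close>

lemma metric_tendsto_0:
  assumes \<rho>: "metrizes_weak_conv \<rho>" and \<mu>: "real_distribution \<mu>"
    and r: "strict_mono r" "\<And>k. 0 < r k" and conv: "weak_conv_m (\<lambda>k. EL (r k)) \<mu>" and \<epsilon>: "0 < \<epsilon>"
  shows "(\<lambda>k. measure (M (r k)) {\<omega> \<in> space (M (r k)). \<epsilon> \<le> \<rho> (LL (r k) \<omega>) \<mu>}) \<longlonglongrightarrow> 0"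
proof -
  obtain J \<delta> where J: "finite J" "\<forall>z\<in>J. Im z \<noteq> 0" and \<delta>: "0 < \<delta>"
    and nb: "\<forall>\<nu>. real_distribution \<nu> \<longrightarrow> (\<forall>z\<in>J. cmod (stieltjes \<nu> z - stieltjes \<mu> z) < \<delta>) \<longrightarrow> \<rho> \<nu> \<mu> < \<epsilon>"
    using metric_ball_contains_stieltjes_nbhd[OF \<rho> \<mu> \<epsilon>] by (elim exE conjE)
  define U where "U k = (\<Sum>z\<in>J. (dev z (r k) + cmod (stieltjes (EL (r k)) z - stieltjes \<mu> z)) / \<delta>)" for k
  have "(\<lambda>k. (dev z (r k) + cmod (stieltjes (EL (r k)) z - stieltjes \<mu> z)) / \<delta>) \<longlonglongrightarrow> (0 + cmod (stieltjes \<mu> z - stieltjes \<mu> z)) / \<delta>"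
    if z: "z \<in> J" for z
  proof (intro tendsto_intros)
    show "(\<lambda>k. dev z (r k)) \<longlonglongrightarrow> 0"
      using LIMSEQ_subseq_LIMSEQ[OF dev_tendsto_0[OF J(2)[rule_format, OF z]] r(1)] by (simp add: comp_def)
    show "(\<lambda>k. stieltjes (EL (r k)) z) \<longlonglongrightarrow> stieltjes \<mu> z"
      by (rule weak_conv_imp_stieltjes_conv[OF real_distribution_EL[OF r(2)] \<mu> conv J(2)[rule_format, OF z]])
  qed (use \<delta> in simp)
  then have "U \<longlonglongrightarrow> (\<Sum>z\<in>J. (0 + cmod (stieltjes \<mu> z - stieltjes \<mu> z)) / \<delta>)"
    unfolding U_def by (intro tendsto_sum)
  then have U: "U \<longlonglongrightarrow> 0" by simp
  show ?thesis
  proof (rule Lim_null_comparison[OF always_eventually[OF allI] U])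
    fix k
    let ?n = "r k"
    interpret prob_space "M ?n" by (rule prob)
    note n = r(2)[of k]
    let ?A = "\<lambda>z. {\<omega> \<in> space (M ?n). \<delta> \<le> cmod (stieltjes (LL ?n \<omega>) z - stieltjes \<mu> z)}"
    have m: "(\<lambda>\<omega>. stieltjes (LL ?n \<omega>) z) \<in> borel_measurable (M ?n)" if "z \<in> J" for z
      unfolding LL_eq[OF n] by (rule random_hermitian.measurable_stieltjes_esd[OF random_hermitian[OF n] J(2)[rule_format, OF that]])
    have A: "?A z \<in> events" if "z \<in> J" for z
      using m[OF that] by measurable
    have "prob {\<omega> \<in> space (M ?n). \<epsilon> \<le> \<rho> (LL ?n \<omega>) \<mu>} \<le> prob (\<Union>z\<in>J. ?A z)"
    proof (rule finite_measure_mono)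
      show "{\<omega> \<in> space (M ?n). \<epsilon> \<le> \<rho> (LL ?n \<omega>) \<mu>} \<subseteq> (\<Union>z\<in>J. ?A z)"
        using nb real_distribution_LL[OF n] by (force simp: not_less[symmetric])
      show "(\<Union>z\<in>J. ?A z) \<in> events" using A J(1) by auto
    qed
    also have "\<dots> \<le> (\<Sum>z\<in>J. prob (?A z))"
      using A J(1) by (intro finite_measure_subadditive_finite) auto
    also have "\<dots> \<le> U k"
      unfolding U_def
    proof (rule sum_mono)
      fix z assume zJ: "z \<in> J"
      note z = J(2)[rule_format, OF zJ]
      have b: "cmod (stieltjes (LL ?n \<omega>) z) \<le> 1 / \<bar>Im z\<bar>" if "\<omega> \<in> space (M ?n)" for \<omega>
        by (rule real_distribution.norm_stieltjes_le[OF real_distribution_LL[OF n that] z])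
      have i: "integrable (M ?n) (\<lambda>\<omega>. stieltjes (LL ?n \<omega>) z)"
        by (rule integrable_bounded[OF m[OF zJ] b])
      have "prob (?A z) \<le> (\<integral>\<omega>. cmod (stieltjes (LL ?n \<omega>) z - stieltjes \<mu> z) \<partial>M ?n) / \<delta>"
        using i \<delta> by (intro integral_Markov_inequality_measure[where A="{}"]) auto
      also have "(\<integral>\<omega>. cmod (stieltjes (LL ?n \<omega>) z - stieltjes \<mu> z) \<partial>M ?n) \<le>
          (\<integral>\<omega>. cmod (stieltjes (LL ?n \<omega>) z - stieltjes (EL ?n) z) + cmod (stieltjes (EL ?n) z - stieltjes \<mu> z) \<partial>M ?n)"
      proof (rule integral_mono)
        fix \<omega>
        show "cmod (stieltjes (LL ?n \<omega>) z - stieltjes \<mu> z) \<le>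
          cmod (stieltjes (LL ?n \<omega>) z - stieltjes (EL ?n) z) + cmod (stieltjes (EL ?n) z - stieltjes \<mu> z)"
          using norm_triangle_ineq[of "stieltjes (LL ?n \<omega>) z - stieltjes (EL ?n) z" "stieltjes (EL ?n) z - stieltjes \<mu> z"] by simp
      qed (use i in simp_all)
      also have "\<dots> = dev z ?n + cmod (stieltjes (EL ?n) z - stieltjes \<mu> z)"
        using i by (simp add: dev_def prob_space)
      finally show "prob (?A z) \<le> (dev z ?n + cmod (stieltjes (EL ?n) z - stieltjes \<mu> z)) / \<delta>"
        using \<delta> by (simp add: divide_right_mono)
    qed
    finally show "norm (prob {\<omega> \<in> space (M ?n). \<epsilon> \<le> \<rho> (LL ?n \<omega>) \<mu>}) \<le> U k" by simp
  qed
qed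

end

theorem theorem2p5:
  fixes M :: "nat \<Rightarrow> 'a measure"
    and X :: "nat \<Rightarrow> 'a \<Rightarrow> complex mat"
    and d :: "nat \<Rightarrow> nat"
    and \<rho> :: "real measure \<Rightarrow> real measure \<Rightarrow> real"
  assumes prob: "\<And>n. prob_space (M n)"
    and herm: "\<And>n \<omega>. \<omega> \<in> space (M n) \<Longrightarrow> hermitian_mat n (X n \<omega>)"
    and meas: "\<And>n i j. i < n \<Longrightarrow> j < n \<Longrightarrow> (\<lambda>\<omega>. X n \<omega> $$ (i,j)) \<in> borel_measurable (M n)"
    and S: "\<And>n. satisfies_S (M n) n n (X n) (d n)"
    and d_small: "(\<lambda>n. real (d n)) \<in> o(\<lambda>n. (real n)\<^sup>2)"
    and L: "property_L M X"
    and rho: "metrizes_weak_conv \<rho>"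
  defines "LL \<equiv> (\<lambda>n \<omega>. esd (complex_of_real (1 / sqrt (real n)) \<cdot>\<^sub>m X n \<omega>))"
  shows "(\<forall>n. (\<lambda>\<omega>. \<rho> (LL n \<omega>) (mean_measure (M n) (LL n))) \<in> borel_measurable (M n)) \<and>
         (\<forall>\<epsilon>>0. (\<lambda>n. measure (M n) {\<omega> \<in> space (M n). \<epsilon> < \<rho> (LL n \<omega>) (mean_measure (M n) (LL n))})
             \<longlonglongrightarrow> 0) \<and>
         (\<forall>\<mu>. real_distribution \<mu> \<longrightarrow> weak_conv_m (\<lambda>n. mean_measure (M n) (LL n)) \<mu> \<longrightarrow>
            (\<forall>n. (\<lambda>\<omega>. \<rho> (LL n \<omega>) \<mu>) \<in> borel_measurable (M n)) \<and>
            (\<forall>\<epsilon>>0. (\<lambda>n. measure (M n) {\<omega> \<in> space (M n). \<epsilon> < \<rho> (LL n \<omega>) \<mu>}) \<longlonglongrightarrow> 0))"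
proof -
  interpret B: block_matrix_sequence M X d
    by (intro block_matrix_sequence.intro prob herm meas S d_small L)
  have LLB: "LL = B.LL" by (simp add: LL_def B.LL_def fun_eq_iff)
  have EB: "mean_measure (M n) (B.LL n) = B.EL n" for n by (simp add: B.EL_def)
  note D = metrizes_weak_convD[OF rho]
  have meas1: "(\<lambda>\<omega>. \<rho> (B.LL n \<omega>) (B.EL n)) \<in> borel_measurable (M n)" for n
    by (rule B.measurable_metric_LL[OF rho B.real_distribution_EL])
  have mono: "measure (M n) A \<le> measure (M n) A'" if "A \<subseteq> A'" "A' \<in> sets (M n)" for n A A'
    using that prob_space.axioms(1)[OF prob] finite_measure.finite_measure_mono by blast
  \<comment> \<open>The centre \<open>B.EL n\<close> varies with n, so
    \<open>metric_tendsto_0\<close> does not apply directly. A subsequence on which the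
    probabilities stay above some \<open>e\<close> is refined until the centres converge.\<close>
  have conv1: "(\<lambda>n. measure (M n) {\<omega> \<in> space (M n). \<epsilon> < \<rho> (B.LL n \<omega>) (B.EL n)}) \<longlonglongrightarrow> 0"
    if \<epsilon>: "0 < \<epsilon>" for \<epsilon>
  proof (rule ccontr)
    define a where "a n = measure (M n) {\<omega> \<in> space (M n). \<epsilon> < \<rho> (B.LL n \<omega>) (B.EL n)}" for n
    assume "\<not> (\<lambda>n. measure (M n) {\<omega> \<in> space (M n). \<epsilon> < \<rho> (B.LL n \<omega>) (B.EL n)}) \<longlonglongrightarrow> 0"
    \<comment> \<open>The shift discards dimension 0, where the laws are not probability
      measures.\<close>
    then have "\<not> (\<lambda>k. a (Suc k)) \<longlonglongrightarrow> 0" unfolding a_def[symmetric] by (subst filterlim_sequentially_Suc)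
    then obtain e where e: "0 < e" "\<And>N. \<exists>k\<ge>N. e \<le> a (Suc k)"
      unfolding LIMSEQ_iff by (auto simp: a_def not_less)
    then have "infinite {k. e \<le> a (Suc k)}" by (simp add: infinite_nat_iff_unbounded_le)
    from infinite_enumerate[OF this] obtain s :: "nat \<Rightarrow> nat" where s: "strict_mono s" "\<And>k. e \<le> a (Suc (s k))" by auto
    \<comment> \<open>Tightness of the mean laws provides the fixed limit around which distances can
      be controlled.\<close>
    obtain t \<mu> where t: "strict_mono t" and \<mu>: "real_distribution \<mu>"
      and conv: "weak_conv_m ((\<lambda>k. B.EL (Suc k)) \<circ> s \<circ> t) \<mu>"
      using tight_imp_convergent_subsubsequence[OF B.tight_EL s(1)] by auto
    define r where "r k = Suc (s (t k))" for k
    have r: "strict_mono r" "\<And>k. 0 < r k"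
      using strict_mono_o[OF s(1) t] by (auto simp: r_def strict_mono_def)
    have conv': "weak_conv_m (\<lambda>k. B.EL (r k)) \<mu>" using conv by (simp add: r_def comp_def)
    have lim: "(\<lambda>k. measure (M (r k)) {\<omega> \<in> space (M (r k)). \<epsilon> / 2 \<le> \<rho> (B.LL (r k) \<omega>) \<mu>}) \<longlonglongrightarrow> 0"
      using \<epsilon> by (intro B.metric_tendsto_0[OF rho \<mu> r conv']) simp
    have "(\<lambda>k. \<rho> (B.EL (r k)) \<mu>) \<longlonglongrightarrow> 0"
      by (rule D(3)[OF B.real_distribution_EL[OF r(2)] \<mu> conv'])
    then have "\<forall>\<^sub>F k in sequentially. \<rho> (B.EL (r k)) \<mu> < \<epsilon> / 2"
      by (rule order_tendstoD) (use \<epsilon> in simp)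
    moreover have "\<forall>\<^sub>F k in sequentially. measure (M (r k)) {\<omega> \<in> space (M (r k)). \<epsilon> / 2 \<le> \<rho> (B.LL (r k) \<omega>) \<mu>} < e"
      by (rule order_tendstoD(2)[OF lim e(1)])
    ultimately have "\<forall>\<^sub>F k in sequentially. False"
    proof eventually_elim
      case (elim k)
      have "a (r k) \<le> measure (M (r k)) {\<omega> \<in> space (M (r k)). \<epsilon> / 2 \<le> \<rho> (B.LL (r k) \<omega>) \<mu>}"
        unfolding a_def
      proof (rule mono)
        show "{\<omega> \<in> space (M (r k)). \<epsilon> < \<rho> (B.LL (r k) \<omega>) (B.EL (r k))} \<subseteq> {\<omega> \<in> space (M (r k)). \<epsilon> / 2 \<le> \<rho> (B.LL (r k) \<omega>) \<mu>}"
        proof clarsimp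
          fix \<omega> assume \<omega>: "\<omega> \<in> space (M (r k))" "\<epsilon> < \<rho> (B.LL (r k) \<omega>) (B.EL (r k))"
          note l = B.real_distribution_LL[OF r(2) \<omega>(1)] and E = B.real_distribution_EL[OF r(2), of k]
          \<comment> \<open>Since the mean law is within \<epsilon> / 2 of \<mu>, a distance above
            \<epsilon> from the mean law leaves more than \<epsilon> / 2 from \<mu>.\<close>
          show "\<epsilon> \<le> \<rho> (B.LL (r k) \<omega>) \<mu> * 2"
            using D(2)[OF l \<mu> E] D(1)[OF \<mu> E] elim(1) \<omega>(2) by linarith
        qed
        show "{\<omega> \<in> space (M (r k)). \<epsilon> / 2 \<le> \<rho> (B.LL (r k) \<omega>) \<mu>} \<in> sets (M (r k))"
          using B.measurable_metric_LL[OF rho \<mu>, of "r k"] by measurable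
      qed
      with elim(2) s(2)[of "t k"] show ?case by (simp add: r_def)
    qed
    then show False by simp
  qed
  have conv2: "(\<lambda>n. measure (M n) {\<omega> \<in> space (M n). \<epsilon> < \<rho> (B.LL n \<omega>) \<mu>}) \<longlonglongrightarrow> 0"
    if \<mu>: "real_distribution \<mu>" and w: "weak_conv_m B.EL \<mu>" and \<epsilon>: "0 < \<epsilon>" for \<mu> \<epsilon>
  proof -
    \<comment> \<open>With a given limit no refinement is required: \<open>metric_tendsto_0\<close>
      is applied along \<open>Suc\<close>, which again skips dimension 0.\<close>
    have "weak_conv_m (\<lambda>k. B.EL (Suc k)) \<mu>"
      using w unfolding weak_conv_m_def weak_conv_def by (auto intro: LIMSEQ_Suc)
    then have "(\<lambda>k. measure (M (Suc k)) {\<omega> \<in> space (M (Suc k)). \<epsilon> \<le> \<rho> (B.LL (Suc k) \<omega>) \<mu>}) \<longlonglongrightarrow> 0"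
      by (intro B.metric_tendsto_0[OF rho \<mu> _ _ _ \<epsilon>, of Suc]) (auto simp: strict_mono_Suc_iff)
    then have "(\<lambda>k. measure (M (Suc k)) {\<omega> \<in> space (M (Suc k)). \<epsilon> < \<rho> (B.LL (Suc k) \<omega>) \<mu>}) \<longlonglongrightarrow> 0"
    proof (rule Lim_null_comparison[rotated], intro always_eventually allI)
      fix k
      have "{\<omega> \<in> space (M (Suc k)). \<epsilon> \<le> \<rho> (B.LL (Suc k) \<omega>) \<mu>} \<in> sets (M (Suc k))"
        using B.measurable_metric_LL[OF rho \<mu>, of "Suc k"] by measurable
      then show "norm (measure (M (Suc k)) {\<omega> \<in> space (M (Suc k)). \<epsilon> < \<rho> (B.LL (Suc k) \<omega>) \<mu>}) \<le>
          measure (M (Suc k)) {\<omega> \<in> space (M (Suc k)). \<epsilon> \<le> \<rho> (B.LL (Suc k) \<omega>) \<mu>}"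
        by (simp, intro mono) auto
    qed
    then show ?thesis by (subst (asm) filterlim_sequentially_Suc)
  qed
  show ?thesis
    unfolding LLB EB using meas1 conv1 conv2 B.measurable_metric_LL[OF rho] by blast
qed

end
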